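(* Let $N$ be an odd positive integer, $W$ a compact closed oriented 3-manifold, $L\subset W$ a link, and $\rho$ an equivalence class of flat principal $B$-bundles on $W$, where $B=B(2,\mathbb{C})$ is the group of upper triangular matrices in $SL(2,\mathbb{C})$. Let $\widehat W$ denote $W$ with the opposite orientation, and let $\rho^*=[z^*]$, where $z$ is a full cocycle (of a decorated distinguished triangulation of $(W,L)$) representing $\rho$ and $z^*$ is its entrywise complex conjugate. Then, $^*$ denoting complex conjugation, $$\big(K_N(W,L,\rho)\big)^*=K_N(\widehat W,L,\rho^* ).$$ Hence, if $\rho$ is real, that is, if it can be represented by $B(2,\mathbb{R})$-valued cocycles ($B(2,\mathbb{R})$ being the group of real matrices in $B$), then $\big(K_N(W,L,\rho)\big)^*=K_N(\widehat W,L,\rho)$. In particular, writing $K_N(W,L)$ for the value of $K_N(W,L,\rho)$ at the trivial flat bundle $\rho$, one has $\big(K_N(W,L)\big)^*=K_N(\widehat W,L)$.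
   Context: **Triangulations.** $W$ is connected. A *triangulation* $T$ of $W$ means a singular triangulation: self-adjacencies and multiple adjacencies of simplices are allowed. $E(T)$, $F(T)$ are the sets of edges and 2-faces of $T$, $r_0$ is the number of vertices of $T$. "Abstract" tetrahedra are the tetrahedra before gluing; $E_\Delta(T)$ is the set of all edges of all abstract tetrahedra, and $\epsilon:E_\Delta(T)\to E(T)$ is the natural identification map. A *distinguished triangulation* $(T,H)$ of $(W,L)$ is a triangulation $T$ of $W$ with a subcomplex $H$ of its 1-skeleton which realizes $L$ and is Hamiltonian: at each vertex of $T$ there are exactly two germs of edges of $H$. **Branching $b$.** A system of orientations of the edges of $T$ such that the edge orientations do not induce an orientation of the boundary of any 2-face; equivalently each abstract tetrahedron $\Delta$ has one source and one sink on its 1-skeleton. It orders the vertices of each $\Delta$ as $v_0,v_1,v_2,v_3$ ($v_i$ has exactly $i$ incoming edges in $\Delta$; edges go from smaller to bigger index). The ordered triple of edges $v_0v_1,v_0v_2,v_0v_3$ orients $\Delta$; the *index* of $\Delta$ is $-1$ if this orientation agrees with that of $W$, and $+1$ otherwise. **Full cocycle $z$.** A $B$-valued cellular 1-cocycle on $T$: a matrix $z(e)=\begin{pmatrix} t(e)&x(e)\\0&t(e)^{-1}\end{pmatrix}$ for each $b$-oriented edge $e$, with $z(v_0v_1)z(v_1v_2)=z(v_0v_2)$ on each 2-face with $b$-ordered vertices $v_0,v_1,v_2$ (reversing an edge inverts the matrix). *Full* means $x(e)\ne 0$ for every edge $e$. Cocycles $z,z'$ are equivalent if $z'(e)=\lambda(v_0)^{-1}z(e)\lambda(v_1)$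 for some function $\lambda$ from vertices to $B$ ($e$ going from $v_0$ to $v_1$); the set of classes $[z]$ is identified with the set of equivalence classes of flat principal $B$-bundles on $W$. **Charge $c$.** Let $U(L)$ be a tubular neighbourhood of $L$ and $M=W\setminus \mathrm{Int}\,U(L)$. Let $P$ be the 2-skeleton of the cell decomposition dual to $T$, and $\widetilde P$ the polyhedron obtained from $P$ by removing the open regions dual to the edges of $H$; it is a spine of $M$, assumed to be standard (i.e. a simple polyhedron all of whose strata are open cells). Its dual is an ideal triangulation $T(\widetilde P)$ of $M$; truncating its tetrahedra at the vertices induces a triangulation $\tau$ of $\partial M$. The tetrahedra of $T(\widetilde P)$ correspond to the vertices of $\widetilde P$, which are vertices of $P$, hence to certain abstract tetrahedra of $T$; in this way a function on $E_\Delta(T)$ assigns integers to the edges of abstract tetrahedra of $T(\widetilde P)$, hence to the vertices of the (abstract) triangles of $\tau$. A curve on $\partial M$ in general position with respect to $\tau$ (resp. in $M$ in general position with respect to $T(\widetilde P)$) has no back-tracking if it never leaves a triangle (resp. tetrahedron) through the edge (resp. face) by which it entered; each time it crosses a triangle (resp. tetrahedron) it selects the vertex (resp. edge) between the entering and departing sides. On $\partial M$ a selected vertex gets the sign $\pm1$ according to whether the oriented curve goes past it positively or negatively with respect to the boundary orientation. On each component of $\partial M$ fix oriented simple closed curves $m_i$ (a meridian of $L_i$) and $l_i$ meeting transversely at one point, without back-tracking. An *integral charge* is a map $c':E_\Delta(T)\to\mathbb{Z}$ such that: (1) for each 2-face of each abstract tetrahedron the sum of $c'$ over its three edges is $1$;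 $\sum_{e'\in\epsilon^{-1}(e)}c'(e')=2$ for $e\in E(T)\setminus E(H)$ and $=0$ for $e\in E(H)$; (2) for each $s\in\{m_i,l_i\}$ the sum of the signed integers assigned by $c'$ to the vertices selected by $s$ is $0$; (3) for every curve $s$ in $M$ without back-tracking with respect to $T(\widetilde P)$ the sum of the integers assigned by $c'$ to the edges selected by $s$ is even. A *charge* is $c:E_\Delta(T)\to\mathbb{Z}/N\mathbb{Z}$ of the form $c\equiv (p+1)c' \bmod N$ with $c'$ an integral charge, where $N=2p+1$ (so $p+1=1/2$ in $\mathbb{Z}/N\mathbb{Z}$). A *decorated distinguished triangulation* is $\mathcal{T}=(T,H,\mathcal{D}=(b,z,c))$ with $(T,H)$ distinguished, $b$ a branching, $z$ a full cocycle, $c$ a charge. A *determination* $d$ of the $N$-th root holding for $z$ is a branch of $w\mapsto w^{1/N}$ on a domain of $\mathbb{C}^*$ containing all the nonzero entries of all the matrices $z(e)$; all $N$-th roots $x(e)^{1/N}$ below are taken with $d$. **Quantum data.** $N=2p+1$, $\omega=\exp(2i\pi/N)$, exponents of $\omega$ are in $\mathbb{Z}/N\mathbb{Z}$ with $1/2:=p+1$; $\delta(n)=1$ if $n\equiv0\bmod N$ and $0$ otherwise. For $x^N+y^N=z^N$, $y\neq0$, put $\Omega(x,y,z\mid n)=\prod_{j=1}^{n}\frac{y}{z-x\omega^j}$, which is $N$-periodic in $n$, and $\Omega(x,y,z\mid m,n)=\Omega(x,y,z\mid m-n)\,\omega^{n^2/2}$. Put $g(x)=\prod_{j=1}^{N-1}(1-x\omega^j)^{j/N}$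 (branch with $g(0)=1$; only $N$-th powers of products of values of $g$ enter the final formula), $h(x)=x^{-p}g(x)/g(1)$, $[x]=N^{-1}\frac{1-x^N}{1-x}$. A *state* is a map $\alpha:F(T)\to\mathbb{Z}/N\mathbb{Z}$. For a tetrahedron $\Delta$ with $b$-ordered vertices $v_0,\dots,v_3$ let $x_{ij}=x(v_iv_j)^{1/N}$, $c_{ij}=c(v_iv_j)$, and $\alpha_k$ the value of $\alpha$ on the face opposite to $v_k$. Set $A=(x_{03}x_{12},\,x_{01}x_{23},\,x_{02}x_{13})$, $A'=(x_{03}x_{12}/\omega,\,x_{01}x_{23},\,x_{02}x_{13})$ and $\nu=h\!\left(\frac{x_{02}x_{13}}{x_{03}x_{12}}\right)$. If $\Delta$ has index $-1$, $$t^\Delta(\mathcal{D},\alpha,d)=(x_{02}x_{13})^p\,\omega^{c_{12}(\alpha_2-\alpha_3)-c_{01}c_{12}/2}\;\nu\;\omega^{\alpha_3\alpha_0}\,\Omega(A\mid\alpha_2-c_{01},\alpha_3)\,\delta(\alpha_2+\alpha_0-\alpha_1),$$ and if $\Delta$ has index $+1$, $$t^\Delta(\mathcal{D},\alpha,d)=(x_{02}x_{13})^p\,\omega^{c_{12}(\alpha_2-\alpha_3)+c_{01}c_{12}/2}\;\frac{\left[\frac{x_{03}x_{12}}{x_{02}x_{13}}\right]}{\nu}\;\omega^{-\alpha_3\alpha_0}\,\frac{\delta(\alpha_2+\alpha_0-\alpha_1)}{\Omega(A'\mid\alpha_2+c_{01},\alpha_3)}.$$ The state sum is $$K_N(\mathcal{T},d)=\Big(N^{-r_0}\sum_{\alpha}\prod_{\Delta}t^{\Delta}(\mathcal{D},\alpha,d)\prod_{e\in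 E(T)\setminus E(H)}x(e)^{-2p/N}\Big)^N ,$$ and $K_N(W,L,\rho)$ denotes the common value of $K_N(\mathcal{T},d)$ over all decorated distinguished triangulations $\mathcal{T}$ of $(W,L)$ with $[z]=\rho$ and all determinations $d$ (such $\mathcal{T}$ exist and the value is independent of the choices). *)

theory Defs
  imports "HOL-Analysis.Analysis" "HOL-Homology.Homology"
begin

section \<open>Oriented closed 3-manifolds and links\<close>

definition closed_3_manifold :: "'w topology \<Rightarrow> bool" where
  "closed_3_manifold W \<longleftrightarrow>
     topspace W \<noteq> {} \<and> compact_space W \<and> connected_space W \<and> Hausdorff_space W \<and>
     (\<forall>y\<in>topspace W. \<exists>U. openin W U \<and> y \<in> U \<and>
        subtopology W U homeomorphic_space Euclidean_space 3)"

text \<open>An orientation is a locally consistent choice of generators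
  \<open>\<mu> y\<close> of the local homology groups \<open>H\<^sub>3(W, W - {y})\<close>.\<close>

definition local_homology :: "'w topology \<Rightarrow> 'w \<Rightarrow> 'w chain set monoid" where
  "local_homology W y = relative_homology_group 3 W (topspace W - {y})"

definition manifold_orientation :: "'w topology \<Rightarrow> ('w \<Rightarrow> 'w chain set) \<Rightarrow> bool" where
  "manifold_orientation W \<mu> \<longleftrightarrow>
     (\<forall>y\<in>topspace W. \<mu> y \<in> carrier (local_homology W y) \<and>
        subgroup_generated (local_homology W y) {\<mu> y} = local_homology W y) \<and>
     (\<forall>y\<in>topspace W. \<exists>U \<kappa>. openin W U \<and> y \<in> U \<and>
        \<kappa> \<in> carrier (relative_homology_group 3 W (topspace W - U)) \<and>
        (\<forall>u\<in>U. hom_induced 3 W (topspace W - U) W (topspace W - {u}) id \<kappa> = \<mu> u))"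

definition opposite_orientation :: "'w topology \<Rightarrow> ('w \<Rightarrow> 'w chain set) \<Rightarrow> 'w \<Rightarrow> 'w chain set" where
  "opposite_orientation W \<mu> y = inv\<^bsub>local_homology W y\<^esub> (\<mu> y)"

text \<open>A link is a nonempty locally flat closed 1-submanifold, i.e. (by compactness) a finite
  disjoint union of tame circles; \<open>topspace (Euclidean_space 1)\<close> is the first coordinate
  axis of \<open>Euclidean_space 3\<close>.\<close>

definition link_in :: "'w topology \<Rightarrow> 'w set \<Rightarrow> bool" where
  "link_in W L \<longleftrightarrow> L \<noteq> {} \<and> closedin W L \<and>
     (\<forall>y\<in>L. \<exists>U h. openin W U \<and> y \<in> U \<and>
        homeomorphic_map (subtopology W U) (Euclidean_space 3) h \<and>
        h ` (U \<inter> L) = topspace (Euclidean_space 1))"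

section \<open>Singular triangulations\<close>

text \<open>An abstract tetrahedron is represented by its characteristic map
  \<open>standard_simplex 3 \<rightarrow> W\<close>, so that its vertices are \<open>0, 1, 2, 3\<close> and its
  faces correspond to the nonempty subsets \<open>I\<close> of \<open>{..3}\<close>.
  The cells of \<open>T\<close> are the images of the open faces.\<close>

type_synonym 'w tet = "(nat \<Rightarrow> real) \<Rightarrow> 'w"

definition open_face :: "nat set \<Rightarrow> (nat \<Rightarrow> real) set" where
  "open_face I = {x \<in> standard_simplex 3. \<forall>i. 0 < x i \<longleftrightarrow> i \<in> I}"

definition closed_face :: "nat set \<Rightarrow> (nat \<Rightarrow> real) set" where
  "closed_face I = {x \<in> standard_simplex 3. \<forall>i. i \<notin> I \<longrightarrow> x i = 0}"

definition simplex_vertex :: "nat \<Rightarrow> nat \<Rightarrow> real" where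
  "simplex_vertex i = (\<lambda>j. if j = i then 1 else 0)"

definition barycentre :: "nat \<Rightarrow> real" where
  "barycentre = (\<lambda>j. if j \<le> 3 then 1/4 else 0)"

text \<open>The maps \<open>\<phi> f\<close>, restricted to a part \<open>S\<close> of the standard simplex, are glued
  along faces by affine isomorphisms and by nothing else. A face may be glued to another face of
  the same tetrahedron.\<close>

definition glued_along_faces ::
    "'w tet set \<Rightarrow> ('w tet \<Rightarrow> (nat \<Rightarrow> real) \<Rightarrow> 'w) \<Rightarrow> (nat \<Rightarrow> real) set \<Rightarrow> bool" where
  "glued_along_faces A \<phi> S \<longleftrightarrow>
     (\<forall>f\<in>A. \<forall>I. I \<subseteq> {..3} \<longrightarrow> inj_on (\<phi> f) (open_face I \<inter> S)) \<and>
     (\<forall>f\<in>A. \<forall>g\<in>A. \<forall>I J. I \<subseteq> {..3} \<and> J \<subseteq> {..3} \<and>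
        \<phi> f ` (open_face I \<inter> S) \<inter> \<phi> g ` (open_face J \<inter> S) \<noteq> {} \<longrightarrow>
          (card I = 4 \<longrightarrow> f = g) \<and>
          (\<exists>\<pi>. bij_betw \<pi> I J \<and>
             (\<forall>x\<in>closed_face J \<inter> S. \<phi> g x = \<phi> f (\<lambda>i. if i \<in> I then x (\<pi> i) else 0))))"

definition triangulation :: "'w topology \<Rightarrow> 'w tet set \<Rightarrow> bool" where
  "triangulation W T \<longleftrightarrow> finite T \<and>
     (\<forall>f\<in>T. singular_simplex 3 W f) \<and>
     (\<Union>f\<in>T. f ` standard_simplex 3) = topspace W \<and>
     glued_along_faces T (\<lambda>f. f) (standard_simplex 3)"

definition tri_vertices :: "'w tet set \<Rightarrow> 'w set" where
  "tri_vertices T = {f (simplex_vertex i) | f i. f \<in> T \<and> i \<le> 3}"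

definition tri_edges :: "'w tet set \<Rightarrow> 'w set set" where
  "tri_edges T = {f ` open_face I | f I. f \<in> T \<and> I \<subseteq> {..3} \<and> card I = 2}"

definition tri_faces :: "'w tet set \<Rightarrow> 'w set set" where
  "tri_faces T = {f ` open_face I | f I. f \<in> T \<and> I \<subseteq> {..3} \<and> card I = 3}"

definition abstract_edges :: "'w tet set \<Rightarrow> ('w tet \<times> nat set) set" where
  "abstract_edges T = {(f, I). f \<in> T \<and> I \<subseteq> {..3} \<and> card I = 2}"

definition edge_identification :: "'w tet \<times> nat set \<Rightarrow> 'w set" where
  "edge_identification = (\<lambda>(f, I). f ` open_face I)"

text \<open>Oriented edges of \<open>T\<close> are recorded by their affine parametrizations. Since faces
  are glued affinely, oriented abstract edges have the same parametrization iff they are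
  identified in \<open>T\<close>.\<close>

definition edge_path :: "'w tet \<Rightarrow> nat \<Rightarrow> nat \<Rightarrow> real \<Rightarrow> 'w" where
  "edge_path f i j = (\<lambda>s\<in>{0..1}. f (\<lambda>k. if k = i then 1 - s else if k = j then s else 0))"

definition oriented_edges :: "'w tet set \<Rightarrow> (real \<Rightarrow> 'w) set" where
  "oriented_edges T = {edge_path f i j | f i j. f \<in> T \<and> i \<le> 3 \<and> j \<le> 3 \<and> i \<noteq> j}"

definition reverse_edge :: "(real \<Rightarrow> 'w) \<Rightarrow> real \<Rightarrow> 'w" where
  "reverse_edge e = (\<lambda>s\<in>{0..1}. e (1 - s))"

definition open_edge :: "(real \<Rightarrow> 'w) \<Rightarrow> 'w set" where
  "open_edge e = e ` {0<..<1}"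

text \<open>The subcomplex \<open>H\<close> is given by its set of edges; a loop of \<open>H\<close> contributes two germs
  at its vertex, one for each of its orientations.\<close>

definition distinguished_triangulation ::
    "'w topology \<Rightarrow> 'w set \<Rightarrow> 'w tet set \<Rightarrow> 'w set set \<Rightarrow> bool" where
  "distinguished_triangulation W L T H \<longleftrightarrow> triangulation W T \<and> H \<subseteq> tri_edges T \<and>
     \<Union>{e ` {0..1} | e. e \<in> oriented_edges T \<and> open_edge e \<in> H} = L \<and>
     (\<forall>v\<in>tri_vertices T. card {e \<in> oriented_edges T. e 0 = v \<and> open_edge e \<in> H} = 2)"

section \<open>Branchings\<close>

definition branching :: "'w tet set \<Rightarrow> (real \<Rightarrow> 'w) set \<Rightarrow> bool" where
  "branching T b \<longleftrightarrow> b \<subseteq> oriented_edges T \<and>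
     (\<forall>e\<in>oriented_edges T. (e \<in> b) \<noteq> (reverse_edge e \<in> b)) \<and>
     (\<forall>f\<in>T. \<forall>i\<le>3. \<forall>j\<le>3. \<forall>k\<le>3. i \<noteq> j \<and> j \<noteq> k \<and> i \<noteq> k \<longrightarrow>
        \<not> (edge_path f i j \<in> b \<and> edge_path f j k \<in> b \<and> edge_path f k i \<in> b))"

text \<open>\<open>branch_vertex b f k\<close> is the vertex of \<open>f\<close> with exactly \<open>k\<close> incoming edges.\<close>

definition branch_vertex :: "(real \<Rightarrow> 'w) set \<Rightarrow> 'w tet \<Rightarrow> nat \<Rightarrow> nat" where
  "branch_vertex b f k =
     (THE i. i \<le> 3 \<and> card {j. j \<le> 3 \<and> j \<noteq> i \<and> edge_path f j i \<in> b} = k)"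

text \<open>The orientation of the tetrahedron \<open>f\<close> given by the ordered triple of edges
  \<open>(u 0)(u 1), (u 0)(u 2), (u 0)(u 3)\<close> agrees with that of \<open>W\<close>.\<close>

definition orientation_agrees ::
    "'w topology \<Rightarrow> ('w \<Rightarrow> 'w chain set) \<Rightarrow> 'w tet \<Rightarrow> (nat \<Rightarrow> nat) \<Rightarrow> bool" where
  "orientation_agrees W \<mu> f u \<longleftrightarrow>
     homologous_rel_set 3 W (topspace W - {f barycentre})
       (frag_of (simplex_map 3 f (oriented_simplex 3 (\<lambda>k. simplex_vertex (u k)))))
     = \<mu> (f barycentre)"

definition tet_index ::
    "'w topology \<Rightarrow> ('w \<Rightarrow> 'w chain set) \<Rightarrow> (real \<Rightarrow> 'w) set \<Rightarrow> 'w tet \<Rightarrow> int" where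
  "tet_index W \<mu> b f = (if orientation_agrees W \<mu> f (branch_vertex b f) then - 1 else 1)"

section \<open>Cocycles and flat bundles\<close>

type_synonym mat2 = "complex ^ 2 ^ 2"

definition B2C :: "mat2 set" where
  "B2C = {A. det A = 1 \<and> A $ 2 $ 1 = 0}"

definition B2R :: "mat2 set" where
  "B2R = {A \<in> B2C. \<forall>i j. A $ i $ j \<in> \<real>}"

definition cnj_mat :: "mat2 \<Rightarrow> mat2" where
  "cnj_mat A = (\<chi> i j. cnj (A $ i $ j))"

definition cocycle :: "'w tet set \<Rightarrow> ((real \<Rightarrow> 'w) \<Rightarrow> mat2) \<Rightarrow> bool" where
  "cocycle T z \<longleftrightarrow>
     (\<forall>e\<in>oriented_edges T. z e \<in> B2C \<and> z (reverse_edge e) = matrix_inv (z e)) \<and>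
     (\<forall>f\<in>T. \<forall>i\<le>3. \<forall>j\<le>3. \<forall>k\<le>3. i \<noteq> j \<and> j \<noteq> k \<and> i \<noteq> k \<longrightarrow>
        z (edge_path f i j) ** z (edge_path f j k) = z (edge_path f i k))"

definition full_cocycle :: "'w tet set \<Rightarrow> ((real \<Rightarrow> 'w) \<Rightarrow> mat2) \<Rightarrow> bool" where
  "full_cocycle T z \<longleftrightarrow> cocycle T z \<and> (\<forall>e\<in>oriented_edges T. z e $ 1 $ 2 \<noteq> 0)"

text \<open>A flat principal \<open>B\<close>-bundle is a principal bundle with locally constant transition
  functions, i.e. a principal bundle for \<open>B\<close> with the discrete topology. Every such bundle
  over \<open>W\<close> is isomorphic to one with underlying set \<open>topspace W \<times> B\<close>, so a fixed type
  of total spaces loses no equivalence class; the topology on the total space is arbitrary.\<close>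

record 'w principal_bundle =
  total :: "('w \<times> mat2) topology"
  proj :: "'w \<times> mat2 \<Rightarrow> 'w"
  act :: "'w \<times> mat2 \<Rightarrow> mat2 \<Rightarrow> 'w \<times> mat2"

definition flat_bundle :: "'w topology \<Rightarrow> 'w principal_bundle \<Rightarrow> bool" where
  "flat_bundle W E \<longleftrightarrow> continuous_map (total E) W (proj E) \<and>
     (\<forall>y\<in>topspace W. \<exists>U h. openin W U \<and> y \<in> U \<and>
        homeomorphic_map (prod_topology (subtopology W U) (discrete_topology B2C))
          (subtopology (total E) {x \<in> topspace (total E). proj E x \<in> U}) h \<and>
        (\<forall>u\<in>U. \<forall>g\<in>B2C. proj E (h (u, g)) = u \<and>
           (\<forall>k\<in>B2C. act E (h (u, g)) k = h (u, g ** k))))"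

definition bundle_iso :: "'w principal_bundle \<Rightarrow> 'w principal_bundle \<Rightarrow> bool" where
  "bundle_iso E E' \<longleftrightarrow> (\<exists>F. homeomorphic_map (total E) (total E') F \<and>
     (\<forall>x\<in>topspace (total E). proj E' (F x) = proj E x \<and>
        (\<forall>g\<in>B2C. F (act E x g) = act E' (F x) g)))"

definition flat_bundle_classes :: "'w topology \<Rightarrow> 'w principal_bundle set set" where
  "flat_bundle_classes W =
     {E. flat_bundle W E} // {(E, E'). flat_bundle W E \<and> flat_bundle W E' \<and> bundle_iso E E'}"

definition trivial_bundle :: "'w topology \<Rightarrow> 'w principal_bundle" where
  "trivial_bundle W =
     \<lparr>total = prod_topology W (discrete_topology B2C), proj = fst,
      act = (\<lambda>(y, g) k. (y, g ** k))\<rparr>"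

definition trivial_class :: "'w topology \<Rightarrow> 'w principal_bundle set" where
  "trivial_class W = {E. flat_bundle W E \<and> bundle_iso (trivial_bundle W) E}"

text \<open>The class \<open>[z]\<close>: the flat bundles whose parallel transport along the edges of \<open>T\<close> is
  \<open>z\<close>, with respect to some choice of points \<open>s v\<close> in the fibres over the vertices. Here
  \<open>q\<close> is the horizontal lift of \<open>e\<close>, running from \<open>(s (e 0)) \<cdot> z e\<close> to \<open>s (e 1)\<close>.
  Replacing \<open>s v\<close> by \<open>s v \<cdot> \<lambda> v\<close> replaces \<open>z e\<close> by
  \<open>\<lambda>(e 0)\<inverse> z(e) \<lambda>(e 1)\<close>, so equivalent cocycles have the same class.\<close>

definition flat_class :: "'w topology \<Rightarrow> 'w tet set \<Rightarrow> ((real \<Rightarrow> 'w) \<Rightarrow> mat2) \<Rightarrow> 'w principal_bundle set" where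
  "flat_class W T z = {E. flat_bundle W E \<and>
     (\<exists>s. (\<forall>v\<in>tri_vertices T. s v \<in> topspace (total E) \<and> proj E (s v) = v) \<and>
        (\<forall>e\<in>oriented_edges T. \<exists>q. pathin (total E) q \<and> (\<forall>t\<in>{0..1}. proj E (q t) = e t) \<and>
           q 0 = act E (s (e 0)) (z e) \<and> q 1 = s (e 1)))}"

section \<open>The spine dual to a distinguished triangulation\<close>

text \<open>The part in a tetrahedron of the open cell dual to its face \<open>I\<close>. This is the union of the
  open simplices of the barycentric subdivision whose flags start with \<open>I\<close>.\<close>

definition dual_open_cell :: "nat set \<Rightarrow> (nat \<Rightarrow> real) set" where
  "dual_open_cell I =
     {x \<in> standard_simplex 3. \<exists>m. (\<forall>i\<in>I. x i = m) \<and> (\<forall>i\<in>{..3} - I. x i < m)}"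

definition dual_skeleton_simplex :: "(nat \<Rightarrow> real) set" where
  "dual_skeleton_simplex = \<Union>{dual_open_cell I | I. I \<subseteq> {..3} \<and> 2 \<le> card I}"

definition spine :: "'w tet set \<Rightarrow> 'w set set \<Rightarrow> 'w set" where
  "spine T H = (\<Union>f\<in>T. f ` dual_skeleton_simplex) -
     \<Union>{f ` dual_open_cell I | f I. f \<in> T \<and> I \<subseteq> {..3} \<and> card I = 2 \<and> f ` open_face I \<in> H}"

text \<open>Local models of simple polyhedra: the points of 3-space at which the maximum of
  \<open>0, x\<^sub>0, \<dots>, x\<^sub>n\<^sub>-\<^sub>1\<close> is attained at least twice. For \<open>n = 1, 2, 3\<close> this is a plane,
  a tripod times a line, and the open cone over the 1-skeleton of a tetrahedron.\<close>

definition polyhedron_model :: "nat \<Rightarrow> (nat \<Rightarrow> real) set" where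
  "polyhedron_model n = {x \<in> topspace (Euclidean_space 3).
     \<exists>i\<le>n. \<exists>j\<le>n. i \<noteq> j \<and> (x(n := 0)) i = (x(n := 0)) j \<and>
       (\<forall>k\<le>n. (x(n := 0)) k \<le> (x(n := 0)) i)}"

text \<open>The \<open>k\<close>-dimensional stratum, \<open>k = 0, 1, 2\<close>.\<close>

definition stratum :: "'w topology \<Rightarrow> nat \<Rightarrow> 'w set" where
  "stratum X k = {y \<in> topspace X. \<exists>U h. openin X U \<and> y \<in> U \<and>
     homeomorphic_map (subtopology X U)
       (subtopology (Euclidean_space 3) (polyhedron_model (3 - k))) h \<and>
     h y = (\<lambda>_. 0)}"

definition standard_polyhedron :: "'w topology \<Rightarrow> bool" where
  "standard_polyhedron X \<longleftrightarrow> topspace X = stratum X 0 \<union> stratum X 1 \<union> stratum X 2 \<and>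
     (\<forall>k\<le>2. \<forall>C\<in>connected_components_of (subtopology X (stratum X k)).
        subtopology X C homeomorphic_space Euclidean_space k)"

section \<open>The link exterior, its ideal triangulation and curves on it\<close>

text \<open>A closed tubular neighbourhood, as the unit disc bundle in an open one. (Normal bundles
  of links in oriented 3-manifolds are trivial.)\<close>

definition tubular_neighbourhood :: "'w topology \<Rightarrow> 'w set \<Rightarrow> 'w set \<Rightarrow> bool" where
  "tubular_neighbourhood W L U \<longleftrightarrow> (\<exists>V h. openin W V \<and>
     homeomorphic_map (prod_topology (subtopology W L) (euclidean :: complex topology))
       (subtopology W V) h \<and>
     (\<forall>y\<in>L. h (y, 0) = y) \<and> U = h ` (L \<times> cball 0 1))"

definition exterior :: "'w topology \<Rightarrow> 'w set \<Rightarrow> 'w set" where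
  "exterior W U = topspace W - W interior_of U"

definition truncated_simplex :: "(nat \<Rightarrow> real) set" where
  "truncated_simplex = {x \<in> standard_simplex 3. \<forall>i\<le>3. x i \<le> 3/4}"

text \<open>The vertices of the spine are the barycentres of the tetrahedra without edges in \<open>H\<close>:
  near the barycentre of any other tetrahedron a region of the dual 2-skeleton has been removed.\<close>

definition spine_tets :: "'w tet set \<Rightarrow> 'w set set \<Rightarrow> 'w tet set" where
  "spine_tets T H = {f \<in> T. \<forall>I. I \<subseteq> {..3} \<and> card I = 2 \<longrightarrow> f ` open_face I \<notin> H}"

text \<open>\<open>\<psi>\<close> is the ideal triangulation of the exterior of \<open>U\<close> dual to the spine, as a family of
  characteristic maps on truncated tetrahedra. The condition at the barycentre matches the
  vertex labels of the ideal tetrahedron with those of the tetrahedron of \<open>T\<close> it comes from.\<close>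

definition dual_ideal_triangulation ::
    "'w topology \<Rightarrow> 'w tet set \<Rightarrow> 'w set set \<Rightarrow> 'w set \<Rightarrow> ('w tet \<Rightarrow> (nat \<Rightarrow> real) \<Rightarrow> 'w) \<Rightarrow> bool" where
  "dual_ideal_triangulation W T H U \<psi> \<longleftrightarrow>
     (\<forall>f\<in>spine_tets T H.
        continuous_map (subtopology (powertop_real UNIV) truncated_simplex) W (\<psi> f)) \<and>
     (\<Union>f\<in>spine_tets T H. \<psi> f ` truncated_simplex) = exterior W U \<and>
     glued_along_faces (spine_tets T H) \<psi> truncated_simplex \<and>
     (\<forall>f\<in>spine_tets T H. \<forall>x\<in>truncated_simplex.
        (\<psi> f x \<in> W frontier_of U \<longleftrightarrow> (\<exists>i\<le>3. x i = 3/4)) \<and>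
        (\<psi> f x \<in> spine T H \<longleftrightarrow> x \<in> dual_skeleton_simplex)) \<and>
     (\<forall>f\<in>spine_tets T H. \<exists>\<delta>>0. \<forall>x\<in>truncated_simplex.
        (\<forall>i\<le>3. \<bar>x i - 1/4\<bar> < \<delta>) \<longrightarrow> \<psi> f x = f x)"

text \<open>An oriented closed curve in general position is a cyclic list of passages through
  ideal tetrahedra. A passage through \<open>ptet\<close> enters by the face opposite to the vertex \<open>pin\<close>
  and departs by the face opposite to \<open>pout\<close>. In a curve without back-tracking \<open>pin\<close> and
  \<open>pout\<close> differ, and the selected edge of \<open>ptet\<close> is the one spanned by the other two
  vertices. The empty list stands for the curves contained in one tetrahedron, which select
  nothing.\<close>

record 'w passage =
  ptet :: "'w tet"
  pin :: nat
  pout :: nat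
  ppath :: "real \<Rightarrow> nat \<Rightarrow> real"

definition passage_in :: "'w tet set \<Rightarrow> 'w passage \<Rightarrow> bool" where
  "passage_in A p \<longleftrightarrow> ptet p \<in> A \<and> pin p \<le> 3 \<and> pout p \<le> 3 \<and> pin p \<noteq> pout p \<and>
     pathin (subtopology (powertop_real UNIV) truncated_simplex) (ppath p) \<and>
     ppath p 0 \<in> open_face ({..3} - {pin p}) \<and> ppath p 1 \<in> open_face ({..3} - {pout p}) \<and>
     (\<forall>t\<in>{0<..<1}. ppath p t \<in> open_face {..3})"

definition selected_edge :: "'w passage \<Rightarrow> 'w tet \<times> nat set" where
  "selected_edge p = (ptet p, {..3} - {pin p, pout p})"

text \<open>Consecutive passages lie on different sides of the face crossed between them.\<close>

definition normal_curve ::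
    "'w tet set \<Rightarrow> ('w tet \<Rightarrow> (nat \<Rightarrow> real) \<Rightarrow> 'w) \<Rightarrow> 'w passage list \<Rightarrow> bool" where
  "normal_curve A \<psi> ps \<longleftrightarrow> (\<forall>p\<in>set ps. passage_in A p) \<and>
     (\<forall>k<length ps. let p = ps ! k; q = ps ! (Suc k mod length ps) in
        \<psi> (ptet p) (ppath p 1) = \<psi> (ptet q) (ppath q 0) \<and> (ptet p, pout p) \<noteq> (ptet q, pin q))"

definition curve_trace :: "('w tet \<Rightarrow> (nat \<Rightarrow> real) \<Rightarrow> 'w) \<Rightarrow> 'w passage list \<Rightarrow> 'w set" where
  "curve_trace \<psi> ps = (\<Union>p\<in>set ps. \<psi> (ptet p) ` ppath p ` {0..1})"

text \<open>A curve on the boundary is in general position without back-tracking for the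
  triangulation by the truncation triangles \<open>{x. x v = 3/4}\<close>.\<close>

definition boundary_curve ::
    "'w tet set \<Rightarrow> ('w tet \<Rightarrow> (nat \<Rightarrow> real) \<Rightarrow> 'w) \<Rightarrow> 'w passage list \<Rightarrow> bool" where
  "boundary_curve A \<psi> ps \<longleftrightarrow> ps \<noteq> [] \<and> normal_curve A \<psi> ps \<and>
     (\<forall>p\<in>set ps. \<exists>v\<le>3. \<forall>t\<in>{0..1}. ppath p t v = 3/4)"

definition simple_boundary_curve ::
    "'w tet set \<Rightarrow> ('w tet \<Rightarrow> (nat \<Rightarrow> real) \<Rightarrow> 'w) \<Rightarrow> 'w passage list \<Rightarrow> bool" where
  "simple_boundary_curve A \<psi> ps \<longleftrightarrow> boundary_curve A \<psi> ps \<and>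
     inj_on (\<lambda>(k, t). \<psi> (ptet (ps ! k)) (ppath (ps ! k) t)) ({..<length ps} \<times> {0..<1})"

definition meet_transversely_once :: "'w topology \<Rightarrow> 'w set \<Rightarrow> 'w set \<Rightarrow> bool" where
  "meet_transversely_once X A B \<longleftrightarrow> (\<exists>y V h. A \<inter> B = {y} \<and> openin X V \<and> y \<in> V \<and>
     homeomorphic_map (subtopology X V) (Euclidean_space 2) h \<and>
     h ` (V \<inter> A) = {x \<in> topspace (Euclidean_space 2). x 1 = 0} \<and>
     h ` (V \<inter> B) = {x \<in> topspace (Euclidean_space 2). x 0 = 0})"

definition bounds_disc_in :: "'w topology \<Rightarrow> 'w set \<Rightarrow> 'w set \<Rightarrow> bool" where
  "bounds_disc_in W U A \<longleftrightarrow> (\<exists>D F. D \<subseteq> U \<and>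
     homeomorphic_map (subtopology euclidean (cball (0::complex) 1)) (subtopology W D) F \<and>
     F ` sphere 0 1 = A \<and> D \<inter> W frontier_of U = A)"

text \<open>\<open>m C\<close> and \<open>l C\<close> are the meridian and the longitude on the component \<open>C\<close> of the boundary
  of \<open>U\<close>. The meridian is essential on \<open>C\<close> because it meets \<open>l C\<close> transversely in one point.\<close>

definition meridian_longitude_system ::
    "'w topology \<Rightarrow> 'w tet set \<Rightarrow> 'w set \<Rightarrow> ('w tet \<Rightarrow> (nat \<Rightarrow> real) \<Rightarrow> 'w) \<Rightarrow>
     ('w set \<Rightarrow> 'w passage list) \<Rightarrow> ('w set \<Rightarrow> 'w passage list) \<Rightarrow> bool" where
  "meridian_longitude_system W A U \<psi> m l \<longleftrightarrow>
     (\<forall>C\<in>connected_components_of (subtopology W (W frontier_of U)).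
        simple_boundary_curve A \<psi> (m C) \<and> simple_boundary_curve A \<psi> (l C) \<and>
        curve_trace \<psi> (m C) \<subseteq> C \<and> curve_trace \<psi> (l C) \<subseteq> C \<and>
        bounds_disc_in W U (curve_trace \<psi> (m C)) \<and>
        meet_transversely_once (subtopology W C) (curve_trace \<psi> (m C)) (curve_trace \<psi> (l C)))"

text \<open>Let a passage \<open>p\<close> of a boundary curve lie in the truncation triangle at the vertex \<open>v\<close>, and
  let \<open>{v, w}\<close> be its selected edge. The curve turns around the vertex \<open>w\<close> of the triangle from
  the side \<open>w (pout p)\<close> to the side \<open>w (pin p)\<close>. For the boundary orientation (outward normal
  first, pointing to \<open>v\<close>) this is counterclockwise iff the edges from \<open>v\<close> to
  \<open>w\<close>, \<open>pin p\<close>, \<open>pout p\<close> form a positive triple.\<close>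

definition passage_sign :: "'w topology \<Rightarrow> ('w \<Rightarrow> 'w chain set) \<Rightarrow> 'w passage \<Rightarrow> int" where
  "passage_sign W \<mu> p =
     (let v = (THE v. v \<le> 3 \<and> ppath p 0 v = 3/4);
          w = (THE w. w \<in> {..3} - {v, pin p, pout p})
      in if orientation_agrees W \<mu> (ptet p) ((!) [v, w, pin p, pout p]) then 1 else - 1)"

section \<open>Charges and decorations\<close>

definition integral_charge ::
    "'w topology \<Rightarrow> ('w \<Rightarrow> 'w chain set) \<Rightarrow> 'w tet set \<Rightarrow> 'w set set \<Rightarrow> 'w set \<Rightarrow>
     ('w tet \<Rightarrow> (nat \<Rightarrow> real) \<Rightarrow> 'w) \<Rightarrow> ('w set \<Rightarrow> 'w passage list) \<Rightarrow> ('w set \<Rightarrow> 'w passage list) \<Rightarrow>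
     ('w tet \<times> nat set \<Rightarrow> int) \<Rightarrow> bool" where
  "integral_charge W \<mu> T H U \<psi> m l c' \<longleftrightarrow>
     (\<forall>f\<in>T. \<forall>J. J \<subseteq> {..3} \<and> card J = 3 \<longrightarrow> (\<Sum>I\<in>{I. I \<subseteq> J \<and> card I = 2}. c' (f, I)) = 1) \<and>
     (\<forall>e\<in>tri_edges T. (\<Sum>a\<in>{a \<in> abstract_edges T. edge_identification a = e}. c' a) =
        (if e \<in> H then 0 else 2)) \<and>
     (\<forall>C\<in>connected_components_of (subtopology W (W frontier_of U)). \<forall>s\<in>{m C, l C}.
        (\<Sum>p\<leftarrow>s. passage_sign W \<mu> p * c' (selected_edge p)) = 0) \<and>
     (\<forall>s. normal_curve (spine_tets T H) \<psi> s \<longrightarrow> even (\<Sum>p\<leftarrow>s. c' (selected_edge p)))"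

text \<open>Elements of \<open>\<int>/N\<close> are represented by integers; all uses below are invariant under
  changes modulo \<open>N\<close>. For \<open>N = 2 p + 1\<close> we write \<open>p = N div 2\<close>.\<close>

definition charge ::
    "nat \<Rightarrow> 'w topology \<Rightarrow> ('w \<Rightarrow> 'w chain set) \<Rightarrow> 'w set \<Rightarrow> 'w tet set \<Rightarrow> 'w set set \<Rightarrow>
     ('w tet \<times> nat set \<Rightarrow> int) \<Rightarrow> bool" where
  "charge N W \<mu> L T H c \<longleftrightarrow> (\<exists>U \<psi> m l c'. tubular_neighbourhood W L U \<and>
     dual_ideal_triangulation W T H U \<psi> \<and>
     meridian_longitude_system W (spine_tets T H) U \<psi> m l \<and>
     integral_charge W \<mu> T H U \<psi> m l c' \<and>
     (\<forall>a\<in>abstract_edges T. c a mod int N = (int (N div 2) + 1) * c' a mod int N))"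

definition decorated_triangulation ::
    "nat \<Rightarrow> 'w topology \<Rightarrow> ('w \<Rightarrow> 'w chain set) \<Rightarrow> 'w set \<Rightarrow> 'w tet set \<Rightarrow> 'w set set \<Rightarrow>
     (real \<Rightarrow> 'w) set \<Rightarrow> ((real \<Rightarrow> 'w) \<Rightarrow> mat2) \<Rightarrow> ('w tet \<times> nat set \<Rightarrow> int) \<Rightarrow> bool" where
  "decorated_triangulation N W \<mu> L T H b z c \<longleftrightarrow>
     distinguished_triangulation W L T H \<and> standard_polyhedron (subtopology W (spine T H)) \<and>
     branching T b \<and> full_cocycle T z \<and> charge N W \<mu> L T H c"

definition determination ::
    "nat \<Rightarrow> (real \<Rightarrow> 'w) set \<Rightarrow> ((real \<Rightarrow> 'w) \<Rightarrow> mat2) \<Rightarrow> (complex \<Rightarrow> complex) \<Rightarrow> bool" where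
  "determination N b z d \<longleftrightarrow> (\<exists>D. open D \<and> connected D \<and> 0 \<notin> D \<and>
     {z e $ i $ j | e i j. e \<in> b} - {0} \<subseteq> D \<and> continuous_on D d \<and> (\<forall>w\<in>D. d w ^ N = w))"

section \<open>The state sum\<close>

definition omega_pow :: "nat \<Rightarrow> int \<Rightarrow> complex" where
  "omega_pow N n = exp (2 * \<i> * of_real pi / of_nat N) powi n"

definition delta_mod :: "nat \<Rightarrow> int \<Rightarrow> complex" where
  "delta_mod N n = (if int N dvd n then 1 else 0)"

definition Omega1 :: "nat \<Rightarrow> complex \<times> complex \<times> complex \<Rightarrow> int \<Rightarrow> complex" where
  "Omega1 N = (\<lambda>(x, y, z) n. \<Prod>j=1..nat (n mod int N). y / (z - x * omega_pow N (int j)))"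

definition Omega2 :: "nat \<Rightarrow> complex \<times> complex \<times> complex \<Rightarrow> int \<Rightarrow> int \<Rightarrow> complex" where
  "Omega2 N A m n = Omega1 N A (m - n) * omega_pow N ((int (N div 2) + 1) * n\<^sup>2)"

text \<open>\<open>g\<close> is taken with the principal branch of each factor, which is \<open>1\<close> at \<open>0\<close>.\<close>

definition g_fun :: "nat \<Rightarrow> complex \<Rightarrow> complex" where
  "g_fun N x = (\<Prod>j=1..<N. (1 - x * omega_pow N (int j)) powr (of_nat j / of_nat N))"

definition h_fun :: "nat \<Rightarrow> complex \<Rightarrow> complex" where
  "h_fun N x = x powi (- int (N div 2)) * g_fun N x / g_fun N 1"

definition bracket :: "nat \<Rightarrow> complex \<Rightarrow> complex" where
  "bracket N x = (1 - x ^ N) / (of_nat N * (1 - x))"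

text \<open>\<open>x i j\<close>, \<open>c i j\<close>, \<open>a k\<close> are the \<open>x\<^sub>i\<^sub>j\<close>, \<open>c\<^sub>i\<^sub>j\<close>, \<open>\<alpha>\<^sub>k\<close> of a tetrahedron with index
  \<open>\<epsilon>\<close>.\<close>

definition tet_tensor ::
    "nat \<Rightarrow> int \<Rightarrow> (nat \<Rightarrow> nat \<Rightarrow> complex) \<Rightarrow> (nat \<Rightarrow> nat \<Rightarrow> int) \<Rightarrow> (nat \<Rightarrow> int) \<Rightarrow> complex" where
  "tet_tensor N \<epsilon> x c a =
     (let p = N div 2; half = int p + 1;
          X = x 0 3 * x 1 2; Y = x 0 1 * x 2 3; Z = x 0 2 * x 1 3;
          \<nu> = h_fun N (Z / X)
      in if \<epsilon> = - 1
         then Z ^ p * omega_pow N (c 1 2 * (a 2 - a 3) - half * c 0 1 * c 1 2) * \<nu> *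
              omega_pow N (a 3 * a 0) * Omega2 N (X, Y, Z) (a 2 - c 0 1) (a 3) *
              delta_mod N (a 2 + a 0 - a 1)
         else Z ^ p * omega_pow N (c 1 2 * (a 2 - a 3) + half * c 0 1 * c 1 2) *
              (bracket N (X / Z) / \<nu>) * omega_pow N (- (a 3 * a 0)) *
              (delta_mod N (a 2 + a 0 - a 1) /
               Omega2 N (X / omega_pow N 1, Y, Z) (a 2 + c 0 1) (a 3)))"

definition tet_weight ::
    "nat \<Rightarrow> 'w topology \<Rightarrow> ('w \<Rightarrow> 'w chain set) \<Rightarrow> (real \<Rightarrow> 'w) set \<Rightarrow> ((real \<Rightarrow> 'w) \<Rightarrow> mat2) \<Rightarrow>
     ('w tet \<times> nat set \<Rightarrow> int) \<Rightarrow> ('w set \<Rightarrow> int) \<Rightarrow> (complex \<Rightarrow> complex) \<Rightarrow> 'w tet \<Rightarrow> complex" where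
  "tet_weight N W \<mu> b z c \<alpha> d f =
     (let v = branch_vertex b f
      in tet_tensor N (tet_index W \<mu> b f)
           (\<lambda>i j. d (z (edge_path f (v i) (v j)) $ 1 $ 2))
           (\<lambda>i j. c (f, {v i, v j}))
           (\<lambda>k. \<alpha> (f ` open_face ({..3} - {v k}))))"

text \<open>The edges not in \<open>H\<close> are indexed by the \<open>b\<close>-oriented edges, at which \<open>x(e)\<close> is taken.\<close>

definition state_sum ::
    "nat \<Rightarrow> 'w topology \<Rightarrow> ('w \<Rightarrow> 'w chain set) \<Rightarrow> 'w tet set \<Rightarrow> 'w set set \<Rightarrow>
     (real \<Rightarrow> 'w) set \<Rightarrow> ((real \<Rightarrow> 'w) \<Rightarrow> mat2) \<Rightarrow> ('w tet \<times> nat set \<Rightarrow> int) \<Rightarrow>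
     (complex \<Rightarrow> complex) \<Rightarrow> complex" where
  "state_sum N W \<mu> T H b z c d =
     ((\<Sum>\<alpha>\<in>tri_faces T \<rightarrow>\<^sub>E {0..<int N}.
         (\<Prod>f\<in>T. tet_weight N W \<mu> b z c \<alpha> d f) *
         (\<Prod>e\<in>{e \<in> b. open_edge e \<notin> H}. d (z e $ 1 $ 2) powi (- 2 * int (N div 2))))
      / of_nat N ^ card (tri_vertices T)) ^ N"

definition state_sum_values ::
    "nat \<Rightarrow> 'w topology \<Rightarrow> ('w \<Rightarrow> 'w chain set) \<Rightarrow> 'w set \<Rightarrow> 'w principal_bundle set \<Rightarrow> complex set" where
  "state_sum_values N W \<mu> L \<rho> =
     {state_sum N W \<mu> T H b z c d | T H b z c d.
        decorated_triangulation N W \<mu> L T H b z c \<and> flat_class W T z = \<rho> \<and> determination N b z d}"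

text \<open>The common value of the state sums. That it exists for all \<open>(W, L, \<rho>)\<close> is the invariance
  theorem for these state sums; the value \<open>0\<close> in the other case only makes \<open>KN\<close> total.\<close>

definition KN ::
    "nat \<Rightarrow> 'w topology \<Rightarrow> ('w \<Rightarrow> 'w chain set) \<Rightarrow> 'w set \<Rightarrow> 'w principal_bundle set \<Rightarrow> complex" where
  "KN N W \<mu> L \<rho> =
     (if is_singleton (state_sum_values N W \<mu> L \<rho>)
      then the_elem (state_sum_values N W \<mu> L \<rho>) else 0)"

definition KN_trivial ::
    "nat \<Rightarrow> 'w topology \<Rightarrow> ('w \<Rightarrow> 'w chain set) \<Rightarrow> 'w set \<Rightarrow> complex" where
  "KN_trivial N W \<mu> L = KN N W \<mu> L (trivial_class W)"

definition real_class :: "'w topology \<Rightarrow> 'w principal_bundle set \<Rightarrow> bool" where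
  "real_class W \<rho> \<longleftrightarrow> (\<exists>T z. triangulation W T \<and> cocycle T z \<and>
     (\<forall>e\<in>oriented_edges T. z e \<in> B2R) \<and> flat_class W T z = \<rho>)"

end

theory Submission
  imports Defs "HOL-Computational_Algebra.Fundamental_Theorem_Algebra"
begin

text \<open>Complex conjugation turns the tensor of a tetrahedron of index \<open>\<epsilon>\<close> into the tensor of
  index \<open>-\<epsilon>\<close> for the conjugate cocycle and the state \<open>-\<alpha>\<close>, up to an \<open>N\<close>-th root of unity
  independent of the state, which the \<open>N\<close>-th power removes. So conjugation of the state sums is
  matched by reversing all indices, conjugating the cocycle and keeping the branching and
  the charge. Reversing the orientation of the manifold reverses all indices because the
  characteristic map of a tetrahedron represents a free generator of the local homology at its
  barycentre, hence is exactly one of \<open>\<mu>\<close> and \<open>-\<mu>\<close> there. For this, the class of the identity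
  simplex is shown to generate \<open>H\<^sub>n\<close> of the pair (all vectors, vectors off the diagonal) by
  induction on \<open>n\<close>, and is transported by excision. On classes of flat bundles, conjugation of
  cocycles is a change of the \<open>B\<close>-action alone, so it depends only on the class.\<close>

section \<open>Free generators of cyclic groups\<close>

text \<open>The obstacle is that \<open>orientation_agrees\<close> is an equation with
  \<open>\<mu>\<close>: its failure must force equality with the inverse of \<open>\<mu>\<close>. So
  the class of a tetrahedron has to generate the local group, and even this is too little, since in
  a group of order 2 both equations would hold. Hence the notion of a free generator. Simplices live
  in the infinite product of real lines, where a point has infinite codimension. The diagonal of the
  first n+1 coordinates has codimension n, meets the n-simplex only in its barycentre, and takes the
  place of the removed point. On the algebraic side, negating the state restores the exponents
  linear in the state; the quadratic ones and the pure charge term do change sign, as the change of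
  index demands. For \<open>Omega1\<close> the point is that the product of y / (z - x u) over all
  N-th roots of unity u is 1, so a partial product is the inverse of the complementary one. The
  passage to \<open>KN\<close> compares whole sets of values, in both directions.\<close>

definition free_generator :: "('a, 'b) monoid_scheme \<Rightarrow> 'a \<Rightarrow> bool" where
  "free_generator G a \<longleftrightarrow> a \<in> carrier G \<and> bij_betw (\<lambda>k::int. a [^]\<^bsub>G\<^esub> k) UNIV (carrier G)"

lemma free_generator_iso:
  assumes h: "h \<in> iso G H" and G: "group G" and H: "group H" and a: "a \<in> carrier G"
  shows "free_generator H (h a) \<longleftrightarrow> free_generator G a"
proof -
  have hom: "h \<in> hom G H" and bij: "bij_betw h (carrier G) (carrier H)"
    using h by (auto simp: iso_def)
  have ha: "h a \<in> carrier H"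
    using hom a by (auto simp: hom_def)
  interpret group_hom G H h
    using G H hom by (simp add: group_hom_def group_hom_axioms_def)
  have eq: "(\<lambda>k::int. h a [^]\<^bsub>H\<^esub> k) = h \<circ> (\<lambda>k::int. a [^]\<^bsub>G\<^esub> k)"
    using a by (auto simp: hom_int_pow)
  have img: "(\<lambda>k::int. a [^]\<^bsub>G\<^esub> k) ` UNIV \<subseteq> carrier G"
    using a by auto
  show ?thesis
    unfolding free_generator_def eq using a ha bij_betw_comp_iff2[OF bij img] by blast
qed

lemma free_generator_inv:
  assumes G: "group G" and a: "free_generator G a"
  shows "free_generator G (inv\<^bsub>G\<^esub> a)"
proof -
  interpret group G by fact
  have ac: "a \<in> carrier G" using a by (simp add: free_generator_def)
  have eq: "(\<lambda>k::int. inv\<^bsub>G\<^esub> a [^]\<^bsub>G\<^esub> k) = (\<lambda>k::int. a [^]\<^bsub>G\<^esub> k) \<circ> uminus"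
    using ac by (auto simp: int_pow_inv int_pow_neg)
  have "bij (uminus :: int \<Rightarrow> int)"
    by (rule bij_uminus)
  then show ?thesis
    using a ac unfolding free_generator_def eq by (auto intro: bij_betw_trans)
qed

text \<open>Writing \<open>m\<close> as a power of \<open>a\<close> and \<open>a\<close> as a power
  of \<open>m\<close>, freeness gives \<open>k * l = 1\<close>, so \<open>k\<close> is 1 or -1;
  infinite order excludes that both cases hold. This exclusive alternative is what makes
  \<open>orientation_agrees\<close> switch with the orientation.\<close>

lemma generator_cases:
  assumes G: "group G" and a: "free_generator G a" and m: "m \<in> carrier G"
    and gen: "subgroup_generated G {m} = G"
  shows "(a = m) \<noteq> (a = inv\<^bsub>G\<^esub> m)"
proof -
  interpret group G by fact
  have ac: "a \<in> carrier G" using a by (simp add: free_generator_def)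
  have bij: "bij_betw (\<lambda>k::int. a [^]\<^bsub>G\<^esub> k) UNIV (carrier G)"
    using a by (simp add: free_generator_def)
  obtain k :: int where k: "m = a [^]\<^bsub>G\<^esub> k"
    using bij m by (auto simp: bij_betw_def image_iff)
  have "a \<in> carrier (subgroup_generated G {m})"
    using ac gen by simp
  then obtain l :: int where l: "a = m [^]\<^bsub>G\<^esub> l"
    using m by (auto simp: carrier_subgroup_generated_by_singleton)
  have "a [^]\<^bsub>G\<^esub> (1::int) = a [^]\<^bsub>G\<^esub> (k * l)"
    using l k ac by (simp add: int_pow_pow)
  then have kl: "k * l = 1"
    using bij by (metis (no_types, lifting) UNIV_I bij_betw_def inj_on_def)
  then have "k = 1 \<or> k = -1"
    using pos_zmult_eq_1_iff_lemma zmult_eq_1_iff by blast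
  moreover have "a \<noteq> inv\<^bsub>G\<^esub> a"
  proof
    assume "a = inv\<^bsub>G\<^esub> a"
    then have "a [^]\<^bsub>G\<^esub> (1::int) = a [^]\<^bsub>G\<^esub> (-1::int)"
      using ac by (simp add: int_pow_neg)
    then have "(1::int) = -1"
      using bij by (metis (no_types, lifting) UNIV_I bij_betw_def inj_on_def)
    then show False by simp
  qed
  ultimately show ?thesis
    using k ac by (auto simp: int_pow_neg)
qed

section \<open>Straight-line homotopies in the space of coordinates\<close>

abbreviation coord_space :: "(nat \<Rightarrow> real) topology" where
  "coord_space \<equiv> powertop_real UNIV"

lemma coord_space_euclidean: "coord_space = euclidean"
  by (simp add: euclidean_product_topology)

text \<open>For homotopies of pairs, \<open>P\<close> says that a subspace is mapped into itself. By
  \<open>cong\<close> it sees only the values on \<open>A\<close>, so the homotopy has to match the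
  end maps only there.\<close>

lemma homotopic_with_segments:
  assumes f: "continuous_map (subtopology coord_space A) (subtopology coord_space B) f"
    and g: "continuous_map (subtopology coord_space A) (subtopology coord_space B) g"
    and B: "\<And>x t. \<lbrakk>x \<in> A; 0 \<le> t; t \<le> 1\<rbrakk> \<Longrightarrow> (\<lambda>i. (1 - t) * f x i + t * g x i) \<in> B"
    and P: "\<And>t. \<lbrakk>0 \<le> t; t \<le> 1\<rbrakk> \<Longrightarrow> P (\<lambda>x i. (1 - t) * f x i + t * g x i)"
    and cong: "\<And>h k. (\<And>x. x \<in> A \<Longrightarrow> h x = k x) \<Longrightarrow> P h \<longleftrightarrow> P k"
  shows "homotopic_with P (subtopology coord_space A) (subtopology coord_space B) f g"
proof -
  let ?h = "\<lambda>(t, x) i. (1 - t) * f x i + t * g x i"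
  have iff: "homotopic_with P (subtopology coord_space A) (subtopology coord_space B) f g \<longleftrightarrow>
    (\<exists>h. continuous_map (prod_topology (top_of_set {0..1::real}) (subtopology coord_space A))
        (subtopology coord_space B) h \<and>
      (\<forall>x \<in> topspace (subtopology coord_space A). h (0, x) = f x) \<and>
      (\<forall>x \<in> topspace (subtopology coord_space A). h (1, x) = g x) \<and>
      (\<forall>t\<in>{0..1}. P (\<lambda>x. h (t, x))))"
    by (rule homotopic_with, rule cong) auto
  have "continuous_map (prod_topology (top_of_set {0..1::real}) (subtopology coord_space A))
        (subtopology coord_space B) ?h"
  proof -
    let ?P = "prod_topology (top_of_set {0..1::real}) (subtopology coord_space A)"
    have fi: "continuous_map ?P euclideanreal (\<lambda>z. f (snd z) i)" 
      and gi: "continuous_map ?P euclideanreal (\<lambda>z. g (snd z) i)" for i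
    proof -
      have "continuous_map ?P (subtopology coord_space A) snd"
        by (rule continuous_map_snd)
      then have "continuous_map ?P (subtopology coord_space B) (f \<circ> snd)"
        "continuous_map ?P (subtopology coord_space B) (g \<circ> snd)"
        using f g continuous_map_compose by blast+
      then show "continuous_map ?P euclideanreal (\<lambda>z. f (snd z) i)" 
       "continuous_map ?P euclideanreal (\<lambda>z. g (snd z) i)"
        by (auto simp: continuous_map_in_subtopology continuous_map_componentwise_UNIV)
    qed
    have t: "continuous_map ?P euclideanreal fst"
      by (metis continuous_map_fst continuous_map_into_fulltopology)
    have "continuous_map ?P coord_space ?h"
      unfolding continuous_map_componentwise_UNIV case_prod_unfold
      by (intro allI continuous_intros fi gi t)
    moreover have "?h \<in> topspace ?P \<rightarrow> B"
      using B by auto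
    ultimately show ?thesis
      by (simp add: continuous_map_in_subtopology)
  qed
  then show ?thesis
    unfolding iff using P by (intro exI[of _ ?h]) auto
qed

section \<open>Homology off the diagonal\<close>

text \<open>The coordinates beyond \<open>n\<close> are free, so this is a linear subspace of
  codimension \<open>n\<close> in the infinite product; its complement has the homotopy type of a
  sphere of dimension \<open>n - 1\<close>.\<close>

definition diag :: "nat \<Rightarrow> (nat \<Rightarrow> real) set" where
  "diag n = {x. \<forall>i\<le>n. \<forall>j\<le>n. x i = x j}"

lemma diagD: "\<lbrakk>x \<in> diag n; i \<le> n; j \<le> n\<rbrakk> \<Longrightarrow> x i = x j"
  unfolding diag_def by blast

lemma diagI:
  assumes "\<And>i. i \<le> n \<Longrightarrow> x i = x 0"
  shows "x \<in> diag n"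
  unfolding diag_def mem_Collect_eq by (intro allI impI) (rule trans[OF assms sym[OF assms]])

lemma diag_Suc: "x \<in> diag (Suc n) \<longleftrightarrow> x \<in> diag n \<and> x (Suc n) = x 0"
proof (intro iffI conjI)
  assume x: "x \<in> diag (Suc n)"
  show "x \<in> diag n"
    by (rule diagI) (rule diagD[OF x], simp_all)
  show "x (Suc n) = x 0"
    by (rule diagD[OF x]) simp_all
next
  assume x: "x \<in> diag n \<and> x (Suc n) = x 0"
  show "x \<in> diag (Suc n)"
  proof (rule diagI)
    fix i assume "i \<le> Suc n"
    then consider "i \<le> n" | "i = Suc n" by linarith
    then show "x i = x 0"
      using x diagD[of x n i 0] by cases auto
  qed
qed

abbreviation identity_simplex :: "nat \<Rightarrow> (nat \<Rightarrow> real) \<Rightarrow> nat \<Rightarrow> real" where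
  "identity_simplex n \<equiv> restrict id (standard_simplex n)"

lemma singular_simplex_identity:
  "standard_simplex n \<subseteq> A \<Longrightarrow> singular_simplex n (subtopology coord_space A) (identity_simplex n)"
  by (auto simp: singular_simplex_def continuous_map_in_subtopology continuous_map_from_subtopology
      intro: continuous_map_eq[where f = id])

lemma singular_face_identity:
  assumes "k \<le> Suc n"
  shows "singular_face (Suc n) k (identity_simplex (Suc n)) = restrict (simplical_face k) (standard_simplex n)"
proof -
  have "singular_face (Suc n) k (identity_simplex (Suc n)) = singular_face (Suc n) k id"
    using assms by simp
  then show ?thesis by (simp add: singular_face_def)
qed

text \<open>Points of \<open>standard_simplex n\<close> vanish beyond index \<open>n\<close>, so
  inserting a zero at position \<open>n + 1\<close> changes nothing. By this literal equality the
  boundary of one identity simplex contains the previous one.\<close>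

lemma singular_face_identity_last:
  "singular_face (Suc n) (Suc n) (identity_simplex (Suc n)) = identity_simplex n"
  unfolding singular_face_identity[OF order_refl]
proof (rule restrict_ext)
  fix x assume "x \<in> standard_simplex n"
  then show "simplical_face (Suc n) x = id x"
    by (auto simp: simplical_face_def standard_simplex_def)
qed

lemma continuous_on_coordinate [continuous_intros]:
  "continuous_on A (\<lambda>x::'a \<Rightarrow> 'b::topological_space. x i)"
  by (rule continuous_on_subset[OF continuous_on_product_coordinates]) simp

lemma standard_simplex_diag:
  assumes "x \<in> standard_simplex n" "x \<in> diag n" "i \<le> n"
  shows "x i = 1 / (real n + 1)"
proof -
  have x0: "x j = x 0" if "j \<le> n" for j
    by (rule diagD[OF assms(2) that]) simp
  have "1 = (\<Sum>j\<le>n. x j)"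
    using assms by (simp add: standard_simplex_def)
  also have "\<dots> = (\<Sum>j\<le>n. x 0)"
    by (intro sum.cong refl x0) simp
  finally have "x 0 = 1 / (real n + 1)"
    by (simp add: field_simps)
  with x0[OF assms(3)] show ?thesis by simp
qed

lemma not_diag_if_zero:
  assumes "x \<in> standard_simplex n" "i \<le> n" "x i = 0"
  shows "x \<notin> diag n"
  using standard_simplex_diag[OF assms(1) _ assms(2)] assms(3) by auto

text \<open>A simplex point on the diagonal has all coordinates \<open>1 / (n + 1)\<close>, whereas
  each face has a vanishing coordinate; so the boundary avoids \<open>diag n\<close>. The set
  \<open>A\<close> is arbitrary because the same cycle is moved between several spaces.\<close>

lemma relcycle_identity:
  assumes "standard_simplex n \<subseteq> A"
  shows "singular_relcycle n (subtopology coord_space A) (- diag n) (frag_of (identity_simplex n))"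
proof (cases n)
  case 0
  then show ?thesis
    using assms by (simp add: singular_relcycle singular_chain_of singular_simplex_identity chain_boundary_of)
next
  case (Suc m)
  have "singular_simplex m (subtopology (subtopology coord_space A) (- diag n)) (singular_face (Suc m) k (identity_simplex (Suc m)))"
    if k: "k \<le> Suc m" for k
    unfolding singular_simplex_subtopology[of _ "subtopology coord_space A"]
  proof
    show "singular_simplex m (subtopology coord_space A) (singular_face (Suc m) k (identity_simplex (Suc m)))"
      using singular_simplex_singular_face[OF singular_simplex_identity[OF assms], of k] k Suc by simp
    have "simplical_face k x \<notin> diag n" if "x \<in> standard_simplex m" for x
      using not_diag_if_zero[of "simplical_face k x" n k] k Suc that
        simplical_face_in_standard_simplex[of n k x]
      by (auto simp: simplical_face_def)
    then show "singular_face (Suc m) k (identity_simplex (Suc m)) ` standard_simplex m \<subseteq> - diag n"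
      unfolding singular_face_identity[OF k] by auto
  qed
  then show ?thesis
    using assms Suc
    by (simp add: singular_relcycle singular_chain_of singular_simplex_identity chain_boundary_of del: sum.atMost_Suc singular_face_restrict)
       (intro singular_chain_sum singular_chain_cmul, simp add: singular_chain_of del: singular_face_restrict)
qed

text \<open>The closed half of \<open>diag n\<close> bounded by \<open>diag (Suc n)\<close>. It
  links consecutive dimensions: its complement is contractible, and away from
  \<open>diag (Suc n)\<close> it looks locally like \<open>diag n\<close>.\<close>

definition half_diag :: "nat \<Rightarrow> (nat \<Rightarrow> real) set" where
  "half_diag n = {x \<in> diag n. x (Suc n) \<le> x 0}"

text \<open>The last coordinate is compared with the mean of the others, and not with
  \<open>x 0\<close>, because \<open>standard_simplex n\<close> has to lie inside: there the last
  coordinate is 0 and the mean is \<open>1 / (n + 1)\<close>, but \<open>x 0\<close> may vanish. On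
  \<open>diag n\<close> the two comparisons agree.\<close>

definition low_last :: "nat \<Rightarrow> (nat \<Rightarrow> real) set" where
  "low_last n = {x. (real n + 1) * x (Suc n) < (\<Sum>i\<le>n. x i)}"

lemma diag_subset_half_diag: "diag (Suc n) \<subseteq> half_diag n"
  by (auto simp: half_diag_def diag_Suc)

lemma diag_sum: "x \<in> diag n \<Longrightarrow> (\<Sum>i\<le>n. x i) = (real n + 1) * x 0"
proof -
  assume "x \<in> diag n"
  then have "(\<Sum>i\<le>n. x i) = (\<Sum>i\<le>n. x 0)"
    by (intro sum.cong refl diagD) auto
  then show ?thesis by simp
qed

lemma half_diag_low_last: "half_diag n - diag (Suc n) \<subseteq> low_last n"
proof
  fix x assume "x \<in> half_diag n - diag (Suc n)"
  then have "x \<in> diag n" "x (Suc n) < x 0"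
    by (auto simp: half_diag_def diag_Suc)
  then show "x \<in> low_last n"
    by (simp add: low_last_def diag_sum)
qed

lemma low_last_disjoint: "low_last n \<inter> diag (Suc n) = {}"
proof -
  have "x \<notin> low_last n" if "x \<in> diag (Suc n)" for x
  proof -
    have "x \<in> diag n" "x (Suc n) = x 0"
      using that by (auto simp: diag_Suc)
    then show ?thesis by (simp add: low_last_def diag_sum)
  qed
  then show ?thesis by auto
qed

lemma low_last_half_diag: "low_last n \<inter> half_diag n = low_last n \<inter> diag n"
  by (auto simp: low_last_def half_diag_def diag_sum)

lemma closed_diag: "closed (diag n)"
proof -
  have "diag n = (\<Inter>i\<le>n. \<Inter>j\<le>n. {x. x i = x j})"
    unfolding diag_def by blast
  then show ?thesis
    by (auto intro!: closed_INT closed_Collect_eq continuous_intros)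
qed

lemma closed_half_diag: "closed (half_diag n)"
proof -
  have "half_diag n = diag n \<inter> {x. x (Suc n) \<le> x 0}"
    by (auto simp: half_diag_def)
  then show ?thesis
    by (auto intro!: closed_diag closed_Int closed_Collect_le continuous_intros)
qed

lemma open_low_last: "open (low_last n)"
  unfolding low_last_def by (intro open_Collect_less continuous_intros)

lemma contractible_if_star_shaped:
  assumes a: "a \<in> A"
    and star: "\<And>x t. \<lbrakk>x \<in> A; 0 \<le> t; t \<le> 1\<rbrakk> \<Longrightarrow> (\<lambda>i. (1 - t) * x i + t * a i) \<in> A"
  shows "contractible_space (subtopology coord_space A)"
proof -
  have "homotopic_with (\<lambda>x. True) (subtopology coord_space A) (subtopology coord_space A) id (\<lambda>x. a)"
  proof (rule homotopic_with_segments)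
    show "continuous_map (subtopology coord_space A) (subtopology coord_space A) (\<lambda>x. a)"
      using a by simp
    show "(\<lambda>i. (1 - t) * id x i + t * a i) \<in> A" if "x \<in> A" "0 \<le> t" "t \<le> 1" for x t
      using star[OF that] by simp
  qed auto
  then show ?thesis
    unfolding contractible_space_def by blast
qed

lemma contractible_coord_space: "contractible_space coord_space"
  using contractible_if_star_shaped[of undefined UNIV] by simp

lemma contractible_Compl_half_diag: "contractible_space (subtopology coord_space (- half_diag n))"
proof (rule contractible_if_star_shaped)
  \<comment> \<open>Moving towards this centre raises the last coordinate relative to the others and
    scales the differences of the others, so a segment that meets \<open>half_diag n\<close> must
    have started in it.\<close>
  let ?e = "\<lambda>j. if j = Suc n then 1 else 0 :: real"
  show "?e \<in> - half_diag n"
    by (auto simp: half_diag_def)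
  fix x :: "nat \<Rightarrow> real" and t :: real
  assume x: "x \<in> - half_diag n" and t: "0 \<le> t" "t \<le> 1"
  show "(\<lambda>i. (1 - t) * x i + t * ?e i) \<in> - half_diag n"
  proof
    assume y: "(\<lambda>i. (1 - t) * x i + t * ?e i) \<in> half_diag n"
    then have "(\<lambda>i. (1 - t) * x i + t * ?e i) \<in> diag n"
      unfolding half_diag_def by blast
    from diagD[OF this] have eq: "(1 - t) * x i = (1 - t) * x j" if "i \<le> n" "j \<le> n" for i j
      using that by fastforce
    have le: "(1 - t) * x (Suc n) + t \<le> (1 - t) * x 0"
      using y by (auto simp: half_diag_def)
    show False
    proof (cases "t = 1")
      case True
      then show ?thesis using le by simp
    next
      case False
      then have "1 - t > 0" using t by simp
      have "(1 - t) * x (Suc n) \<le> (1 - t) * x 0"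
        using le t by linarith
      then have "x (Suc n) \<le> x 0"
        using \<open>1 - t > 0\<close> by simp
      moreover have "x \<in> diag n"
      proof (rule diagI)
        fix i assume "i \<le> n"
        from eq[OF this, of 0] False show "x i = x 0" by simp
      qed
      ultimately show ?thesis
        using x by (simp add: half_diag_def)
    qed
  qed
qed

section \<open>Excision, with subspaces given up to the ambient space\<close>

lemma relative_homology_group_cong:
  assumes "topspace X \<inter> S = topspace X \<inter> T"
  shows "relative_homology_group p X S = relative_homology_group p X T"
proof -
  have "relative_homology_group p X S = relative_homology_group p X (topspace X \<inter> T)"
    unfolding assms[symmetric] by (rule relative_homology_group_restrict[symmetric])
  then show ?thesis by (simp only: relative_homology_group_restrict)
qed

lemma hom_induced_cong:
  assumes "topspace X \<inter> S = topspace X \<inter> S'" "topspace Y \<inter> T = topspace Y \<inter> T'"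
  shows "hom_induced p X S Y T = hom_induced p X S' Y T'"
proof -
  have "hom_induced p X S Y T = hom_induced p X (topspace X \<inter> S') Y (topspace Y \<inter> T')"
    unfolding assms[symmetric] by (rule hom_induced_restrict[symmetric])
  then show ?thesis by (simp only: hom_induced_restrict)
qed

text \<open>The excised set is the complement of \<open>U\<close>: it is closed and lies in the open
  complement of \<open>C\<close>. \<open>S\<close> only has to cut out the complement of
  \<open>C\<close> within \<open>X\<close>, so one set such as \<open>- diag n\<close> can serve in
  every ambient space.\<close>

lemma excision_open_iso:
  assumes U: "openin X U" and C: "closedin X C" and CU: "C \<subseteq> U" and S: "topspace X \<inter> S = topspace X - C"
  shows "hom_induced p (subtopology X U) S X S id
         \<in> iso (relative_homology_group p (subtopology X U) S) (relative_homology_group p X S)"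
proof -
  let ?Z = "topspace X - U" and ?T = "topspace X - C"
  have "X closure_of ?Z = ?Z"
    using U by (simp add: closure_of_eq closedin_diff)
  moreover have "X interior_of ?T = ?T"
    using C by (simp add: interior_of_eq openin_diff)
  ultimately have *: "X closure_of ?Z \<subseteq> X interior_of ?T"
    using CU by auto
  have Us: "U \<subseteq> topspace X"
    by (rule openin_subset[OF U])
  then have ZU: "topspace X - ?Z = U" and TZ: "topspace (subtopology X U) \<inter> (?T - ?Z) = topspace (subtopology X U) \<inter> S"
    using S by auto
  have "hom_induced p (subtopology X U) (?T - ?Z) X ?T id
    \<in> iso (relative_homology_group p (subtopology X U) (?T - ?Z)) (relative_homology_group p X ?T)"
    using homology_excision_axiom[OF *, of "topspace X" p] by (simp add: ZU)
  moreover have T: "topspace X \<inter> ?T = topspace X \<inter> S"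
    using S by auto
  ultimately show ?thesis
    by (simp only: relative_homology_group_cong[OF TZ] relative_homology_group_cong[OF T] hom_induced_cong[OF TZ T])
qed

text \<open>Off \<open>diag (Suc n)\<close> all of \<open>half_diag n\<close> lies in the open set
  \<open>low_last n\<close>, and there it coincides with \<open>diag n\<close>. Excising the rest
  replaces the half-space by the diagonal of the preceding dimension.\<close>

lemma iso_low_last_excision:
  "hom_induced p (subtopology coord_space (low_last n)) (- diag n)
      (subtopology coord_space (- diag (Suc n))) (- half_diag n) id
   \<in> iso (relative_homology_group p (subtopology coord_space (low_last n)) (- diag n))
         (relative_homology_group p (subtopology coord_space (- diag (Suc n))) (- half_diag n))"
proof -
  let ?X = "subtopology coord_space (- diag (Suc n))"
  let ?U = "subtopology coord_space (low_last n)"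
  have low: "- diag (Suc n) \<inter> low_last n = low_last n"
    using low_last_disjoint[of n] by auto
  have U: "openin ?X (low_last n)"
    using openin_open_Int[OF open_low_last[of n], of "- diag (Suc n)"] low
    by (simp add: coord_space_euclidean)
  have C: "closedin ?X (- diag (Suc n) \<inter> half_diag n)"
    unfolding coord_space_euclidean by (intro closedin_closed_Int closed_half_diag)
  have CU: "- diag (Suc n) \<inter> half_diag n \<subseteq> low_last n"
    using half_diag_low_last[of n] by blast
  have "hom_induced p (subtopology ?X (low_last n)) (- half_diag n) ?X (- half_diag n) id
    \<in> iso (relative_homology_group p (subtopology ?X (low_last n)) (- half_diag n))
          (relative_homology_group p ?X (- half_diag n))"
    by (rule excision_open_iso[OF U C CU]) auto
  moreover have "subtopology ?X (low_last n) = ?U"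
    by (simp only: subtopology_subtopology low)
  moreover have T: "topspace ?U \<inter> - half_diag n = topspace ?U \<inter> - diag n"
    using low_last_half_diag[of n] by auto
  ultimately show ?thesis
    by (simp only: relative_homology_group_cong[OF T] hom_induced_cong[OF T refl])
qed

lemma iso_low_last_inclusion:
  "hom_induced p (subtopology coord_space (low_last n)) (- diag n) coord_space (- diag n) id
   \<in> iso (relative_homology_group p (subtopology coord_space (low_last n)) (- diag n))
         (relative_homology_group p coord_space (- diag n))"
proof -
  \<comment> \<open>The last coordinate becomes the mean of the others minus 1, which satisfies the
    strict inequality of \<open>low_last\<close> for every point. Coordinates up to \<open>n\<close>
    are kept, so membership in \<open>diag n\<close> is constant along the segment from
    \<open>j x\<close> to \<open>x\<close>.\<close>
  define j where "j = (\<lambda>x::nat \<Rightarrow> real. \<lambda>i. if i = Suc n then (\<Sum>i\<le>n. x i) / (real n + 1) - 1 else x i)"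
  let ?U = "subtopology coord_space (low_last n)"
  have j_eq: "j x i = x i" if "i \<le> n" for x i
    using that by (simp add: j_def)
  have j_last: "(real n + 1) * j x (Suc n) = (\<Sum>i\<le>n. x i) - (real n + 1)" for x
    by (simp add: j_def field_simps)
  have sum_j: "(\<Sum>i\<le>n. (1 - t) * j x i + t * x i) = (\<Sum>i\<le>n. x i)" for t x
    by (rule sum.cong) (simp_all add: j_eq flip: distrib_right)
  have j_low: "j x \<in> low_last n" for x
    using sum_j[of 0 x] j_last[of x] by (simp add: low_last_def)
  have "continuous_map coord_space euclideanreal (\<lambda>x. j x i)" for i
    unfolding j_def coord_space_euclidean by (auto intro!: continuous_intros)
  then have jc: "continuous_map coord_space ?U j"
    using j_low by (auto simp: continuous_map_in_subtopology continuous_map_componentwise_UNIV)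
  have seg: "(\<lambda>i. (1 - t) * j x i + t * x i) \<in> low_last n"
    if "x \<in> low_last n" "0 \<le> t" "t \<le> 1" for x t
  proof -
    let ?S = "\<Sum>i\<le>n. x i" and ?N = "real n + 1"
    have "?N * ((1 - t) * j x (Suc n) + t * x (Suc n)) = (1 - t) * (?N * j x (Suc n)) + t * (?N * x (Suc n))"
      by (simp add: algebra_simps)
    also have "\<dots> = (1 - t) * (?S - ?N) + t * (?N * x (Suc n))"
      by (simp only: j_last)
    also have "\<dots> < ?S"
    proof (cases "t = 0")
      case False
      then have "t * (?N * x (Suc n)) < t * ?S"
        using that by (simp add: low_last_def)
      moreover have "(1 - t) * (?S - ?N) \<le> (1 - t) * ?S"
        using that by (intro mult_left_mono) auto
      ultimately show ?thesis by (simp add: algebra_simps)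
    qed simp
    finally show ?thesis
      unfolding low_last_def mem_Collect_eq sum_j .
  qed
  have diag_j: "(\<lambda>i. (1 - t) * j x i + t * x i) \<in> diag n \<longleftrightarrow> x \<in> diag n" for x t
  proof -
    have "(1 - t) * j x i + t * x i = x i" if "i \<le> n" for i
      using that by (simp add: j_eq flip: distrib_right)
    then show ?thesis
      unfolding diag_def by simp
  qed
  have jU: "continuous_map ?U ?U (j \<circ> id)"
    using continuous_map_from_subtopology[OF jc] by simp
  have homU: "homotopic_with (\<lambda>h. h \<in> low_last n \<inter> - diag n \<rightarrow> low_last n \<inter> - diag n) ?U ?U (j \<circ> id) id"
  proof (rule homotopic_with_segments[OF jU])
    show "(\<lambda>i. (1 - t) * (j \<circ> id) x i + t * id x i) \<in> low_last n"
      if "x \<in> low_last n" "0 \<le> t" "t \<le> 1" for x t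
      using seg[OF that] by simp
    show "(\<lambda>x i. (1 - t) * (j \<circ> id) x i + t * id x i) \<in> low_last n \<inter> - diag n \<rightarrow> low_last n \<inter> - diag n"
      if "0 \<le> t" "t \<le> 1" for t
      using seg[OF _ that] diag_j[of t] by simp
  qed (auto simp: Pi_iff)
  have "continuous_map coord_space coord_space j"
    using jc by (simp add: continuous_map_in_subtopology)
  then have homV: "homotopic_with (\<lambda>h. h \<in> - diag n \<rightarrow> - diag n) coord_space coord_space (id \<circ> j) id"
    using homotopic_with_segments[of UNIV UNIV j id "\<lambda>h. h \<in> - diag n \<rightarrow> - diag n"] diag_j
    by (simp add: Pi_iff)
  have "hom_induced p ?U (low_last n \<inter> - diag n) coord_space (- diag n) id
    \<in> iso (relative_homology_group p ?U (low_last n \<inter> - diag n)) (relative_homology_group p coord_space (- diag n))"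
  proof (rule homotopy_equivalence_relative_homology_group_isomorphism[OF _ _ jc _ homU homV])
    show "j \<in> - diag n \<rightarrow> low_last n \<inter> - diag n"
      using diag_j[of 0] j_low by auto
  qed (auto simp: continuous_map_from_subtopology)
  then show ?thesis
    using hom_induced_restrict[of p ?U "- diag n" coord_space "- diag n"]
      relative_homology_group_restrict[of p ?U "- diag n"] by simp
qed

section \<open>The class of the identity simplex\<close>

lemma homologous_rel_set_uminus:
  assumes "singular_relcycle n X S c"
  shows "inv\<^bsub>relative_homology_group (int n) X S\<^esub> (homologous_rel_set n X S c) = homologous_rel_set n X S (- c)"
proof -
  have "homologous_rel_set n X S c \<in> carrier (relative_homology_group (int n) X S)"
    using assms by (auto simp: carrier_relative_homology_group)
  then have "inv\<^bsub>relative_homology_group (int n) X S\<^esub> (homologous_rel_set n X S c)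
      = uminus ` homologous_rel_set n X S c"
    by (rule inv_relative_homology_group)
  moreover have "homologous_rel n X S c (- x) \<longleftrightarrow> homologous_rel n X S (- c) x" for x
    unfolding homologous_rel_def
    using singular_relboundary_minus[of n X S "c - - x"] singular_relboundary_minus[of n X S "- c - x"]
    by (auto simp: algebra_simps)
  moreover have "uminus ` homologous_rel_set n X S c = {x. homologous_rel n X S c (- x)}"
    by (auto simp: image_iff) (metis add.inverse_inverse)
  ultimately show ?thesis
    by simp
qed

lemma free_generator_uminus:
  assumes "singular_relcycle n X S c"
    and "free_generator (relative_homology_group (int n) X S) (homologous_rel_set n X S c)"
  shows "free_generator (relative_homology_group (int n) X S) (homologous_rel_set n X S (- c))"
  using free_generator_inv[OF group_relative_homology_group assms(2)]
  by (simp add: homologous_rel_set_uminus[OF assms(1)])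

text \<open>The identity simplex is universal: the chain map of a singular simplex sends it to that
  simplex. This is how isomorphisms of pairs transport the generator.\<close>

lemma hom_induced_identity_simplex:
  assumes A: "standard_simplex n \<subseteq> A" and f: "singular_simplex n X f"
    and cont: "continuous_map (subtopology coord_space A) X f" and im: "f \<in> A \<inter> - diag n \<rightarrow> T"
  shows "hom_induced (int n) (subtopology coord_space A) (- diag n) X T f
       (homologous_rel_set n (subtopology coord_space A) (- diag n) (frag_of (identity_simplex n)))
     = homologous_rel_set n X T (frag_of f)"
proof -
  have "chain_map n f (frag_of (identity_simplex n)) = frag_of f"
    by (rule singular_simplex_chain_map_id[OF f])
  then show ?thesis
    using hom_induced_chain_map_gen[OF cont _ relcycle_identity[OF A]] im by (simp add: Pi_iff)
qed

lemma hom_induced_id_identity_simplex: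
  assumes A: "standard_simplex n \<subseteq> A" "A \<subseteq> B" and T: "A \<inter> - diag n \<subseteq> T"
  shows "hom_induced (int n) (subtopology coord_space A) (- diag n) (subtopology coord_space B) T id
       (homologous_rel_set n (subtopology coord_space A) (- diag n) (frag_of (identity_simplex n)))
     = homologous_rel_set n (subtopology coord_space B) T (frag_of (identity_simplex n))"
proof -
  have cont: "continuous_map (subtopology coord_space A) (subtopology coord_space B) id"
    using A(2) by (auto simp: continuous_map_in_subtopology continuous_map_from_subtopology)
  have "chain_map n id (frag_of (identity_simplex n)) = frag_of (identity_simplex n)"
    by (rule chain_map_ident) (simp only: singular_chain_of, rule singular_simplex_identity[OF A(1)])
  then show ?thesis
    using hom_induced_chain_map_gen[OF cont _ relcycle_identity[OF A(1)]] T by (auto simp: Pi_iff)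
qed

lemma homologous_rel_set_in_carrier:
  "singular_relcycle n X S c \<Longrightarrow> homologous_rel_set n X S c \<in> carrier (relative_homology_group (int n) X S)"
  by (auto simp: carrier_relative_homology_group)

lemma free_generator_hom_induced:
  assumes "hom_induced (int n) X S Y T f \<in> iso (relative_homology_group (int n) X S) (relative_homology_group (int n) Y T)"
    and "singular_relcycle n X S c"
  shows "free_generator (relative_homology_group (int n) Y T) (hom_induced (int n) X S Y T f (homologous_rel_set n X S c))
     \<longleftrightarrow> free_generator (relative_homology_group (int n) X S) (homologous_rel_set n X S c)"
  by (intro free_generator_iso assms homologous_rel_set_in_carrier) simp_all

lemma standard_simplex_low_last: "standard_simplex n \<subseteq> low_last n"
  by (auto simp: standard_simplex_def low_last_def)

text \<open>Only the last face of the boundary is not contained in \<open>- half_diag n\<close>.\<close>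

lemma hom_relboundary_identity:
  "hom_relboundary (int (Suc n)) coord_space (- diag (Suc n)) (- half_diag n)
      (homologous_rel_set (Suc n) coord_space (- diag (Suc n)) (frag_of (identity_simplex (Suc n))))
   = homologous_rel_set n (subtopology coord_space (- diag (Suc n))) (- half_diag n)
      (frag_cmul ((- 1) ^ Suc n) (frag_of (identity_simplex n)))"
proof -
  let ?Y = "subtopology coord_space (- diag (Suc n))"
  let ?i = "identity_simplex (Suc n)"
  let ?b = "chain_boundary (Suc n) (frag_of ?i)"
  have cyc: "singular_relcycle (Suc n) coord_space (- diag (Suc n)) (frag_of ?i)"
    using relcycle_identity[of "Suc n" UNIV] by simp
  then have b: "singular_relcycle n ?Y {} ?b"
    using chain_boundary_boundary[of "Suc n" coord_space "frag_of ?i"]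
    by (simp add: singular_relcycle singular_cycle)
  have "hom_boundary (int (Suc n)) coord_space (- diag (Suc n)) (homologous_rel_set (Suc n) coord_space (- diag (Suc n)) (frag_of ?i))
    = homologous_rel_set n ?Y {} ?b"
    using hom_boundary_chain_boundary[OF cyc] by simp
  moreover have "hom_induced (int n) ?Y {} ?Y (- half_diag n) id (homologous_rel_set n ?Y {} ?b)
    = homologous_rel_set n ?Y (- half_diag n) ?b"
    using hom_induced_chain_map_gen[OF continuous_map_id _ b, of "- half_diag n"]
      chain_map_ident[of n ?Y ?b] b by (simp add: singular_relcycle)
  moreover have "homologous_rel n ?Y (- half_diag n) ?b (frag_cmul ((- 1) ^ Suc n) (frag_of (identity_simplex n)))"
  proof -
    have sum: "?b - frag_cmul ((- 1) ^ Suc n) (frag_of (identity_simplex n))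
      = (\<Sum>k\<le>n. frag_cmul ((- 1) ^ k) (frag_of (singular_face (Suc n) k ?i)))"
      unfolding chain_boundary_of by (simp add: singular_face_identity_last del: singular_face_restrict)
    have "singular_simplex n (subtopology ?Y (- half_diag n)) (singular_face (Suc n) k ?i)" if k: "k \<le> n" for k
    proof -
      \<comment> \<open>Otherwise the first \<open>n + 1\<close> coordinates would all equal the
        zero inserted at \<open>k\<close> and the last would be at most 0, against coordinate sum
        1.\<close>
      have "simplical_face k x \<notin> half_diag n" if x: "x \<in> standard_simplex n" for x
      proof
        assume "simplical_face k x \<in> half_diag n"
        then have d: "simplical_face k x \<in> diag n" "simplical_face k x (Suc n) \<le> simplical_face k x 0"
          by (auto simp: half_diag_def)
        have "simplical_face k x k = 0"
          by (simp add: simplical_face_def)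
        then have z: "simplical_face k x i = 0" if "i \<le> n" for i
          using diagD[OF d(1) that k] by simp
        have "simplical_face k x \<in> standard_simplex (Suc n)"
          using simplical_face_in_standard_simplex[of "Suc n" k x] k x by simp
        then have "1 = (\<Sum>i\<le>n. simplical_face k x i) + simplical_face k x (Suc n)"
          by (simp add: standard_simplex_def)
        then show False
          using d(2) z by simp
      qed
      moreover have "singular_simplex n coord_space (singular_face (Suc n) k ?i)"
        using singular_simplex_singular_face[of "Suc n" coord_space ?i k] singular_simplex_identity[of "Suc n" UNIV] k
        by simp
      moreover have "singular_face (Suc n) k ?i ` standard_simplex n = simplical_face k ` standard_simplex n"
        using singular_face_identity[of k n] k by simp
      moreover have "subtopology ?Y (- half_diag n) = subtopology coord_space (- half_diag n)"
        using diag_subset_half_diag[of n] by (simp add: subtopology_subtopology Int_absorb1)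
      ultimately show ?thesis
        by (auto simp: singular_simplex_subtopology)
    qed
    then show ?thesis
      unfolding homologous_rel_def sum
      by (intro singular_chain_imp_relboundary singular_chain_sum singular_chain_cmul)
         (simp add: singular_chain_of del: singular_face_restrict)
  qed
  ultimately show ?thesis
    by (simp add: hom_relboundary_def homologous_rel_set_eq)
qed

text \<open>The induction step is a chain of isomorphisms. As the whole space and the complement of
  \<open>half_diag n\<close> are contractible, the boundary map of the triple leads to degree
  \<open>n\<close> of the pair (\<open>- diag (Suc n)\<close>, \<open>- half_diag n\<close>);
  excision to \<open>low_last n\<close> and enlargement to the whole space lead on to the pair of
  the induction hypothesis. The identity simplices correspond up to sign.\<close>

theorem free_generator_identity_simplex:
  "free_generator (relative_homology_group (int n) coord_space (- diag n))
     (homologous_rel_set n coord_space (- diag n) (frag_of (identity_simplex n)))"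
proof (induction n)
  case 0
  \<comment> \<open>With nothing left outside the diagonal, the base case is absolute homology of
    degree 0 of a path-connected space.\<close>
  have D: "- diag 0 = {}"
    by (auto intro: diagI)
  have "singular_simplex 0 coord_space (identity_simplex 0)"
    using singular_simplex_identity[of 0 UNIV] by simp
  from iso_integer_zeroth_homology_group[OF contractible_imp_path_connected_space[OF contractible_coord_space] this]
  have "bij_betw (\<lambda>k::int. homologous_rel_set 0 coord_space {} (frag_of (identity_simplex 0)) [^]\<^bsub>homology_group 0 coord_space\<^esub> k)
      UNIV (carrier (homology_group 0 coord_space))"
    by (simp add: iso_def integer_group_def del: restrict_apply)
  moreover have "singular_relcycle 0 coord_space {} (frag_of (identity_simplex 0))"
    using relcycle_identity[of 0 UNIV] by (simp only: D subtopology_UNIV subset_UNIV)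
  ultimately show ?case
    using homologous_rel_set_in_carrier[of 0 coord_space "{}"] by (simp only: free_generator_def D of_nat_0)
next
  case (Suc n)
  let ?V = "coord_space" and ?U = "subtopology coord_space (low_last n)"
    and ?Y = "subtopology coord_space (- diag (Suc n))"
  let ?i = "frag_of (identity_simplex n)"
  have cycU: "singular_relcycle n ?U (- diag n) ?i"
    by (rule relcycle_identity[OF standard_simplex_low_last])
  have low: "low_last n \<subseteq> - diag (Suc n)"
    using low_last_disjoint[of n] by auto
  have T: "low_last n \<inter> - diag n \<subseteq> - half_diag n"
    using low_last_half_diag[of n] by auto
  have "free_generator (relative_homology_group (int n) ?U (- diag n)) (homologous_rel_set n ?U (- diag n) ?i)"
    using Suc.IH free_generator_hom_induced[OF iso_low_last_inclusion cycU]
      hom_induced_id_identity_simplex[OF standard_simplex_low_last subset_UNIV Int_lower2]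
    by (simp only: subtopology_UNIV)
  then have gen: "free_generator (relative_homology_group (int n) ?Y (- half_diag n)) (homologous_rel_set n ?Y (- half_diag n) ?i)"
    using free_generator_hom_induced[OF iso_low_last_excision cycU]
      hom_induced_id_identity_simplex[OF standard_simplex_low_last low T] by (simp only:)
  have cycY: "singular_relcycle n ?Y (- half_diag n) ?i"
  proof -
    have cont: "continuous_map ?U ?Y id"
      using low by (auto simp: continuous_map_in_subtopology continuous_map_from_subtopology)
    have "chain_map n id ?i = ?i"
      by (rule chain_map_ident) (simp only: singular_chain_of, rule singular_simplex_identity[OF standard_simplex_low_last])
    moreover have "id \<in> low_last n \<inter> - diag n \<rightarrow> - half_diag n"
      using T by auto
    ultimately show ?thesis
      using singular_relcycle_chain_map[of n ?U "low_last n \<inter> - diag n" ?i ?Y id "- half_diag n"] cont cycU T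
        singular_relcycle_restrict[of n ?U "- diag n"] by auto
  qed
  \<comment> \<open>The last face enters the boundary with the sign \<open>(- 1) ^ Suc n\<close>;
    the inverse of a free generator is again one.\<close>
  have "free_generator (relative_homology_group (int n) ?Y (- half_diag n))
     (homologous_rel_set n ?Y (- half_diag n) (frag_cmul ((- 1) ^ Suc n) ?i))"
  proof (cases "even n")
    case True
    then show ?thesis
      using free_generator_uminus[OF cycY gen] by simp
  next
    case False
    then show ?thesis
      using gen by simp
  qed
  then have 1: "free_generator (relative_homology_group (int (Suc n) - 1) ?Y (- half_diag n))
     (hom_relboundary (int (Suc n)) ?V (- diag (Suc n)) (- half_diag n)
       (homologous_rel_set (Suc n) ?V (- diag (Suc n)) (frag_of (identity_simplex (Suc n)))))"
    unfolding hom_relboundary_identity by simp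
  have ne: "topspace ?V \<inter> - half_diag n \<noteq> {}"
  proof -
    have "(\<lambda>j. if j = Suc n then 1 else 0) \<in> - half_diag n"
      by (simp add: half_diag_def)
    then show ?thesis
      by (metis Int_UNIV_left coord_space_euclidean empty_iff topspace_euclidean)
  qed
  have 2: "hom_relboundary (int (Suc n)) ?V (- diag (Suc n)) (- half_diag n)
    \<in> iso (relative_homology_group (int (Suc n)) ?V (- diag (Suc n))) (relative_homology_group (int (Suc n) - 1) ?Y (- half_diag n))"
    using diag_subset_half_diag[of n]
    by (intro iso_hom_relboundary_contractible contractible_coord_space contractible_Compl_half_diag ne) auto
  have "singular_relcycle (Suc n) ?V (- diag (Suc n)) (frag_of (identity_simplex (Suc n)))"
    using relcycle_identity[of "Suc n" UNIV] by simp
  from homologous_rel_set_in_carrier[OF this] show ?case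
    using free_generator_iso[OF 2 group_relative_homology_group group_relative_homology_group] 1 by blast
qed

section \<open>Local homology classes of embedded simplices\<close>

definition open_simplex :: "nat \<Rightarrow> (nat \<Rightarrow> real) set" where
  "open_simplex n = {x \<in> standard_simplex n. \<forall>i\<le>n. 0 < x i}"

text \<open>The points whose translate along (1, ..., 1) to coordinate sum 1 has positive
  coordinates up to \<open>n\<close>. The open simplex is not open in the infinite product; the tube
  is an open set around \<open>diag n\<close> that retracts onto the open simplex.\<close>

definition simplex_tube :: "nat \<Rightarrow> (nat \<Rightarrow> real) set" where
  "simplex_tube n = {x. \<forall>i\<le>n. (\<Sum>j\<le>n. x j) < (real n + 1) * x i + 1}"

lemma open_simplex_subset: "open_simplex n \<subseteq> standard_simplex n"
  by (auto simp: open_simplex_def)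

lemma diag_subset_tube: "diag n \<subseteq> simplex_tube n"
proof
  fix x assume x: "x \<in> diag n"
  have "(\<Sum>j\<le>n. x j) < (real n + 1) * x i + 1" if "i \<le> n" for i
    using diag_sum[OF x] diagD[OF x that, of 0] by simp
  then show "x \<in> simplex_tube n"
    by (simp add: simplex_tube_def)
qed

lemma open_simplex_tube: "open (simplex_tube n)"
proof -
  have "simplex_tube n = (\<Inter>i\<le>n. {x. (\<Sum>j\<le>n. x j) < (real n + 1) * x i + 1})"
    by (auto simp: simplex_tube_def)
  then show ?thesis
    by (auto intro!: open_INT open_Collect_less continuous_on_coordinate continuous_on_sum continuous_on_add
        continuous_on_mult continuous_on_const)
qed

lemma iso_open_simplex_tube:
  "hom_induced p (subtopology coord_space (open_simplex n)) (- diag n) (subtopology coord_space (simplex_tube n)) (- diag n) id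
   \<in> iso (relative_homology_group p (subtopology coord_space (open_simplex n)) (- diag n))
         (relative_homology_group p (subtopology coord_space (simplex_tube n)) (- diag n))"
proof -
  \<comment> \<open>The same number is added to all coordinates up to \<open>n\<close>, to make
    their sum 1, and the others are set to 0. A common shift preserves equality of coordinates, so
    the segments from \<open>r x\<close> to \<open>x\<close> respect \<open>diag n\<close> and its
    complement.\<close>
  define r where "r = (\<lambda>x::nat \<Rightarrow> real. \<lambda>i. if i \<le> n then x i + (1 - (\<Sum>j\<le>n. x j)) / (real n + 1) else 0)"
  let ?O = "subtopology coord_space (open_simplex n)" and ?C = "subtopology coord_space (simplex_tube n)"
  have r_le: "r x i = x i + (1 - (\<Sum>j\<le>n. x j)) / (real n + 1)" if "i \<le> n" for x i
    using that by (simp add: r_def)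
  have sum_r: "(\<Sum>j\<le>n. r x j) = 1" for x
  proof -
    define c where "c = (1 - (\<Sum>j\<le>n. x j)) / (real n + 1)"
    have "(\<Sum>j\<le>n. r x j) = (\<Sum>j\<le>n. x j + c)"
      by (rule sum.cong) (simp_all add: r_le c_def)
    also have "\<dots> = (\<Sum>j\<le>n. x j) + (real n + 1) * c"
      by (simp add: sum.distrib algebra_simps)
    finally show ?thesis
      by (simp add: c_def)
  qed
  have r_pos: "0 < r x i" if "x \<in> simplex_tube n" "i \<le> n" for x i
  proof -
    have "0 < ((real n + 1) * x i + 1 - (\<Sum>j\<le>n. x j)) / (real n + 1)"
      using that by (auto simp: simplex_tube_def intro!: divide_pos_pos)
    also have "\<dots> = r x i"
      using that by (simp add: r_le field_simps)
    finally show ?thesis .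
  qed
  have r_open: "r x \<in> open_simplex n" if x: "x \<in> simplex_tube n" for x
  proof -
    have zero: "r x i = 0" if "n < i" for i
      using that by (simp add: r_def)
    have ge: "0 \<le> r x i" for i
      using r_pos[OF x, of i] zero[of i] by (cases "i \<le> n") auto
    have "r x i \<le> 1" for i
    proof (cases "i \<le> n")
      case True
      then have "r x i \<le> (\<Sum>j\<le>n. r x j)"
        using ge by (intro member_le_sum) auto
      then show ?thesis by (simp add: sum_r)
    qed (simp add: zero)
    then show ?thesis
      using zero ge sum_r[of x] r_pos[OF x] by (simp add: open_simplex_def standard_simplex_def)
  qed
  have r_id: "r x = x" if "x \<in> open_simplex n" for x
    using that by (auto simp: r_def open_simplex_def standard_simplex_def fun_eq_iff)
  have OC: "open_simplex n \<subseteq> simplex_tube n"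
  proof
    fix x assume x: "x \<in> open_simplex n"
    then have "(\<Sum>j\<le>n. x j) = 1" "\<forall>i\<le>n. 0 < x i"
      by (auto simp: open_simplex_def standard_simplex_def)
    then show "x \<in> simplex_tube n"
      by (auto simp: simplex_tube_def)
  qed
  have "continuous_map coord_space euclideanreal (\<lambda>x. r x i)" for i
    unfolding r_def coord_space_euclidean by (auto intro!: continuous_intros)
  then have "continuous_map coord_space coord_space r"
    by (simp add: continuous_map_componentwise_UNIV)
  then have rc: "continuous_map ?C ?O r"
    using r_open by (auto simp: continuous_map_in_subtopology continuous_map_from_subtopology)
  have ic: "continuous_map ?O ?C id"
    using OC by (auto simp: continuous_map_in_subtopology continuous_map_from_subtopology)
  have diag_r: "(\<lambda>i. (1 - t) * r x i + t * x i) \<in> diag n \<longleftrightarrow> x \<in> diag n" for x t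
  proof -
    have eq: "(1 - t) * r x i + t * x i = x i + (1 - t) * ((1 - (\<Sum>j\<le>n. x j)) / (real n + 1))" if "i \<le> n" for i
      by (simp only: r_le[OF that]) (simp only: algebra_simps)
    show ?thesis
      unfolding diag_def by (simp add: eq)
  qed
  have seg: "(\<lambda>i. (1 - t) * r x i + t * x i) \<in> simplex_tube n"
    if x: "x \<in> simplex_tube n" and t: "0 \<le> t" "t \<le> 1" for x t
  proof -
    let ?S = "\<Sum>j\<le>n. x j"
    have sum: "(\<Sum>j\<le>n. (1 - t) * r x j + t * x j) = (1 - t) + t * ?S"
      by (simp add: sum.distrib sum_r flip: sum_distrib_left)
    have "(1 - t) + t * ?S < (real n + 1) * ((1 - t) * r x i + t * x i) + 1" if "i \<le> n" for i
    proof -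
      have e1: "(real n + 1) * r x i = (real n + 1) * x i + (1 - ?S)"
        using that by (simp add: r_le field_simps)
      have e2: "(real n + 1) * ((1 - t) * r x i + t * x i) = (1 - t) * ((real n + 1) * r x i) + t * ((real n + 1) * x i)"
        by (simp add: algebra_simps)
      have "(real n + 1) * ((1 - t) * r x i + t * x i) = (real n + 1) * x i + (1 - t) * (1 - ?S)"
        unfolding e2 e1 by (simp add: algebra_simps)
      moreover have "?S < (real n + 1) * x i + 1"
        using x that by (simp add: simplex_tube_def)
      ultimately show ?thesis
        by (simp add: algebra_simps)
    qed
    then show ?thesis
      unfolding simplex_tube_def by (simp add: sum)
  qed
  have homO: "homotopic_with (\<lambda>h. h \<in> open_simplex n \<inter> - diag n \<rightarrow> open_simplex n \<inter> - diag n) ?O ?O (r \<circ> id) id"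
    using continuous_map_compose[OF ic rc] r_id by (intro homotopic_with_equal) auto
  have rC: "continuous_map ?C ?C (id \<circ> r)"
    using continuous_map_compose[OF rc ic] by simp
  have homC: "homotopic_with (\<lambda>h. h \<in> simplex_tube n \<inter> - diag n \<rightarrow> simplex_tube n \<inter> - diag n) ?C ?C (id \<circ> r) id"
  proof (rule homotopic_with_segments[OF rC])
    show "(\<lambda>i. (1 - t) * (id \<circ> r) x i + t * id x i) \<in> simplex_tube n"
      if "x \<in> simplex_tube n" "0 \<le> t" "t \<le> 1" for x t
      using seg[OF that] by simp
    show "(\<lambda>x i. (1 - t) * (id \<circ> r) x i + t * id x i) \<in> simplex_tube n \<inter> - diag n \<rightarrow> simplex_tube n \<inter> - diag n"
      if "0 \<le> t" "t \<le> 1" for t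
      using seg[OF _ that] diag_r[of t] by simp
  qed (auto simp: Pi_iff)
  have "hom_induced p ?O (open_simplex n \<inter> - diag n) ?C (simplex_tube n \<inter> - diag n) id
    \<in> iso (relative_homology_group p ?O (open_simplex n \<inter> - diag n)) (relative_homology_group p ?C (simplex_tube n \<inter> - diag n))"
  proof (rule homotopy_equivalence_relative_homology_group_isomorphism[OF ic _ rc _ homO homC])
    show "r \<in> simplex_tube n \<inter> - diag n \<rightarrow> open_simplex n \<inter> - diag n"
      using diag_r[of 0] r_open by auto
    show "id \<in> open_simplex n \<inter> - diag n \<rightarrow> simplex_tube n \<inter> - diag n"
      using OC by auto
  qed
  moreover have "topspace ?O \<inter> (open_simplex n \<inter> - diag n) = topspace ?O \<inter> - diag n"
    and "topspace ?C \<inter> (simplex_tube n \<inter> - diag n) = topspace ?C \<inter> - diag n"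
    by auto
  ultimately show ?thesis
    using relative_homology_group_cong[of ?O _ "- diag n" p] relative_homology_group_cong[of ?C _ "- diag n" p]
      hom_induced_cong[of ?O _ "- diag n" ?C _ "- diag n" p] by metis
qed

lemma iso_cancel_right:
  assumes f: "f \<in> iso G H" and g: "g \<in> hom H K" and gf: "g \<circ> f \<in> iso G K"
  shows "g \<in> iso H K"
proof -
  have "bij_betw f (carrier G) (carrier H)" "bij_betw (g \<circ> f) (carrier G) (carrier K)"
    using f gf by (auto simp: iso_def)
  then have "bij_betw g (carrier H) (carrier K)"
    using bij_betw_comp_iff by blast
  then show ?thesis
    using g by (simp add: iso_def)
qed

lemma open_simplex_diag:
  assumes "b \<in> standard_simplex n" "b \<in> diag n"
  shows "b \<in> open_simplex n" and "standard_simplex n \<inter> diag n = {b}"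
proof -
  show "b \<in> open_simplex n"
    using assms standard_simplex_diag[OF assms] by (auto simp: open_simplex_def)
  have "x = b" if x: "x \<in> standard_simplex n" "x \<in> diag n" for x
  proof
    fix i show "x i = b i"
    proof (cases "i \<le> n")
      case True
      then show ?thesis
        using standard_simplex_diag[OF x True] standard_simplex_diag[OF assms True] by simp
    next
      case False
      then show ?thesis
        using x(1) assms(1) by (simp add: standard_simplex_def)
    qed
  qed
  then show "standard_simplex n \<inter> diag n = {b}"
    using assms by blast
qed

lemma iso_open_simplex_standard:
  "hom_induced p (subtopology coord_space (open_simplex n)) (- diag n) (subtopology coord_space (standard_simplex n)) (- diag n) id
   \<in> iso (relative_homology_group p (subtopology coord_space (open_simplex n)) (- diag n))
         (relative_homology_group p (subtopology coord_space (standard_simplex n)) (- diag n))"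
proof -
  let ?X = "subtopology coord_space (standard_simplex n)"
  have "open (\<Inter>i\<le>n. {x::nat \<Rightarrow> real. 0 < x i})"
    by (intro open_INT ballI finite_atMost open_Collect_less continuous_on_coordinate continuous_on_const)
  moreover have "open_simplex n = standard_simplex n \<inter> (\<Inter>i\<le>n. {x. 0 < x i})"
    by (auto simp: open_simplex_def)
  ultimately have U: "openin ?X (open_simplex n)"
    unfolding coord_space_euclidean by (metis openin_open_Int)
  have C: "closedin ?X (standard_simplex n \<inter> diag n)"
    unfolding coord_space_euclidean by (intro closedin_closed_Int closed_diag)
  have CU: "standard_simplex n \<inter> diag n \<subseteq> open_simplex n"
    using open_simplex_diag(1) by auto
  have "subtopology ?X (open_simplex n) = subtopology coord_space (open_simplex n)"
    using open_simplex_subset[of n] by (simp add: subtopology_subtopology Int_absorb1)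
  then show ?thesis
    using excision_open_iso[OF U C CU, of "- diag n" p] by auto
qed

lemma iso_open_simplex_coord_space:
  "hom_induced p (subtopology coord_space (open_simplex n)) (- diag n) coord_space (- diag n) id
   \<in> iso (relative_homology_group p (subtopology coord_space (open_simplex n)) (- diag n))
         (relative_homology_group p coord_space (- diag n))"
proof -
  let ?O = "subtopology coord_space (open_simplex n)" and ?C = "subtopology coord_space (simplex_tube n)"
  have tube: "hom_induced p ?C (- diag n) coord_space (- diag n) id
    \<in> iso (relative_homology_group p ?C (- diag n)) (relative_homology_group p coord_space (- diag n))"
    using open_simplex_tube closed_diag diag_subset_tube
    by (intro excision_open_iso[of _ _ "diag n"]) (auto simp: coord_space_euclidean)
  have OC: "open_simplex n \<subseteq> simplex_tube n"
    by (auto simp: open_simplex_def simplex_tube_def standard_simplex_def)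
  have "hom_induced p ?O (- diag n) coord_space (- diag n) (id \<circ> id)
     = hom_induced p ?C (- diag n) coord_space (- diag n) id \<circ> hom_induced p ?O (- diag n) ?C (- diag n) id"
    using OC by (intro hom_induced_compose) (auto simp: continuous_map_in_subtopology continuous_map_from_subtopology)
  then show ?thesis
    using iso_set_trans[OF iso_open_simplex_tube tube] by simp
qed

text \<open>The identity simplex is a chain in the closed simplex but not in the open one. Relative
  to \<open>- diag n\<close>, the inclusions of the open simplex in the closed one and in the whole
  space are isomorphisms, hence so is the inclusion of the closed one.\<close>

lemma free_generator_standard_simplex:
  "free_generator (relative_homology_group (int n) (subtopology coord_space (standard_simplex n)) (- diag n))
     (homologous_rel_set n (subtopology coord_space (standard_simplex n)) (- diag n) (frag_of (identity_simplex n)))"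
proof -
  let ?O = "subtopology coord_space (open_simplex n)" and ?X = "subtopology coord_space (standard_simplex n)"
  have cont: "continuous_map ?O ?X id"
    using open_simplex_subset[of n] by (auto simp: continuous_map_in_subtopology continuous_map_from_subtopology)
  have "hom_induced n ?O (- diag n) coord_space (- diag n) (id \<circ> id)
     = hom_induced n ?X (- diag n) coord_space (- diag n) id \<circ> hom_induced n ?O (- diag n) ?X (- diag n) id"
    by (intro hom_induced_compose cont) (auto simp: continuous_map_from_subtopology)
  then have "hom_induced n ?X (- diag n) coord_space (- diag n) id
     \<in> iso (relative_homology_group n ?X (- diag n)) (relative_homology_group n coord_space (- diag n))"
    using iso_open_simplex_coord_space[of "int n" n]
    by (intro iso_cancel_right[OF iso_open_simplex_standard]) (auto simp: hom_induced_hom)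
  from free_generator_hom_induced[OF this relcycle_identity[OF order_refl]] show ?thesis
    using free_generator_identity_simplex[of n] hom_induced_id_identity_simplex[OF order_refl subset_UNIV Int_lower2]
    by (simp only: subtopology_UNIV)
qed

text \<open>On the open simplex \<open>g\<close> is a homeomorphism onto an open set, so homology
  relative to the complement of \<open>b\<close> is carried to the local homology at
  \<open>g b\<close> by excision. The class of \<open>g\<close> comes from the closed simplex, which
  is reached by cancelling the isomorphism induced by the inclusion of the open one.\<close>

theorem free_generator_singular_simplex:
  assumes W: "Hausdorff_space W" and g: "singular_simplex n W g"
    and inj: "inj_on g (open_simplex n)" and opn: "openin W (g ` open_simplex n)"
    and disj: "g ` open_simplex n \<inter> g ` (standard_simplex n - open_simplex n) = {}"
    and b: "b \<in> standard_simplex n" "b \<in> diag n"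
  shows "free_generator (relative_homology_group (int n) W (topspace W - {g b}))
    (homologous_rel_set n W (topspace W - {g b}) (frag_of g))"
proof -
  let ?O = "subtopology coord_space (open_simplex n)" and ?X = "subtopology coord_space (standard_simplex n)"
  let ?U = "g ` open_simplex n" and ?T = "topspace W - {g b}"
  let ?S = "standard_simplex n - {b}" and ?R = "open_simplex n - {b}"
  have bO: "b \<in> open_simplex n" and bD: "standard_simplex n \<inter> diag n = {b}"
    using open_simplex_diag[OF b] by auto
  have cg: "continuous_map ?X W g"
    using g by (simp add: singular_simplex_def)
  have gW: "g ` standard_simplex n \<subseteq> topspace W"
    using continuous_map_image_subset_topspace[OF cg] by simp
  have gS: "g x \<noteq> g b" if "x \<in> ?S" for x
  proof (cases "x \<in> open_simplex n")
    case True
    then show ?thesis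
      using inj bO that by (auto dest: inj_onD)
  next
    case False
    then show ?thesis
      using disj bO that by auto
  qed
  have XS: "topspace ?X \<inter> ?S = topspace ?X \<inter> - diag n" and OR: "topspace ?O \<inter> ?R = topspace ?O \<inter> - diag n"
    using bD open_simplex_subset[of n] by auto
  have cO: "continuous_map ?O ?X id"
    using open_simplex_subset[of n] by (auto simp: continuous_map_in_subtopology continuous_map_from_subtopology)
  have iOX: "hom_induced n ?O ?R ?X ?S id \<in> iso (relative_homology_group n ?O ?R) (relative_homology_group n ?X ?S)"
    using iso_open_simplex_standard[of n n]
    by (simp only: relative_homology_group_cong[OF XS] relative_homology_group_cong[OF OR] hom_induced_cong[OF OR XS])
  \<comment> \<open>The map \<open>g\<close> is closed on the compact simplex, and by
    \<open>disj\<close> the open simplex is the full preimage of its image, so closedness survives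
    the restriction.\<close>
  have homeo: "homeomorphic_map ?O (subtopology W ?U) g"
  proof (rule bijective_closed_imp_homeomorphic_map)
    have "closed_map ?X W g"
      using continuous_imp_closed_map[OF cg _ W] compactin_standard_simplex[of n] compact_space_subtopology by blast
    moreover have "{x \<in> topspace ?X. g x \<in> ?U} = open_simplex n"
      using disj open_simplex_subset[of n] by auto
    ultimately have "closed_map (subtopology ?X (open_simplex n)) (subtopology W ?U) g"
      by (rule closed_map_restriction)
    then show "closed_map ?O (subtopology W ?U) g"
      using open_simplex_subset[of n] by (simp add: subtopology_subtopology Int_absorb1)
    show "continuous_map ?O (subtopology W ?U) g"
      using continuous_map_compose[OF cO cg] by (auto simp: continuous_map_in_subtopology)
    show "g ` topspace ?O = topspace (subtopology W ?U)"
      using openin_subset[OF opn] by auto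
  qed (use inj in simp)
  have "g ` ?R = ?U - {g b}"
    using gS open_simplex_subset[of n] by auto
  then have i1: "hom_induced n ?O ?R (subtopology W ?U) (?U - {g b}) g
      \<in> iso (relative_homology_group n ?O ?R) (relative_homology_group n (subtopology W ?U) (?U - {g b}))"
    by (intro homeomorphic_map_relative_homology_iso[OF homeo]) auto
  have UT: "topspace (subtopology W ?U) \<inter> (?U - {g b}) = topspace (subtopology W ?U) \<inter> ?T"
    by auto
  have "closedin W {g b}"
    using W gW b by (auto intro!: closedin_Hausdorff_singleton)
  then have "hom_induced n (subtopology W ?U) ?T W ?T id
      \<in> iso (relative_homology_group n (subtopology W ?U) ?T) (relative_homology_group n W ?T)"
    using bO by (intro excision_open_iso[OF opn]) auto
  then have i2: "hom_induced n (subtopology W ?U) (?U - {g b}) W ?T id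
      \<in> iso (relative_homology_group n (subtopology W ?U) (?U - {g b})) (relative_homology_group n W ?T)"
    by (simp only: relative_homology_group_cong[OF UT] hom_induced_cong[OF UT refl])
  have "hom_induced n ?O ?R W ?T (id \<circ> g) = hom_induced n (subtopology W ?U) (?U - {g b}) W ?T id
      \<circ> hom_induced n ?O ?R (subtopology W ?U) (?U - {g b}) g"
  proof (rule hom_induced_compose)
    show "continuous_map ?O (subtopology W ?U) g"
      by (rule homeomorphic_imp_continuous_map[OF homeo])
    show "g \<in> ?R \<rightarrow> ?U - {g b}"
      using gS open_simplex_subset[of n] by auto
    show "id \<in> ?U - {g b} \<rightarrow> ?T"
      using gW open_simplex_subset[of n] by (auto simp: image_subset_iff)
  qed (simp add: continuous_map_from_subtopology)
  then have i3: "hom_induced n ?O ?R W ?T g \<in> iso (relative_homology_group n ?O ?R) (relative_homology_group n W ?T)"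
    using iso_set_trans[OF i1 i2] by simp
  have "hom_induced n ?O ?R W ?T (g \<circ> id) = hom_induced n ?X ?S W ?T g \<circ> hom_induced n ?O ?R ?X ?S id"
  proof (intro hom_induced_compose cO cg)
    show "id \<in> ?R \<rightarrow> ?S"
      using open_simplex_subset[of n] by auto
    show "g \<in> ?S \<rightarrow> ?T"
      using gS gW by (auto simp: image_subset_iff)
  qed
  then have "hom_induced n ?X ?S W ?T g \<in> iso (relative_homology_group n ?X ?S) (relative_homology_group n W ?T)"
    using i3 by (intro iso_cancel_right[OF iOX]) (auto simp: hom_induced_hom)
  then have i4: "hom_induced n ?X (- diag n) W ?T g \<in> iso (relative_homology_group n ?X (- diag n)) (relative_homology_group n W ?T)"
    by (simp only: relative_homology_group_cong[OF XS] hom_induced_cong[OF XS refl])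
  have "g \<in> standard_simplex n \<inter> - diag n \<rightarrow> ?T"
    using gS gW XS by (auto simp: image_subset_iff)
  from hom_induced_identity_simplex[OF order_refl g cg this]
  show ?thesis
    using free_generator_hom_induced[OF i4 relcycle_identity[OF order_refl]] free_generator_standard_simplex[of n]
    by (simp only:)
qed

section \<open>Reversing the orientation of a triangulated manifold\<close>

lemma open_face_open_simplex: "open_face {..3} = open_simplex 3"
  by (auto simp: open_face_def open_simplex_def standard_simplex_def) (metis less_irrefl not_le)

lemma barycentre_standard_simplex: "barycentre \<in> standard_simplex 3"
  by (auto simp: barycentre_def standard_simplex_def eval_nat_numeral)

lemma barycentre_diag: "barycentre \<in> diag 3"
  by (rule diagI) (simp add: barycentre_def)

text \<open>Complements of open tetrahedra are finite unions of compact sets; this makes an appeal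
  to invariance of domain unnecessary.\<close>

lemma triangulation_open_tetrahedron:
  assumes W: "Hausdorff_space W" and T: "triangulation W T" and f: "f \<in> T"
  shows "inj_on f (open_simplex 3)" and "openin W (f ` open_simplex 3)"
    and "f ` open_simplex 3 \<inter> f ` (standard_simplex 3 - open_simplex 3) = {}"
proof -
  have fin: "finite T" and sing: "\<And>h. h \<in> T \<Longrightarrow> singular_simplex 3 W h"
    and cover: "(\<Union>h\<in>T. h ` standard_simplex 3) = topspace W"
    and glued: "glued_along_faces T (\<lambda>f. f) (standard_simplex 3)"
    using T by (auto simp: triangulation_def)
  have face: "open_face I \<inter> standard_simplex 3 = open_face I" for I
    by (auto simp: open_face_def)
  have "inj_on f (open_face {..3} \<inter> standard_simplex 3)"
    using glued f by (auto simp: glued_along_faces_def)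
  then show inj: "inj_on f (open_simplex 3)"
    unfolding face by (simp only: open_face_open_simplex)
  \<comment> \<open>\<open>J\<close> is the support of \<open>x\<close>. Meeting the open
    tetrahedron, the open face of \<open>J\<close> is matched with all four vertices, so
    \<open>J\<close> is full; the clause on cardinality 4 gives \<open>f = h\<close>.\<close>
  have glue: "f = h \<and> x \<in> open_simplex 3"
    if h: "h \<in> T" "x \<in> standard_simplex 3" "h x \<in> f ` open_simplex 3" for h x
  proof -
    define J where "J = {i. 0 < x i}"
    have x: "x \<in> open_face J" and J: "J \<subseteq> {..3}"
      using h(2) by (auto simp: J_def open_face_def standard_simplex_def) (metis less_irrefl not_le)
    have "f ` (open_face {..3} \<inter> standard_simplex 3) \<inter> h ` (open_face J \<inter> standard_simplex 3) \<noteq> {}"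
      unfolding face unfolding open_face_open_simplex using h(3) x by blast
    then have "(card {..3::nat} = 4 \<longrightarrow> f = h) \<and> (\<exists>\<pi>. bij_betw \<pi> {..3::nat} J)"
      using glued f h(1) J unfolding glued_along_faces_def by (meson order_refl)
    then obtain \<pi> where fh: "f = h" and \<pi>: "bij_betw \<pi> {..3::nat} J"
      by auto
    have "card J = card {..3::nat}"
      by (rule bij_betw_same_card[OF \<pi>, symmetric])
    then have "J = {..3}"
      using J by (intro card_subset_eq) auto
    then show ?thesis
      using x fh by (simp add: open_face_open_simplex)
  qed
  have boundary: "f x \<notin> f ` open_simplex 3" if "x \<in> standard_simplex 3 - open_simplex 3" for x
    using glue[OF f, of x] that by blast
  show disj: "f ` open_simplex 3 \<inter> f ` (standard_simplex 3 - open_simplex 3) = {}"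
  proof (rule equals0I)
    fix y assume "y \<in> f ` open_simplex 3 \<inter> f ` (standard_simplex 3 - open_simplex 3)"
    then obtain x where "x \<in> standard_simplex 3 - open_simplex 3" "y = f x" "y \<in> f ` open_simplex 3"
      by blast
    then show False
      using boundary by simp
  qed
  have compact_image: "closedin W (h ` K)" if h: "h \<in> T" and K: "closed K" "K \<subseteq> standard_simplex 3" for h K
  proof -
    have "compactin coord_space (standard_simplex 3 \<inter> K)"
      using compactin_standard_simplex K(1) by (intro compact_Int_closedin) (simp_all add: coord_space_euclidean)
    then have "compactin (subtopology coord_space (standard_simplex 3)) K"
      using K(2) by (simp add: compactin_subtopology Int_absorb1)
    then have "compactin W (h ` K)"
      using sing[OF h] unfolding singular_simplex_def by (blast intro: image_compactin)
    then show ?thesis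
      by (rule compactin_imp_closedin[OF W])
  qed
  let ?B = "\<Union>i\<le>3. standard_simplex 3 \<inter> {x. x i = 0}"
  have closed_standard: "closed (standard_simplex 3)"
    using closedin_standard_simplex[of 3] by (simp add: coord_space_euclidean)
  have B: "standard_simplex 3 - open_simplex 3 = ?B"
    by (auto simp: open_simplex_def standard_simplex_def) (metis atMost_iff less_le)
  have "closed ?B"
    by (intro closed_UN ballI finite_atMost closed_Int closed_standard closed_Collect_eq continuous_on_coordinate continuous_on_const)
  then have "closedin W (f ` (standard_simplex 3 - open_simplex 3))"
    using compact_image[OF f, of "?B"] B by auto
  moreover have "closedin W (\<Union>h\<in>T - {f}. h ` standard_simplex 3)"
    using fin compact_image[OF _ closed_standard] by (intro closedin_Union) auto
  ultimately have "closedin W (f ` (standard_simplex 3 - open_simplex 3) \<union> (\<Union>h\<in>T - {f}. h ` standard_simplex 3))"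
    by (rule closedin_Un)
  moreover have "f ` open_simplex 3 = topspace W - (f ` (standard_simplex 3 - open_simplex 3) \<union> (\<Union>h\<in>T - {f}. h ` standard_simplex 3))"
  proof -
    have fW: "f ` open_simplex 3 \<subseteq> topspace W"
      using cover f open_simplex_subset[of 3] by blast
    have other: "h x \<notin> f ` open_simplex 3" if "h \<in> T" "h \<noteq> f" "x \<in> standard_simplex 3" for h x
      using glue[OF that(1,3)] that(2) by blast
    show ?thesis
    proof (rule subset_antisym)
      show "f ` open_simplex 3 \<subseteq> topspace W - (f ` (standard_simplex 3 - open_simplex 3) \<union> (\<Union>h\<in>T - {f}. h ` standard_simplex 3))"
      proof
        fix y assume y: "y \<in> f ` open_simplex 3"
        have "y \<notin> f ` (standard_simplex 3 - open_simplex 3)"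
          using disj y by blast
        moreover have "y \<notin> h ` standard_simplex 3" if "h \<in> T - {f}" for h
        proof
          assume "y \<in> h ` standard_simplex 3"
          then obtain x where "x \<in> standard_simplex 3" "y = h x"
            by blast
          then show False
            using other[of h x] y that by simp
        qed
        ultimately show "y \<in> topspace W - (f ` (standard_simplex 3 - open_simplex 3) \<union> (\<Union>h\<in>T - {f}. h ` standard_simplex 3))"
          using fW y by blast
      qed
      show "topspace W - (f ` (standard_simplex 3 - open_simplex 3) \<union> (\<Union>h\<in>T - {f}. h ` standard_simplex 3)) \<subseteq> f ` open_simplex 3"
        using cover by blast
    qed
  qed
  ultimately show "openin W (f ` open_simplex 3)"
    by (metis closedin_def openin_diff openin_topspace)
qed

text \<open>The orientation test precomposes a tetrahedron with such a map. It only moves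
  coordinates, so positivity of all coordinates is preserved both ways and the composite inherits
  the embedding properties of the tetrahedron.\<close>

lemma oriented_simplex_permutation:
  assumes u: "bij_betw u {..n} {..n}"
  defines "\<sigma> \<equiv> oriented_simplex n (\<lambda>k. simplex_vertex (u k))"
  shows "singular_simplex n (subtopology coord_space (standard_simplex n)) \<sigma>"
    and "\<And>x j. \<lbrakk>x \<in> standard_simplex n; j \<le> n\<rbrakk> \<Longrightarrow> \<sigma> x (u j) = x j"
    and "inj_on \<sigma> (standard_simplex n)"
    and "\<sigma> ` open_simplex n = open_simplex n"
    and "\<sigma> ` (standard_simplex n - open_simplex n) \<subseteq> standard_simplex n - open_simplex n"
proof -
  have uinj: "u i = u j \<longleftrightarrow> i = j" if "i \<le> n" "j \<le> n" for i j
    using bij_betw_imp_inj_on[OF u] that by (auto simp: inj_on_def)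
  have ule: "u j \<le> n" if "j \<le> n" for j
    using bij_betw_apply[OF u, of j] that by simp
  have usurj: "\<exists>j\<le>n. u j = i" if "i \<le> n" for i
    using bij_betw_imp_surj_on[OF u] that by (metis atMost_iff imageE)
  have val: "\<sigma> x i = (\<Sum>j\<le>n. (if i = u j then x j else 0))" if "x \<in> standard_simplex n" for x i
    using that by (simp add: \<sigma>_def oriented_simplex_def simplex_vertex_def if_distrib[of "\<lambda>a. a * _"] cong: if_cong)
  show at: "\<sigma> x (u j) = x j" if "x \<in> standard_simplex n" "j \<le> n" for x j
  proof -
    have "(\<Sum>k\<le>n. (if u j = u k then x k else 0)) = (\<Sum>k\<le>n. (if j = k then x k else 0))"
      using that(2) by (intro sum.cong) (auto simp: uinj)
    then show ?thesis
      using that by (simp add: val)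
  qed
  have zero: "\<sigma> x i = 0" if "x \<in> standard_simplex n" "n < i" for x i
  proof -
    have "i \<noteq> u j" if "j \<le> n" for j
      using ule[OF that] \<open>n < i\<close> by linarith
    then show ?thesis
      unfolding val[OF that(1)] by (intro sum.neutral) simp
  qed
  have std: "\<sigma> x \<in> standard_simplex n" if x: "x \<in> standard_simplex n" for x
  proof -
    have "0 \<le> \<sigma> x i \<and> \<sigma> x i \<le> 1" for i
    proof (cases "i \<le> n")
      case True
      then obtain j where "j \<le> n" "u j = i" using usurj by blast
      then show ?thesis
        using at[OF x, of j] x by (auto simp: standard_simplex_def)
    next
      case False
      then show ?thesis using zero[OF x] by simp
    qed
    moreover have "(\<Sum>i\<le>n. \<sigma> x i) = (\<Sum>j\<le>n. \<sigma> x (u j))"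
      by (rule sum.reindex_bij_betw[OF u, symmetric])
    moreover have "(\<Sum>j\<le>n. \<sigma> x (u j)) = (\<Sum>j\<le>n. x j)"
      by (intro sum.cong refl at x) simp
    ultimately show ?thesis
      using zero[OF x] x by (simp add: standard_simplex_def)
  qed
  have "(\<lambda>x i. \<Sum>j\<le>n. simplex_vertex (u j) i * x j) ` standard_simplex n \<subseteq> standard_simplex n"
    using std by (auto simp: \<sigma>_def oriented_simplex_def)
  then show "singular_simplex n (subtopology coord_space (standard_simplex n)) \<sigma>"
    unfolding \<sigma>_def by (intro simplicial_imp_singular_simplex) (simp add: simplicial_simplex_oriented_simplex)
  show "inj_on \<sigma> (standard_simplex n)"
  proof (rule inj_onI, rule ext)
    fix x y i assume x: "x \<in> standard_simplex n" and y: "y \<in> standard_simplex n" and eq: "\<sigma> x = \<sigma> y"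
    show "x i = y i"
    proof (cases "i \<le> n")
      case True
      then show ?thesis using at[OF x True] at[OF y True] eq by simp
    next
      case False
      then show ?thesis using x y by (simp add: standard_simplex_def)
    qed
  qed
  have open_iff: "\<sigma> x \<in> open_simplex n \<longleftrightarrow> x \<in> open_simplex n" if x: "x \<in> standard_simplex n" for x
  proof -
    have "(\<forall>i\<le>n. 0 < \<sigma> x i) \<longleftrightarrow> (\<forall>j\<le>n. 0 < \<sigma> x (u j))"
      using ule usurj by metis
    also have "\<dots> \<longleftrightarrow> (\<forall>j\<le>n. 0 < x j)"
      using at[OF x] by auto
    finally show ?thesis
      using std[OF x] x by (simp add: open_simplex_def)
  qed
  then show "\<sigma> ` (standard_simplex n - open_simplex n) \<subseteq> standard_simplex n - open_simplex n"
    using std by auto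
  show "\<sigma> ` open_simplex n = open_simplex n"
  proof
    show "\<sigma> ` open_simplex n \<subseteq> open_simplex n"
      using open_iff open_simplex_subset[of n] by blast
    show "open_simplex n \<subseteq> \<sigma> ` open_simplex n"
    proof
      fix y assume y: "y \<in> open_simplex n"
      define x where "x = (\<lambda>j. if j \<le> n then y (u j) else 0)"
      have "(\<Sum>j\<le>n. x j) = (\<Sum>j\<le>n. y (u j))"
        by (rule sum.cong) (auto simp: x_def)
      also have "\<dots> = (\<Sum>i\<le>n. y i)"
        by (rule sum.reindex_bij_betw[OF u])
      finally have x: "x \<in> standard_simplex n"
        using y by (auto simp: x_def open_simplex_def standard_simplex_def)
      have "\<sigma> x i = y i" for i
      proof (cases "i \<le> n")
        case True
        then obtain j where j: "j \<le> n" "u j = i" using usurj by blast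
        then show ?thesis
          using at[OF x j(1)] by (simp add: x_def)
      next
        case False
        then show ?thesis
          using zero[OF x] y by (simp add: open_simplex_def standard_simplex_def)
      qed
      then have "\<sigma> x = y" by auto
      then show "y \<in> \<sigma> ` open_simplex n"
        using open_iff[OF x] y by blast
    qed
  qed
qed

lemma orientation_agrees_opposite:
  assumes W: "Hausdorff_space W" and T: "triangulation W T" and f: "f \<in> T"
    and \<mu>: "manifold_orientation W \<mu>" and u: "bij_betw u {..3} {..3}"
  shows "orientation_agrees W (opposite_orientation W \<mu>) f u \<longleftrightarrow> \<not> orientation_agrees W \<mu> f u"
proof -
  let ?s = "oriented_simplex 3 (\<lambda>k. simplex_vertex (u k))"
  let ?g = "simplex_map 3 f ?s"
  let ?b = "barycentre"
  let ?G = "local_homology W (f ?b)"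
  note s = oriented_simplex_permutation[OF u]
  note tet = triangulation_open_tetrahedron[OF W T f]
  have f3: "singular_simplex 3 W f"
    using T f by (simp add: triangulation_def)
  have g: "singular_simplex 3 W ?g"
    using singular_simplex_simplex_map[OF s(1)] f3 unfolding singular_simplex_def by blast
  have geq: "?g x = f (?s x)" if "x \<in> standard_simplex 3" for x
    using that by (simp add: simplex_map_def)
  have gO: "?g ` open_simplex 3 = f ` open_simplex 3"
  proof -
    have "?g ` open_simplex 3 = f ` ?s ` open_simplex 3"
      unfolding image_image using geq open_simplex_subset[of 3] by (intro image_cong) auto
    then show ?thesis by (simp only: s(4))
  qed
  have gB: "?g ` (standard_simplex 3 - open_simplex 3) \<subseteq> f ` (standard_simplex 3 - open_simplex 3)"
  proof -
    have "?g ` (standard_simplex 3 - open_simplex 3) = f ` ?s ` (standard_simplex 3 - open_simplex 3)"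
      unfolding image_image using geq by (intro image_cong) auto
    then show ?thesis using s(5) by blast
  qed
  have b: "?b \<in> standard_simplex 3" "?b \<in> diag 3"
    by (rule barycentre_standard_simplex, rule barycentre_diag)
  \<comment> \<open>The local group is taken at the image of the barycentre under \<open>f\<close>,
    the generator at its image under \<open>?g\<close>; the two points agree because a permutation
    fixes the barycentre.\<close>
  have sb: "?s ?b = ?b"
  proof -
    have "?s ?b \<in> open_simplex 3"
      using s(4) open_simplex_diag(1)[OF b] by blast
    then have "?s ?b \<in> standard_simplex 3"
      using open_simplex_subset[of 3] by blast
    moreover have "?s ?b \<in> diag 3"
    proof (rule diagI)
      have quarter: "?s ?b i = 1/4" if "i \<le> 3" for i
      proof -
        obtain j where "j \<le> 3" "u j = i"
          using bij_betw_imp_surj_on[OF u] \<open>i \<le> 3\<close> by (metis atMost_iff imageE)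
        then show ?thesis
          using s(2)[OF b(1), of j] by (simp add: barycentre_def)
      qed
      show "?s ?b i = ?s ?b 0" if "i \<le> 3" for i
        by (simp only: quarter[OF that] quarter[OF le0])
    qed
    ultimately show ?thesis
      using open_simplex_diag(2)[OF b] by blast
  qed
  have "free_generator (relative_homology_group (int 3) W (topspace W - {?g ?b}))
    (homologous_rel_set 3 W (topspace W - {?g ?b}) (frag_of ?g))"
  proof (rule free_generator_singular_simplex[OF W g _ _ _ b])
    have "inj_on (f \<circ> ?s) (open_simplex 3)"
      using tet(1) s(3,4) open_simplex_subset[of 3] by (intro comp_inj_on) (auto intro: inj_on_subset)
    then show "inj_on ?g (open_simplex 3)"
      using geq open_simplex_subset[of 3] by (subst inj_on_cong[of _ _ "f \<circ> ?s"]) auto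
    show "openin W (?g ` open_simplex 3)"
      using tet(2) by (simp only: gO)
    show "?g ` open_simplex 3 \<inter> ?g ` (standard_simplex 3 - open_simplex 3) = {}"
      using tet(3) gB unfolding gO by blast
  qed
  then have gen: "free_generator ?G (homologous_rel_set 3 W (topspace W - {f ?b}) (frag_of ?g))"
    using geq[OF b(1)] by (simp add: local_homology_def sb)
  have fb: "f ?b \<in> topspace W"
    using f3 b(1) by (auto simp: singular_simplex_def continuous_map_def Pi_iff)
  have "group ?G"
    by (simp add: local_homology_def)
  from generator_cases[OF this gen] \<mu> fb show ?thesis
    by (auto simp: orientation_agrees_def opposite_orientation_def manifold_orientation_def)
qed

section \<open>Conjugate bundles, cocycles and determinations\<close>

lemma cnj_mat_nth [simp]: "cnj_mat A $ i $ j = cnj (A $ i $ j)"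
  by (simp add: cnj_mat_def)

lemma cnj_mat_cnj_mat [simp]: "cnj_mat (cnj_mat A) = A"
  by (simp add: vec_eq_iff)

lemma cnj_mat_mult: "cnj_mat (A ** B) = cnj_mat A ** cnj_mat B"
  by (simp add: vec_eq_iff matrix_matrix_mult_def)

lemma cnj_mat_one: "cnj_mat (mat 1) = mat 1"
  by (simp add: vec_eq_iff mat_def)

lemma cnj_mat_B2C [simp]: "cnj_mat A \<in> B2C \<longleftrightarrow> A \<in> B2C"
proof -
  have "det (cnj_mat A) = cnj (det A)"
    by (simp add: det_2)
  then show ?thesis
    by (auto simp: B2C_def)
qed

text \<open>\<open>matrix_inv\<close> is a choice that is characterised only for invertible
  matrices; determinant 1 supplies this for the matrix and its conjugate.\<close>

lemma cnj_mat_matrix_inv: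
  assumes "A \<in> B2C"
  shows "matrix_inv (cnj_mat A) = cnj_mat (matrix_inv A)"
proof -
  have inv: "X ** matrix_inv X = mat 1 \<and> matrix_inv X ** X = mat 1" if "invertible X" for X :: mat2
    unfolding matrix_inv_def by (rule someI_ex) (use that in \<open>simp add: invertible_def\<close>)
  have "invertible A" "invertible (cnj_mat A)"
    using assms cnj_mat_B2C[of A] by (auto simp: B2C_def invertible_det_nz)
  note A = inv[OF this(1)] and cA = inv[OF this(2)]
  have "matrix_inv (cnj_mat A) = matrix_inv (cnj_mat A) ** (cnj_mat A ** cnj_mat (matrix_inv A))"
    using A by (simp add: cnj_mat_one matrix_mul_rid flip: cnj_mat_mult)
  also have "\<dots> = cnj_mat (matrix_inv A)"
    using cA by (simp add: matrix_mul_assoc matrix_mul_lid)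
  finally show ?thesis .
qed

lemma cnj_mat_B2R: "A \<in> B2R \<Longrightarrow> cnj_mat A = A"
  by (auto simp: B2R_def vec_eq_iff Reals_cnj_iff)

text \<open>Change of structure group along the conjugation automorphism. As this is an involution,
  twisting the action needs no new total space; the topology, and with it horizontal lifting, stays
  the same.\<close>

definition conj_bundle :: "'w principal_bundle \<Rightarrow> 'w principal_bundle" where
  "conj_bundle E = E\<lparr>act := \<lambda>x g. act E x (cnj_mat g)\<rparr>"

lemma conj_bundle_simps [simp]:
  "total (conj_bundle E) = total E" "proj (conj_bundle E) = proj E"
  "act (conj_bundle E) x g = act E x (cnj_mat g)"
  "conj_bundle (conj_bundle E) = E"
  by (simp_all add: conj_bundle_def)

lemma homeomorphic_map_cnj_mat:
  "homeomorphic_map (prod_topology X (discrete_topology B2C)) (prod_topology X (discrete_topology B2C))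
     (\<lambda>(u, g). (u, cnj_mat g))"
proof -
  have "homeomorphic_maps (discrete_topology B2C) (discrete_topology B2C) cnj_mat cnj_mat"
    by (auto simp: homeomorphic_maps_def)
  moreover have "homeomorphic_maps X X (\<lambda>u. u) (\<lambda>u. u)"
    by (simp add: homeomorphic_maps_def)
  ultimately show ?thesis
    using homeomorphic_maps_prod[of X "discrete_topology B2C" X "discrete_topology B2C" "\<lambda>u. u" cnj_mat "\<lambda>u. u" cnj_mat]
    unfolding homeomorphic_map_maps by blast
qed

lemma flat_bundle_conj_bundle_imp:
  assumes "flat_bundle W E"
  shows "flat_bundle W (conj_bundle E)"
  unfolding flat_bundle_def
proof (intro conjI ballI)
  show "continuous_map (total (conj_bundle E)) W (proj (conj_bundle E))"
    using assms by (simp add: flat_bundle_def)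
  fix y assume y: "y \<in> topspace W"
  obtain U h where U: "openin W U" "y \<in> U"
    and h: "homeomorphic_map (prod_topology (subtopology W U) (discrete_topology B2C))
          (subtopology (total E) {x \<in> topspace (total E). proj E x \<in> U}) h"
    and hh: "\<forall>u\<in>U. \<forall>g\<in>B2C. proj E (h (u, g)) = u \<and> (\<forall>k\<in>B2C. act E (h (u, g)) k = h (u, g ** k))"
    using bspec[OF conjunct2[OF assms[unfolded flat_bundle_def]] y] by (elim exE conjE) (rule that)
  let ?h = "h \<circ> (\<lambda>(u, g). (u, cnj_mat g))"
  have "homeomorphic_map (prod_topology (subtopology W U) (discrete_topology B2C))
          (subtopology (total E) {x \<in> topspace (total E). proj E x \<in> U}) ?h"
    by (rule homeomorphic_map_compose[OF homeomorphic_map_cnj_mat h])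
  moreover have "\<forall>u\<in>U. \<forall>g\<in>B2C. proj E (?h (u, g)) = u \<and> (\<forall>k\<in>B2C. act E (?h (u, g)) (cnj_mat k) = ?h (u, g ** k))"
    using hh by (simp add: cnj_mat_mult)
  ultimately show "\<exists>U h. openin W U \<and> y \<in> U \<and>
        homeomorphic_map (prod_topology (subtopology W U) (discrete_topology B2C))
          (subtopology (total (conj_bundle E)) {x \<in> topspace (total (conj_bundle E)). proj (conj_bundle E) x \<in> U}) h \<and>
        (\<forall>u\<in>U. \<forall>g\<in>B2C. proj (conj_bundle E) (h (u, g)) = u \<and>
           (\<forall>k\<in>B2C. act (conj_bundle E) (h (u, g)) k = h (u, g ** k)))"
    using U by (intro exI[of _ U] exI[of _ ?h]) simp
qed

lemma flat_bundle_conj_bundle [simp]: "flat_bundle W (conj_bundle E) \<longleftrightarrow> flat_bundle W E"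
  using flat_bundle_conj_bundle_imp[of W E] flat_bundle_conj_bundle_imp[of W "conj_bundle E"] by auto

lemma conj_bundle_image: "E \<in> conj_bundle ` \<rho> \<longleftrightarrow> conj_bundle E \<in> \<rho>"
  by (auto simp: image_iff) (metis conj_bundle_simps(4))

lemma conj_bundle_image_image [simp]: "conj_bundle ` conj_bundle ` \<rho> = \<rho>"
  by (simp add: image_image)

text \<open>The same points in the fibres and the same lifts serve both sides, because the twisted
  action of \<open>cnj_mat (z e)\<close> is the original action of \<open>z e\<close>.\<close>

lemma flat_class_cnj: "flat_class W T (\<lambda>e. cnj_mat (z e)) = conj_bundle ` flat_class W T z"
  by (rule Set.set_eqI) (simp add: conj_bundle_image flat_class_def)

lemma flat_class_cong:
  assumes "\<And>e. e \<in> oriented_edges T \<Longrightarrow> z e = z' e"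
  shows "flat_class W T z = flat_class W T z'"
  using assms by (simp add: flat_class_def)

lemma real_class_conj:
  assumes "real_class W \<rho>"
  shows "conj_bundle ` \<rho> = \<rho>"
proof -
  obtain T z where z: "\<forall>e\<in>oriented_edges T. z e \<in> B2R" "flat_class W T z = \<rho>"
    using assms by (auto simp: real_class_def)
  have "flat_class W T (\<lambda>e. cnj_mat (z e)) = flat_class W T z"
    using z(1) by (intro flat_class_cong) (simp add: cnj_mat_B2R)
  then show ?thesis
    using z(2) by (simp add: flat_class_cnj)
qed

text \<open>Fibrewise conjugation identifies the trivial bundle with its conjugate; it is composed
  with the given trivialization.\<close>

lemma bundle_iso_trivial_conj_bundle:
  assumes "bundle_iso (trivial_bundle W) E"
  shows "bundle_iso (trivial_bundle W) (conj_bundle E)"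
proof -
  obtain F where F: "homeomorphic_map (prod_topology W (discrete_topology B2C)) (total E) F"
    and eq: "\<And>y g. \<lbrakk>y \<in> topspace W; g \<in> B2C\<rbrakk> \<Longrightarrow> proj E (F (y, g)) = y \<and>
        (\<forall>k\<in>B2C. F (y, g ** k) = act E (F (y, g)) k)"
    using assms by (auto simp: bundle_iso_def trivial_bundle_def)
  let ?F = "F \<circ> (\<lambda>(y, g). (y, cnj_mat g))"
  have "homeomorphic_map (prod_topology W (discrete_topology B2C)) (total E) ?F"
    by (rule homeomorphic_map_compose[OF homeomorphic_map_cnj_mat F])
  then show ?thesis
    unfolding bundle_iso_def trivial_bundle_def
    using eq by (intro exI[of _ ?F]) (auto simp: cnj_mat_mult)
qed

lemma trivial_class_conj: "conj_bundle ` trivial_class W = trivial_class W"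
proof (rule Set.set_eqI)
  fix E :: "'a principal_bundle"
  show "E \<in> conj_bundle ` trivial_class W \<longleftrightarrow> E \<in> trivial_class W"
    using bundle_iso_trivial_conj_bundle[of W E] bundle_iso_trivial_conj_bundle[of W "conj_bundle E"]
    by (auto simp: conj_bundle_image trivial_class_def)
qed

lemma full_cocycle_cnj:
  assumes "full_cocycle T z"
  shows "full_cocycle T (\<lambda>e. cnj_mat (z e))"
  using assms by (simp add: full_cocycle_def cocycle_def cnj_mat_matrix_inv flip: cnj_mat_mult)

text \<open>All that indices and charge signs see of a change of orientation. It separates the
  homology from the algebra, and its symmetry later gives both inclusions between sets of
  values.\<close>

definition opposite_on :: "'w topology \<Rightarrow> 'w tet set \<Rightarrow> ('w \<Rightarrow> 'w chain set) \<Rightarrow> ('w \<Rightarrow> 'w chain set) \<Rightarrow> bool" where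
  "opposite_on W T \<mu> \<mu>' \<longleftrightarrow> (\<forall>f\<in>T. \<forall>u. bij_betw u {..3} {..3} \<longrightarrow>
     (orientation_agrees W \<mu>' f u \<longleftrightarrow> \<not> orientation_agrees W \<mu> f u))"

lemma opposite_on_sym: "opposite_on W T \<mu> \<mu>' \<Longrightarrow> opposite_on W T \<mu>' \<mu>"
  by (auto simp: opposite_on_def)

section \<open>Signs, charges and decorations under reversal of orientation\<close>

lemma bij_betw_list4:
  assumes "distinct [a, b, c, d]" "a \<le> 3" "b \<le> 3" "c \<le> 3" "d \<le> (3::nat)"
  shows "bij_betw ((!) [a, b, c, d]) {..3} {..3}"
proof -
  have "bij_betw ((!) [a, b, c, d]) {..<4} (set [a, b, c, d])"
    using assms(1) by (intro bij_betw_nth) auto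
  moreover have "set [a, b, c, d] = {..3}"
    using assms by (intro card_subset_eq) auto
  moreover have "{..<4} = {..3::nat}"
    by auto
  ultimately show ?thesis by simp
qed

text \<open>Both descriptions in \<open>passage_sign\<close> are definite: two coordinates
  \<open>3/4\<close> would exceed the coordinate sum 1, and \<open>v\<close> differs from
  \<open>pin p\<close> and \<open>pout p\<close> because those coordinates vanish on the entering
  and departing faces. The four labels thus form a permutation, to which \<open>opposite_on\<close>
  applies.\<close>

lemma passage_sign_opposite:
  assumes opp: "opposite_on W T \<mu> \<mu>'" and p: "passage_in A p" and A: "A \<subseteq> T"
    and v: "v \<le> 3" "\<forall>t\<in>{0..1}. ppath p t v = 3/4"
  shows "passage_sign W \<mu>' p = - passage_sign W \<mu> p"
proof -
  have pp: "ptet p \<in> T" "pin p \<le> 3" "pout p \<le> 3" "pin p \<noteq> pout p"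
    and in0: "ppath p 0 \<in> open_face ({..3} - {pin p})"
    and out1: "ppath p 1 \<in> open_face ({..3} - {pout p})"
    using p A by (auto simp: passage_in_def)
  have v0: "ppath p 0 v = 3/4" "ppath p 1 v = 3/4"
    using v by auto
  have "v \<noteq> pin p" "v \<noteq> pout p"
    using in0 out1 v0 unfolding open_face_def by (force, force)
  have the_v: "(THE v. v \<le> 3 \<and> ppath p 0 v = 3/4) = v"
  proof (rule the_equality)
    fix v' assume v': "v' \<le> 3 \<and> ppath p 0 v' = 3/4"
    show "v' = v"
    proof (rule ccontr)
      assume "v' \<noteq> v"
      have "ppath p 0 \<in> standard_simplex 3"
        using in0 by (simp add: open_face_def)
      then have nonneg: "\<And>i. 0 \<le> ppath p 0 i" and one: "(\<Sum>i\<le>3. ppath p 0 i) = 1"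
        by (auto simp: standard_simplex_def)
      have "(\<Sum>i\<in>{v, v'}. ppath p 0 i) \<le> (\<Sum>i\<le>3. ppath p 0 i)"
        using v v' nonneg by (intro sum_mono2) auto
      then show False
        using v' v0 \<open>v' \<noteq> v\<close> one by simp
    qed
  qed (use v v0 in simp)
  obtain w where w: "w \<in> {..3} - {v, pin p, pout p}"
    and w_unique: "\<And>w'. w' \<in> {..3} - {v, pin p, pout p} \<Longrightarrow> w' = w"
  proof -
    have "card ({..3} - {v, pin p, pout p}) = 1"
      using pp v \<open>v \<noteq> pin p\<close> \<open>v \<noteq> pout p\<close> by (subst card_Diff_subset) auto
    then show ?thesis
      using that by (auto simp: card_1_singleton_iff)
  qed
  have the_w: "(THE w. w \<in> {..3} - {v, pin p, pout p}) = w"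
    using w w_unique by (rule the_equality)
  have sign: "passage_sign W \<nu> p = (if orientation_agrees W \<nu> (ptet p) ((!) [v, w, pin p, pout p]) then 1 else - 1)" for \<nu>
    by (simp only: passage_sign_def Let_def the_v the_w)
  have "bij_betw ((!) [v, w, pin p, pout p]) {..3} {..3}"
    using w v pp \<open>v \<noteq> pin p\<close> \<open>v \<noteq> pout p\<close> by (intro bij_betw_list4) auto
  then have "orientation_agrees W \<mu>' (ptet p) ((!) [v, w, pin p, pout p]) \<longleftrightarrow>
     \<not> orientation_agrees W \<mu> (ptet p) ((!) [v, w, pin p, pout p])"
    using opp pp(1) by (simp add: opposite_on_def)
  then show ?thesis
    by (simp add: sign)
qed

text \<open>Only the condition on meridians and longitudes involves the orientation. Its sums change
  sign and remain 0, so the same integral charge, curves and ideal triangulation serve.\<close>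

lemma charge_opposite:
  assumes opp: "opposite_on W T \<mu> \<mu>'" and c: "charge N W \<mu> L T H c"
  shows "charge N W \<mu>' L T H c"
proof -
  obtain U \<psi> m l c' where 1: "tubular_neighbourhood W L U" "dual_ideal_triangulation W T H U \<psi>"
    and ml: "meridian_longitude_system W (spine_tets T H) U \<psi> m l"
    and ic: "integral_charge W \<mu> T H U \<psi> m l c'"
    and 2: "\<forall>a\<in>abstract_edges T. c a mod int N = (int (N div 2) + 1) * c' a mod int N"
    using c unfolding charge_def by blast
  have "(\<Sum>p\<leftarrow>s. passage_sign W \<mu>' p * c' (selected_edge p)) = 0"
    if C: "C \<in> connected_components_of (subtopology W (W frontier_of U))" and s: "s \<in> {m C, l C}" for C s
  proof -
    have "boundary_curve (spine_tets T H) \<psi> s"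
      using ml C s by (auto simp: meridian_longitude_system_def simple_boundary_curve_def)
    then have "passage_sign W \<mu>' p = - passage_sign W \<mu> p" if "p \<in> set s" for p
      using that passage_sign_opposite[OF opp, of "spine_tets T H" p]
      by (force simp: boundary_curve_def normal_curve_def spine_tets_def)
    then have "(\<Sum>p\<leftarrow>s. passage_sign W \<mu>' p * c' (selected_edge p))
        = (\<Sum>p\<leftarrow>s. - (passage_sign W \<mu> p * c' (selected_edge p)))"
      by (intro arg_cong[of _ _ sum_list] map_cong) auto
    also have "\<dots> = - (\<Sum>p\<leftarrow>s. passage_sign W \<mu> p * c' (selected_edge p))"
      by (rule uminus_sum_list_map[symmetric, unfolded o_def])
    also have "\<dots> = 0"
      using ic C s unfolding integral_charge_def by force
    finally show ?thesis .
  qed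
  then have "integral_charge W \<mu>' T H U \<psi> m l c'"
    using ic unfolding integral_charge_def by blast
  then show ?thesis
    using 1 2 ml unfolding charge_def by blast
qed

lemma decorated_triangulation_opposite:
  assumes "opposite_on W T \<mu> \<mu>'" "decorated_triangulation N W \<mu> L T H b z c"
  shows "decorated_triangulation N W \<mu>' L T H b (\<lambda>e. cnj_mat (z e)) c"
  using assms charge_opposite full_cocycle_cnj unfolding decorated_triangulation_def by blast

lemma determination_cnj:
  assumes "determination N b z d"
  shows "determination N b (\<lambda>e. cnj_mat (z e)) (cnj \<circ> d \<circ> cnj)"
proof -
  obtain D where D: "open D" "connected D" "0 \<notin> D" "{z e $ i $ j | e i j. e \<in> b} - {0} \<subseteq> D"
    "continuous_on D d" "\<forall>w\<in>D. d w ^ N = w"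
    using assms by (auto simp: determination_def)
  have cont: "continuous_on A cnj" for A
    by (intro continuous_intros)
  have img: "cnj ` D = cnj -` D"
    by (auto simp: image_iff) (metis complex_cnj_cnj)
  show ?thesis
    unfolding determination_def
  proof (intro exI[of _ "cnj ` D"] conjI)
    show "open (cnj ` D)"
      unfolding img by (intro open_vimage D(1) cont)
    show "connected (cnj ` D)"
      by (intro connected_continuous_image cont D(2))
    show "0 \<notin> cnj ` D"
      using D(3) by (simp add: img)
    show "{cnj_mat (z e) $ i $ j | e i j. e \<in> b} - {0} \<subseteq> cnj ` D"
    proof
      fix w assume "w \<in> {cnj_mat (z e) $ i $ j | e i j. e \<in> b} - {0}"
      then obtain e i j where "e \<in> b" "w = cnj (z e $ i $ j)" "z e $ i $ j \<noteq> 0"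
        by auto
      then show "w \<in> cnj ` D"
        using D(4) by blast
    qed
    have "continuous_on D (cnj \<circ> d)"
      by (intro continuous_on_compose D(5) cont)
    then have "continuous_on (cnj ` cnj ` D) (cnj \<circ> d)"
      by (simp add: image_image)
    then show "continuous_on (cnj ` D) (cnj \<circ> d \<circ> cnj)"
      by (rule continuous_on_compose[OF cont])
    show "\<forall>w\<in>cnj ` D. (cnj \<circ> d \<circ> cnj) w ^ N = w"
      using D(6) by (simp flip: complex_cnj_power)
  qed
qed

section \<open>Roots of unity and the functions of the quantum data\<close>

lemma omega_pow_nonzero [simp]: "omega_pow N n \<noteq> 0"
  by (simp add: omega_pow_def)

lemma omega_pow_add: "omega_pow N (a + b) = omega_pow N a * omega_pow N b"
  by (simp add: omega_pow_def power_int_add)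

lemma omega_pow_minus: "omega_pow N (- a) = inverse (omega_pow N a)"
  by (simp add: omega_pow_def power_int_minus)

lemma omega_pow_0 [simp]: "omega_pow N 0 = 1"
  by (simp add: omega_pow_def)

lemma cnj_omega_pow: "cnj (omega_pow N n) = omega_pow N (- n)"
proof -
  have "cnj (exp (2 * \<i> * of_real pi / of_nat N)) = inverse (exp (2 * \<i> * of_real pi / of_nat N))"
    by (simp add: exp_cnj flip: exp_minus)
  then show ?thesis
    by (simp add: omega_pow_def power_int_minus power_int_inverse complex_cnj_power_int)
qed

lemma omega_pow_period:
  assumes "N > 0"
  shows "omega_pow N (int N * k) = 1"
proof -
  have "exp (2 * \<i> * of_real pi / of_nat N) ^ N = exp (2 * of_real pi * \<i>)"
    using assms by (simp add: exp_of_nat_mult[symmetric] mult_ac)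
  then have "omega_pow N (int N) = 1"
    by (simp add: omega_pow_def)
  then show ?thesis
    by (simp add: omega_pow_def power_int_mult)
qed

lemma omega_pow_cong:
  assumes "N > 0" "a mod int N = b mod int N"
  shows "omega_pow N a = omega_pow N b"
proof -
  have "int N dvd a - b"
    using assms(2) by (simp add: mod_eq_dvd_iff)
  then obtain k where "a = b + int N * k"
    by (metis add.commute diff_eq_eq dvd_def)
  then show ?thesis
    using omega_pow_period[OF assms(1)] by (simp add: omega_pow_add)
qed

lemma omega_pow_cis: "omega_pow N (int k) = cis (2 * pi * real k / real N)"
proof -
  have "omega_pow N (int k) = cis (2 * pi / real N) ^ k"
    by (simp add: omega_pow_def cis_conv_exp mult_ac)
  also have "\<dots> = cis (real k * (2 * pi / real N))"
    by (rule Complex.DeMoivre)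
  finally show ?thesis
    by (simp add: mult_ac)
qed

lemma omega_pow_diff:
  assumes "N > 0" "j \<le> N"
  shows "omega_pow N (int (N - j)) = omega_pow N (- int j)"
proof -
  have "int (N - j) = int N * 1 + - int j"
    using assms by (simp add: of_nat_diff)
  then have "omega_pow N (int (N - j)) = omega_pow N (int N * 1) * omega_pow N (- int j)"
    by (simp only: omega_pow_add)
  then show ?thesis
    by (simp only: omega_pow_period[OF assms(1)] mult_1)
qed

text \<open>The factorization of \<open>w ^ N - 1\<close> over its simple roots, taken at
  \<open>w = z / x\<close> and multiplied by \<open>x ^ N\<close>.\<close>

lemma prod_minus_omega_pow:
  fixes x z :: complex
  assumes N: "N > 0"
  shows "(\<Prod>j<N. z - x * omega_pow N (int j)) = z ^ N - x ^ N"
proof (cases "x = 0")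
  case False
  define p where "p = Polynomial.monom (1::complex) N - 1"
  have poly_p: "poly p w = w ^ N - 1" for w
    by (simp add: p_def poly_monom)
  have "pderiv p = Polynomial.monom (of_nat N) (N - 1)"
    by (simp add: p_def pderiv_diff pderiv_monom)
  then have "poly p w = 0 \<Longrightarrow> poly (pderiv p) w \<noteq> 0" for w
    using N by (auto simp: poly_p poly_monom power_0_left)
  then have "rsquarefree p"
    by (auto simp: rsquarefree_roots)
  moreover have "lead_coeff p = 1"
  proof -
    have "degree p = degree (Polynomial.monom (1::complex) N)"
      unfolding p_def diff_conv_add_uminus
      by (rule degree_add_eq_left) (use N in \<open>simp add: degree_monom_eq\<close>)
    then show ?thesis
      using N by (simp add: p_def degree_monom_eq)
  qed
  ultimately have "(\<Prod>w | poly p w = 0. [:- w, 1:]) = p"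
    using complex_poly_decompose_rsquarefree[of p] by simp
  moreover have "bij_betw (\<lambda>k. omega_pow N (int k)) {..<N} {w. poly p w = 0}"
    using Complex.bij_betw_roots_unity[OF N] by (simp add: poly_p omega_pow_cis)
  ultimately have "(\<Prod>k<N. [:- omega_pow N (int k), 1:]) = p"
    using prod.reindex_bij_betw[of "\<lambda>k. omega_pow N (int k)" "{..<N}" "{w. poly p w = 0}" "\<lambda>w. [:- w, 1:]"] by simp
  then have "(\<Prod>k<N. w - omega_pow N (int k)) = w ^ N - 1" for w
    using poly_p[of w] by (metis (no_types, lifting) poly_prod prod.cong poly_pCons poly_0 mult_zero_right add_0_right mult.right_neutral add.commute uminus_add_conv_diff)
  then have "x ^ N * (\<Prod>k<N. z / x - omega_pow N (int k)) = x ^ N * ((z / x) ^ N - 1)"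
    by simp
  moreover have "x ^ N * (\<Prod>k<N. z / x - omega_pow N (int k)) = (\<Prod>k<N. x * (z / x - omega_pow N (int k)))"
    by (simp add: prod.distrib)
  moreover have "(\<Prod>k<N. x * (z / x - omega_pow N (int k))) = (\<Prod>k<N. z - x * omega_pow N (int k))"
    using False by (intro prod.cong) (simp_all add: right_diff_distrib)
  ultimately show ?thesis
    using False by (simp add: right_diff_distrib power_divide)
qed (use N in simp)

text \<open>The full product divided by its factor \<open>1 - v\<close>. Cancelling in polynomials
  includes \<open>v = 1\<close>, where the value \<open>N\<close> is needed for
  \<open>g_fun N 1\<close>.\<close>

lemma prod_one_minus_omega_pow:
  fixes v :: complex
  assumes N: "N > 0"
  shows "(\<Prod>j=1..<N. 1 - v * omega_pow N (int j)) = (\<Sum>k<N. v ^ k)"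
proof -
  let ?A = "\<Prod>j=1..<N. [:1, - omega_pow N (int j):]" and ?S = "\<Sum>k<N. Polynomial.monom (1::complex) k"
  have A: "poly ?A w = (\<Prod>j=1..<N. 1 - w * omega_pow N (int j))" for w
    by (simp add: poly_prod)
  have S: "poly ?S w = (\<Sum>k<N. w ^ k)" for w
    by (simp add: poly_sum poly_monom)
  have "poly ([:1, - 1:] * ?A) w = poly ([:1, - 1:] * ?S) w" for w
  proof -
    have "(1 - w) * (\<Prod>j=1..<N. 1 - w * omega_pow N (int j)) = (\<Prod>j<N. 1 - w * omega_pow N (int j))"
      using N by (simp add: prod.atLeast_Suc_lessThan lessThan_atLeast0)
    also have "\<dots> = 1 - w ^ N"
      using prod_minus_omega_pow[OF N, of 1 w] by simp
    also have "\<dots> = (1 - w) * (\<Sum>k<N. w ^ k)"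
      by (rule one_diff_power_eq)
    finally show ?thesis
      unfolding poly_mult A S by simp
  qed
  then have "[:1, - 1:] * ?A = [:1, - 1:] * ?S"
    by (simp only: poly_eq_poly_eq_iff[symmetric] fun_eq_iff) simp
  then have "?A = ?S"
    by (metis mult_left_cancel one_neq_zero pCons_eq_0_iff)
  then show ?thesis
    using A[of v] S[of v] by simp
qed

text \<open>The power \<open>N\<close> removes the dependence on the branch of the logarithm. For
  \<open>a = 0\<close> both sides vanish, as \<open>j > 0\<close>.\<close>

lemma powr_divide_power:
  fixes a :: complex
  assumes "N > 0" "j > 0"
  shows "(a powr (of_nat j / of_nat N)) ^ N = a ^ j"
proof (cases "a = 0")
  case False
  have "(a powr (of_nat j / of_nat N)) ^ N = exp (of_nat j / of_nat N * Ln a) ^ N"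
    using False by (simp only: powr_def if_False)
  also have "\<dots> = exp (of_nat N * (of_nat j / of_nat N * Ln a))"
    by (rule exp_of_nat_mult[symmetric])
  also have "\<dots> = exp (of_nat j * Ln a)"
    using assms by simp
  also have "\<dots> = exp (Ln a) ^ j"
    by (rule exp_of_nat_mult)
  also have "\<dots> = a ^ j"
    using False by simp
  finally show ?thesis .
qed (use assms in \<open>simp add: zero_power\<close>)

section \<open>The functions g and h up to N-th roots of unity\<close>

lemma g_fun_power:
  assumes "N > 0"
  shows "g_fun N w ^ N = (\<Prod>j=1..<N. (1 - w * omega_pow N (int j)) ^ j)"
  unfolding g_fun_def prod_power_distrib
  using assms by (intro prod.cong refl powr_divide_power) auto

text \<open>Conjugation inverts the roots of unity and so exchanges the indices \<open>j\<close> and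
  \<open>N - j\<close>; for each root the two exponents \<open>N - j\<close> and \<open>j\<close>
  add up to \<open>N\<close>.\<close>

lemma g_fun_cnj_power:
  assumes N: "N > 0"
  shows "(cnj (g_fun N w) * g_fun N (cnj w)) ^ N = (\<Sum>k<N. cnj w ^ k) ^ N"
proof -
  let ?t = "\<lambda>j. 1 - cnj w * omega_pow N (int j)"
  have "cnj (g_fun N w) ^ N = (\<Prod>j=1..<N. (1 - cnj w * omega_pow N (- int j)) ^ j)"
  proof -
    have "cnj (g_fun N w) ^ N = cnj (g_fun N w ^ N)"
      by simp
    then show ?thesis
      unfolding g_fun_power[OF N] by (simp add: cnj_omega_pow)
  qed
  also have "\<dots> = (\<Prod>j=1..<N. ?t j ^ (N - j))"
  proof (rule prod.reindex_bij_witness[of _ "\<lambda>j. N - j" "\<lambda>j. N - j"])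
    fix j assume j: "j \<in> {1..<N}"
    then have "omega_pow N (int (N - j)) = omega_pow N (- int j)"
      using N by (intro omega_pow_diff) auto
    then show "?t (N - j) ^ (N - (N - j)) = (1 - cnj w * omega_pow N (- int j)) ^ j"
      using j by simp
  qed auto
  finally have "(cnj (g_fun N w) * g_fun N (cnj w)) ^ N = (\<Prod>j=1..<N. ?t j ^ (N - j) * ?t j ^ j)"
    by (simp add: power_mult_distrib g_fun_power[OF N] prod.distrib)
  also have "\<dots> = (\<Prod>j=1..<N. ?t j ^ N)"
    by (intro prod.cong refl) (simp flip: power_add)
  also have "\<dots> = (\<Sum>k<N. cnj w ^ k) ^ N"
    by (simp only: prod_power_distrib[symmetric] prod_one_minus_omega_pow[OF N])
  finally show ?thesis .
qed

text \<open>With \<open>v = cnj w\<close>, the two powers in \<open>h_fun\<close> give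
  \<open>v\<close> to the exponent \<open>1 - N\<close>, because \<open>N = 2 * p + 1\<close>. Up to
  \<open>N\<close>-th roots of unity, the values of \<open>g_fun\<close> give the geometric sum of
  \<open>v\<close> and those at 1 give the denominator \<open>N\<close>. Together this is
  \<open>bracket N (1 / v)\<close>. The condition on \<open>w ^ N\<close> keeps the geometric sum
  from vanishing.\<close>

lemma h_fun_cnj_power:
  assumes N: "odd N" and w: "w \<noteq> 0" "w ^ N \<noteq> 1"
  shows "(cnj (h_fun N w) * h_fun N (cnj w)) ^ N = bracket N (1 / cnj w) ^ N"
    and "bracket N (1 / cnj w) \<noteq> 0"
proof -
  define v where "v = cnj w"
  define p where "p = N div 2"
  have N0: "N > 0" and Np: "N = 2 * p + 1"
    using N by (auto simp: odd_pos p_def)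
  have v: "v \<noteq> 0" "v ^ N \<noteq> 1" "v \<noteq> 1"
  proof -
    show "v \<noteq> 0" using w by (simp add: v_def)
    show "v ^ N \<noteq> 1" using w(2) by (metis complex_cnj_one complex_cnj_power complex_cnj_cnj v_def)
    then show "v \<noteq> 1" by auto
  qed
  let ?S = "\<Sum>k<N. v ^ k"
  have S: "?S = (1 - v ^ N) / (1 - v)"
    using v one_diff_power_eq[of v N] by (simp add: field_simps)
  have br: "bracket N (1 / v) = v powi (- 2 * int p) * ?S / of_nat N"
  proof -
    have "v powi (- 2 * int p) = 1 / v ^ (2 * p)"
      by (simp add: power_int_minus inverse_eq_divide power_int_mult flip: power_mult)
    moreover have "v ^ N = v * v ^ (2 * p)"
      by (simp add: Np)
    ultimately show ?thesis
      using v N0 unfolding bracket_def S by (simp add: power_divide divide_simps) (simp add: algebra_simps)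
  qed
  show "bracket N (1 / cnj w) \<noteq> 0"
    using v N0 S by (simp add: br flip: v_def)
  have g1: "(cnj (g_fun N 1) * g_fun N 1) ^ N = of_nat N ^ N"
    using g_fun_cnj_power[OF N0, of 1] by simp
  have hh: "cnj (h_fun N w) * h_fun N v = v powi (- 2 * int p) * (cnj (g_fun N w) * g_fun N v) / (cnj (g_fun N 1) * g_fun N 1)"
  proof -
    have "v powi (- 2 * int p) = v powi (- int p) * v powi (- int p)"
      using v by (simp flip: power_int_add)
    then show ?thesis
      by (simp add: h_fun_def p_def v_def complex_cnj_power_int)
  qed
  have "(A * B / C) ^ N = A ^ N * B ^ N / C ^ N" for A B C :: complex
    by (simp add: power_mult_distrib power_divide)
  then have "(cnj (h_fun N w) * h_fun N v) ^ N = (v powi (- 2 * int p)) ^ N * ?S ^ N / of_nat N ^ N"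
    unfolding hh by (simp only: g1 g_fun_cnj_power[OF N0, of w, folded v_def])
  then show "(cnj (h_fun N w) * h_fun N (cnj w)) ^ N = bracket N (1 / cnj w) ^ N"
    using br by (simp add: power_mult_distrib power_divide v_def)
qed

text \<open>Let \<open>k\<close> be the residue of \<open>n\<close>. Dividing the first argument by
  the root of unity shifts the factors of the second product to \<open>0..k - 1\<close>; conjugation
  moves the factors \<open>1..N - k\<close> of the first to \<open>k..N - 1\<close>. Together they
  fill a period, whose product is 1 by \<open>xyz\<close>.\<close>

lemma Omega1_reflect:
  assumes N: "N > 0" and xyz: "x ^ N + y ^ N = z ^ N" and y: "y \<noteq> 0" and mn: "(m + n) mod int N = 0"
  shows "cnj (Omega1 N (x, y, z) m) * Omega1 N (cnj x / omega_pow N 1, cnj y, cnj z) n = 1"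
proof -
  define k where "k = nat (n mod int N)"
  have k: "k < N" "int k = n mod int N"
    using N by (auto simp: k_def nat_less_iff)
  let ?f = "\<lambda>j. cnj y / (cnj z - cnj x * omega_pow N (int j))"
  have 2: "Omega1 N (cnj x / omega_pow N 1, cnj y, cnj z) n = (\<Prod>j<k. ?f j)"
  proof -
    have "Omega1 N (cnj x / omega_pow N 1, cnj y, cnj z) n
        = (\<Prod>j=1..k. cnj y / (cnj z - cnj x / omega_pow N 1 * omega_pow N (int j)))"
      by (simp add: Omega1_def k_def)
    also have "\<dots> = (\<Prod>j<k. ?f j)"
    proof (rule prod.reindex_bij_witness[of _ Suc "\<lambda>j. j - 1"])
      fix j assume "j \<in> {1..k}"
      then have "int j = 1 + int (j - 1)" by auto
      then have "omega_pow N (int j) = omega_pow N 1 * omega_pow N (int (j - 1))"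
        by (metis omega_pow_add)
      then show "?f (j - 1) = cnj y / (cnj z - cnj x / omega_pow N 1 * omega_pow N (int j))"
        by simp
    qed auto
    finally show ?thesis .
  qed
  have nonzero: "cnj z - cnj x * omega_pow N (int j) \<noteq> 0" for j
  proof
    assume "cnj z - cnj x * omega_pow N (int j) = 0"
    then have "cnj z ^ N = cnj x ^ N * omega_pow N (int j) ^ N"
      by (simp add: power_mult_distrib)
    moreover have "omega_pow N (int j) ^ N = 1"
      using omega_pow_period[OF N, of "int j"] by (simp add: omega_pow_def power_int_mult mult.commute flip: power_mult)
    ultimately have "z ^ N = x ^ N"
      by (metis complex_cnj_cancel_iff complex_cnj_power mult.right_neutral)
    then show False
      using xyz y by simp
  qed
  have all: "(\<Prod>j<N. ?f j) = 1"
  proof -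
    have "(\<Prod>j<N. ?f j) = cnj y ^ N / (cnj z ^ N - cnj x ^ N)"
      by (simp add: prod_dividef prod_minus_omega_pow[OF N])
    also have "cnj z ^ N - cnj x ^ N = cnj y ^ N"
      using xyz by (metis add_diff_cancel_left' complex_cnj_diff complex_cnj_power)
    finally show ?thesis
      using y by simp
  qed
  show ?thesis
  proof (cases "k = 0")
    \<comment> \<open>Here \<open>m\<close> has residue 0, and not \<open>N - k\<close>, and both
      products are empty.\<close>
    case True
    then have "m mod int N = 0"
      using mn k(2) by (metis add.right_neutral mod_add_right_eq of_nat_0)
    then show ?thesis
      unfolding 2 True by (simp add: Omega1_def)
  next
    case False
    have "m mod int N = int (N - k)"
    proof -
      have "m mod int N = (- int k) mod int N"
        using mn k(2) by (metis (no_types, opaque_lifting) add_diff_cancel_right' diff_0 mod_diff_eq mod_0 mod_mod_trivial)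
      also have "\<dots> = (int (N - k)) mod int N"
        using k(1) by (simp add: of_nat_diff)
      also have "\<dots> = int (N - k)"
        using False k(1) by (intro mod_pos_pos_trivial) auto
      finally show ?thesis .
    qed
    then have "cnj (Omega1 N (x, y, z) m) = (\<Prod>j=1..N - k. cnj y / (cnj z - cnj x * omega_pow N (- int j)))"
      by (simp add: Omega1_def cnj_omega_pow)
    also have "\<dots> = (\<Prod>j=k..<N. ?f j)"
    proof (rule prod.reindex_bij_witness[of _ "\<lambda>j. N - j" "\<lambda>j. N - j"])
      fix j assume j: "j \<in> {1..N - k}"
      then have "omega_pow N (int (N - j)) = omega_pow N (- int j)"
        using N by (intro omega_pow_diff) auto
      then show "?f (N - j) = cnj y / (cnj z - cnj x * omega_pow N (- int j))"
        by simp
    qed (use k(1) in auto)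
    finally have "cnj (Omega1 N (x, y, z) m) * Omega1 N (cnj x / omega_pow N 1, cnj y, cnj z) n
       = (\<Prod>j<k. ?f j) * (\<Prod>j=k..<N. ?f j)"
      by (simp only: 2 mult.commute)
    also have "\<dots> = (\<Prod>j<N. ?f j)"
      using k(1) by (simp add: lessThan_atLeast0 prod.atLeastLessThan_concat)
    finally show ?thesis
      by (simp only: all)
  qed
qed

section \<open>Conjugating the tensor of a tetrahedron\<close>

text \<open>The differences \<open>m' - n'\<close> and \<open>m - n\<close> are opposite modulo
  \<open>N\<close>, as \<open>Omega1_reflect\<close> requires, and the Gaussian exponent is even in
  \<open>n\<close>, so conjugation inverts that factor.\<close>

lemma Omega2_reflect:
  assumes N: "N > 0" and xyz: "x ^ N + y ^ N = z ^ N" and y: "y \<noteq> 0"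
    and m: "m' mod int N = (- m) mod int N" and n: "n' mod int N = (- n) mod int N"
  shows "cnj (Omega2 N (x, y, z) m' n') = 1 / Omega2 N (cnj x / omega_pow N 1, cnj y, cnj z) m n"
proof -
  let ?h = "int (N div 2) + 1"
  have "((m' - n') + (m - n)) mod int N = ((- m) - (- n) + (m - n)) mod int N"
    using m n by (intro mod_add_cong mod_diff_cong) auto
  then have "cnj (Omega1 N (x, y, z) (m' - n')) * Omega1 N (cnj x / omega_pow N 1, cnj y, cnj z) (m - n) = 1"
    by (intro Omega1_reflect[OF N xyz y]) simp
  then have 1: "cnj (Omega1 N (x, y, z) (m' - n')) = 1 / Omega1 N (cnj x / omega_pow N 1, cnj y, cnj z) (m - n)"
    by (metis eq_divide_imp mult_zero_right zero_neq_one)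
  have "(?h * n'\<^sup>2) mod int N = (?h * (- n)\<^sup>2) mod int N"
    using n by (intro mod_mult_cong refl) (simp only: power2_eq_square, intro mod_mult_cong, simp_all)
  then have "omega_pow N (?h * n'\<^sup>2) = omega_pow N (?h * n\<^sup>2)"
    by (intro omega_pow_cong[OF N]) simp
  then show ?thesis
    by (simp add: Omega2_def 1 cnj_omega_pow omega_pow_minus inverse_eq_divide)
qed

text \<open>The tensors agree factor by factor except for \<open>cnj \<nu>\<close> against the
  bracket divided by \<open>\<nu>\<close>; the ratio of these is \<zeta>, which involves no state.
  Congruences stand in place of \<open>a' = - a\<close> because states are stored as
  residues.\<close>

lemma tet_tensor_cnj_negative:
  fixes x :: "nat \<Rightarrow> nat \<Rightarrow> complex"
  assumes N: "odd N" and nz: "\<And>i j. \<lbrakk>i < j; j \<le> 3\<rbrakk> \<Longrightarrow> x i j \<noteq> 0"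
    and ptolemy: "(x 0 3 * x 1 2) ^ N + (x 0 1 * x 2 3) ^ N = (x 0 2 * x 1 3) ^ N"
  obtains \<zeta> where "\<zeta> ^ N = 1"
    and "\<And>a a'. (\<And>k. k \<le> 3 \<Longrightarrow> a' k mod int N = (- a k) mod int N) \<Longrightarrow>
      tet_tensor N 1 (\<lambda>i j. cnj (x i j)) c a = \<zeta> * cnj (tet_tensor N (- 1) x c a')"
proof -
  define X Y Z where "X = x 0 3 * x 1 2" and "Y = x 0 1 * x 2 3" and "Z = x 0 2 * x 1 3"
  have N0: "N > 0"
    using N by (simp add: odd_pos)
  have nonzero: "X \<noteq> 0" "Y \<noteq> 0" "Z \<noteq> 0"
    using nz by (simp_all add: X_def Y_def Z_def)
  have XYZ: "X ^ N + Y ^ N = Z ^ N"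
    using ptolemy by (simp add: X_def Y_def Z_def)
  define w where "w = Z / X"
  \<comment> \<open>\<open>w ^ N = 1\<close> would give \<open>Z ^ N = X ^ N\<close>, hence
    \<open>Y = 0\<close>.\<close>
  have w: "w \<noteq> 0" "w ^ N \<noteq> 1"
    using nonzero XYZ by (auto simp: w_def power_divide)
  define B where "B = bracket N (cnj X / cnj Z)"
  have B: "B = bracket N (1 / cnj w)"
    by (simp add: B_def w_def)
  have hB: "(cnj (h_fun N w) * h_fun N (cnj w)) ^ N = B ^ N" "B \<noteq> 0"
    using h_fun_cnj_power[OF N w] by (simp_all add: B)
  then have h0: "cnj (h_fun N w) \<noteq> 0" "h_fun N (cnj w) \<noteq> 0"
    using N0 by (auto simp: zero_power)
  define \<zeta> where "\<zeta> = B / (cnj (h_fun N w) * h_fun N (cnj w))"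
  have "\<zeta> ^ N = B ^ N / (cnj (h_fun N w) * h_fun N (cnj w)) ^ N"
    by (simp only: \<zeta>_def power_divide)
  then have "\<zeta> ^ N = 1"
    using hB N0 by (simp only:) simp
  moreover have "tet_tensor N 1 (\<lambda>i j. cnj (x i j)) c a = \<zeta> * cnj (tet_tensor N (- 1) x c a')"
    if a: "\<And>k. k \<le> 3 \<Longrightarrow> a' k mod int N = (- a k) mod int N" for a a'
  proof -
    let ?p = "N div 2" and ?half = "int (N div 2) + 1"
    have a0: "a' 0 mod int N = (- a 0) mod int N" and a1: "a' 1 mod int N = (- a 1) mod int N"
      and a2: "a' 2 mod int N = (- a 2) mod int N" and a3: "a' 3 mod int N = (- a 3) mod int N"
      by (simp_all add: a)
    have e1: "cnj (omega_pow N (c 1 2 * (a' 2 - a' 3) - ?half * c 0 1 * c 1 2))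
        = omega_pow N (c 1 2 * (a 2 - a 3) + ?half * c 0 1 * c 1 2)"
    proof -
      have "(c 1 2 * (a' 2 - a' 3) - ?half * c 0 1 * c 1 2) mod int N
          = (c 1 2 * ((- a 2) - (- a 3)) - ?half * c 0 1 * c 1 2) mod int N"
        by (intro mod_diff_cong mod_mult_cong refl a2 a3)
      then have "omega_pow N (c 1 2 * (a' 2 - a' 3) - ?half * c 0 1 * c 1 2)
          = omega_pow N (- (c 1 2 * (a 2 - a 3) + ?half * c 0 1 * c 1 2))"
        by (intro omega_pow_cong[OF N0]) (simp add: algebra_simps)
      then show ?thesis
        by (simp only: cnj_omega_pow minus_minus)
    qed
    have e2: "cnj (omega_pow N (a' 3 * a' 0)) = omega_pow N (- (a 3 * a 0))"
    proof -
      have "(a' 3 * a' 0) mod int N = ((- a 3) * (- a 0)) mod int N"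
        by (intro mod_mult_cong a3 a0)
      then have "omega_pow N (a' 3 * a' 0) = omega_pow N (a 3 * a 0)"
        by (intro omega_pow_cong[OF N0]) simp
      then show ?thesis
        by (simp add: cnj_omega_pow omega_pow_minus)
    qed
    have e3: "cnj (delta_mod N (a' 2 + a' 0 - a' 1)) = delta_mod N (a 2 + a 0 - a 1)"
    proof -
      have "(a' 2 + a' 0 - a' 1) mod int N = ((- a 2) + (- a 0) - (- a 1)) mod int N"
        by (intro mod_diff_cong mod_add_cong a0 a1 a2)
      also have "(- a 2) + (- a 0) - (- a 1) = - (a 2 + a 0 - a 1)"
        by simp
      finally have "int N dvd (a' 2 + a' 0 - a' 1) \<longleftrightarrow> int N dvd (a 2 + a 0 - a 1)"
        by (metis dvd_eq_mod_eq_0 dvd_minus_iff)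
      then show ?thesis
        by (simp add: delta_mod_def)
    qed
    have e4: "cnj (Omega2 N (X, Y, Z) (a' 2 - c 0 1) (a' 3))
        = 1 / Omega2 N (cnj X / omega_pow N 1, cnj Y, cnj Z) (a 2 + c 0 1) (a 3)"
    proof (rule Omega2_reflect[OF N0 XYZ nonzero(2) _ a3])
      have "(a' 2 - c 0 1) mod int N = (- a 2 - c 0 1) mod int N"
        by (intro mod_diff_cong a2 refl)
      then show "(a' 2 - c 0 1) mod int N = (- (a 2 + c 0 1)) mod int N"
        by (simp add: algebra_simps)
    qed
    have "cnj (tet_tensor N (- 1) x c a') = cnj Z ^ ?p * omega_pow N (c 1 2 * (a 2 - a 3) + ?half * c 0 1 * c 1 2)
        * cnj (h_fun N w) * omega_pow N (- (a 3 * a 0))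
        * (1 / Omega2 N (cnj X / omega_pow N 1, cnj Y, cnj Z) (a 2 + c 0 1) (a 3)) * delta_mod N (a 2 + a 0 - a 1)"
      unfolding tet_tensor_def Let_def X_def[symmetric] Y_def[symmetric] Z_def[symmetric] w_def[symmetric]
      by (simp only: simp_thms if_True complex_cnj_mult complex_cnj_power e1 e2 e3 e4)
    moreover have "tet_tensor N 1 (\<lambda>i j. cnj (x i j)) c a = cnj Z ^ ?p * omega_pow N (c 1 2 * (a 2 - a 3) + ?half * c 0 1 * c 1 2)
        * (B / h_fun N (cnj w)) * omega_pow N (- (a 3 * a 0))
        * (delta_mod N (a 2 + a 0 - a 1) / Omega2 N (cnj X / omega_pow N 1, cnj Y, cnj Z) (a 2 + c 0 1) (a 3))"
      unfolding tet_tensor_def Let_def complex_cnj_mult[symmetric] X_def[symmetric] Y_def[symmetric] Z_def[symmetric]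
        complex_cnj_divide[symmetric] w_def[symmetric]
      by (simp add: B_def)
    ultimately show ?thesis
      using h0 by (simp add: \<zeta>_def field_simps)
  qed
  ultimately show thesis
    by (rule that)
qed

text \<open>For index 1 the preceding case is applied to the conjugate entries with the two states
  exchanged, negation modulo \<open>N\<close> being an involution; solving for the other tensor
  turns the constant into \<open>1 / cnj \<zeta>\<close>.\<close>

lemma tet_tensor_cnj:
  fixes x :: "nat \<Rightarrow> nat \<Rightarrow> complex"
  assumes N: "odd N" and nz: "\<And>i j. \<lbrakk>i < j; j \<le> 3\<rbrakk> \<Longrightarrow> x i j \<noteq> 0"
    and ptolemy: "(x 0 3 * x 1 2) ^ N + (x 0 1 * x 2 3) ^ N = (x 0 2 * x 1 3) ^ N"
    and \<epsilon>: "\<epsilon> = 1 \<or> \<epsilon> = - 1"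
  obtains \<zeta> where "\<zeta> ^ N = 1"
    and "\<And>a a'. (\<And>k. k \<le> 3 \<Longrightarrow> a' k mod int N = (- a k) mod int N) \<Longrightarrow>
      tet_tensor N (- \<epsilon>) (\<lambda>i j. cnj (x i j)) c a = \<zeta> * cnj (tet_tensor N \<epsilon> x c a')"
  using \<epsilon>
proof
  assume e: "\<epsilon> = - 1"
  show ?thesis
  proof (rule tet_tensor_cnj_negative[OF N, of x c])
    show "x i j \<noteq> 0" if "i < j" "j \<le> 3" for i j
      by (rule nz[OF that])
    show "(x 0 3 * x 1 2) ^ N + (x 0 1 * x 2 3) ^ N = (x 0 2 * x 1 3) ^ N"
      by (rule ptolemy)
    fix \<zeta> assume 1: "\<zeta> ^ N = 1" and 2: "\<And>a a'. (\<And>k. k \<le> 3 \<Longrightarrow> a' k mod int N = (- a k) mod int N) \<Longrightarrow>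
      tet_tensor N 1 (\<lambda>i j. cnj (x i j)) c a = \<zeta> * cnj (tet_tensor N (- 1) x c a')"
    show thesis
      by (rule that[OF 1]) (unfold e minus_minus, rule 2, blast)
  qed
next
  assume e: "\<epsilon> = 1"
  have "cnj ((x 0 3 * x 1 2) ^ N + (x 0 1 * x 2 3) ^ N) = cnj ((x 0 2 * x 1 3) ^ N)"
    using ptolemy by simp
  then have "(cnj (x 0 3) * cnj (x 1 2)) ^ N + (cnj (x 0 1) * cnj (x 2 3)) ^ N = (cnj (x 0 2) * cnj (x 1 3)) ^ N"
    by simp
  then obtain \<zeta> where \<zeta>: "\<zeta> ^ N = 1" and eq: "\<And>a a'. (\<And>k. k \<le> 3 \<Longrightarrow> a' k mod int N = (- a k) mod int N) \<Longrightarrow>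
      tet_tensor N 1 (\<lambda>i j. cnj (cnj (x i j))) c a = \<zeta> * cnj (tet_tensor N (- 1) (\<lambda>i j. cnj (x i j)) c a')"
    using tet_tensor_cnj_negative[OF N, of "\<lambda>i j. cnj (x i j)" c] nz by auto
  have "\<zeta> \<noteq> 0"
    using \<zeta> N by (auto simp: zero_power odd_pos)
  show ?thesis
  proof (rule that[of "1 / cnj \<zeta>"])
    show "(1 / cnj \<zeta>) ^ N = 1"
      using \<zeta> by (simp add: power_divide flip: complex_cnj_power)
    fix a a' :: "nat \<Rightarrow> int"
    assume a: "\<And>k. k \<le> 3 \<Longrightarrow> a' k mod int N = (- a k) mod int N"
    have "tet_tensor N 1 x c a' = \<zeta> * cnj (tet_tensor N (- 1) (\<lambda>i j. cnj (x i j)) c a)"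
    proof -
      have "a k mod int N = (- a' k) mod int N" if "k \<le> 3" for k
        using mod_minus_cong[OF a[OF that]] by simp
      then show ?thesis
        using eq[of a a'] by simp
    qed
    then have "cnj (tet_tensor N 1 x c a') = cnj \<zeta> * tet_tensor N (- 1) (\<lambda>i j. cnj (x i j)) c a"
      by simp
    then show "tet_tensor N (- \<epsilon>) (\<lambda>i j. cnj (x i j)) c a = 1 / cnj \<zeta> * cnj (tet_tensor N \<epsilon> x c a')"
      using \<open>\<zeta> \<noteq> 0\<close> e by simp
  qed
qed

section \<open>Conjugating the state sum\<close>

lemma edge_path_reverse: "i \<noteq> j \<Longrightarrow> reverse_edge (edge_path f i j) = edge_path f j i"
  by (auto simp: reverse_edge_def edge_path_def restrict_def fun_eq_iff intro!: arg_cong[of _ _ f])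

lemma edge_path_in_oriented_edges:
  "\<lbrakk>f \<in> T; i \<le> 3; j \<le> 3; i \<noteq> j\<rbrakk> \<Longrightarrow> edge_path f i j \<in> oriented_edges T"
  by (auto simp: oriented_edges_def)

text \<open>A branching makes each tetrahedron a transitive tournament, in which the number of incoming
  edges increases along edges.\<close>

lemma branch_vertex_properties:
  assumes b: "branching T b" and f: "f \<in> T"
  shows "bij_betw (branch_vertex b f) {..3} {..3}"
    and "\<And>i j. \<lbrakk>i < j; j \<le> 3\<rbrakk> \<Longrightarrow> edge_path f (branch_vertex b f i) (branch_vertex b f j) \<in> b"
proof -
  define R where "R i j \<longleftrightarrow> edge_path f i j \<in> b" for i j
  define d where "d i = card {j. j \<le> 3 \<and> j \<noteq> i \<and> R j i}" for i
  let ?v = "branch_vertex b f"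
  have total: "R i j \<noteq> R j i" if "i \<le> 3" "j \<le> 3" "i \<noteq> j" for i j
  proof -
    have "(edge_path f i j \<in> b) \<noteq> (reverse_edge (edge_path f i j) \<in> b)"
      using b edge_path_in_oriented_edges[OF f that] unfolding branching_def by blast
    then show ?thesis
      by (simp add: R_def edge_path_reverse[OF that(3)])
  qed
  have acyclic: "\<not> (R i j \<and> R j k \<and> R k i)" if "i \<le> 3" "j \<le> 3" "k \<le> 3" "i \<noteq> j" "j \<noteq> k" "i \<noteq> k" for i j k
    using b f that unfolding branching_def R_def by blast
  \<comment> \<open>A predecessor of \<open>i\<close> is one of \<open>j\<close>, as otherwise a
    3-cycle would arise; \<open>i\<close> itself makes the inclusion strict.\<close>
  have d_less: "d i < d j" if ij: "i \<le> 3" "j \<le> 3" "i \<noteq> j" "R i j" for i j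
    unfolding d_def
  proof (rule psubset_card_mono)
    show "finite {k. k \<le> 3 \<and> k \<noteq> j \<and> R k j}"
      by (rule finite_subset[of _ "{..3}"]) auto
    show "{k. k \<le> 3 \<and> k \<noteq> i \<and> R k i} \<subset> {k. k \<le> 3 \<and> k \<noteq> j \<and> R k j}"
    proof
      show "{k. k \<le> 3 \<and> k \<noteq> i \<and> R k i} \<subseteq> {k. k \<le> 3 \<and> k \<noteq> j \<and> R k j}"
      proof
        fix k assume "k \<in> {k. k \<le> 3 \<and> k \<noteq> i \<and> R k i}"
        then have k: "k \<le> 3" "k \<noteq> i" "R k i"
          by auto
        have "k \<noteq> j"
          using total[of i j] ij k by blast
        moreover have "R k j"
          using total[of k j] acyclic[of i j k] ij k \<open>k \<noteq> j\<close> by blast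
        ultimately show "k \<in> {k. k \<le> 3 \<and> k \<noteq> j \<and> R k j}"
          using k by simp
      qed
      show "{k. k \<le> 3 \<and> k \<noteq> i \<and> R k i} \<noteq> {k. k \<le> 3 \<and> k \<noteq> j \<and> R k j}"
        using ij by blast
    qed
  qed
  have inj: "inj_on d {..3}"
  proof (rule inj_onI)
    fix i j assume ij: "i \<in> {..3}" "j \<in> {..3}" "d i = d j"
    show "i = j"
    proof (rule ccontr)
      assume "i \<noteq> j"
      then show False
        using total[of i j] d_less[of i j] d_less[of j i] ij by auto
    qed
  qed
  have "d i \<le> 3" if "i \<le> 3" for i
  proof -
    have "d i \<le> card ({..3} - {i})"
      unfolding d_def by (intro card_mono) auto
    then show ?thesis
      using that by simp
  qed
  then have "d ` {..3} = {..3}"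
    using inj by (intro card_subset_eq) (auto simp: card_image)
  then have bij: "bij_betw d {..3} {..3}"
    using inj by (simp add: bij_betw_def)
  have v: "?v k \<le> 3 \<and> d (?v k) = k" if k: "k \<le> 3" for k
  proof -
    have "\<exists>!i. i \<le> 3 \<and> d i = k"
    proof -
      obtain i where "i \<le> 3" "d i = k"
        using bij k by (auto simp: bij_betw_def image_iff set_eq_iff) (metis atMost_iff)
      moreover have "i' = i" if "i' \<le> 3" "d i' = k" for i'
        using inj_onD[OF inj, of i' i] that calculation by auto
      ultimately show ?thesis by blast
    qed
    from theI'[OF this] show ?thesis
      by (simp add: branch_vertex_def d_def R_def)
  qed
  have "inj_on ?v {..3}"
    by (rule inj_onI) (metis atMost_iff v)
  moreover have "?v ` {..3} \<subseteq> {..3}"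
    using v by auto
  ultimately show "bij_betw ?v {..3} {..3}"
    by (simp add: bij_betw_def endo_inj_surj)
  show "edge_path f (?v i) (?v j) \<in> b" if "i < j" "j \<le> 3" for i j
  proof (rule ccontr)
    assume "edge_path f (?v i) (?v j) \<notin> b"
    moreover have "?v i \<noteq> ?v j"
      using v[of i] v[of j] that by auto
    ultimately have "R (?v j) (?v i)"
      using total[of "?v i" "?v j"] v[of i] v[of j] that by (auto simp: R_def)
    then show False
      using d_less[of "?v j" "?v i"] v[of i] v[of j] that \<open>?v i \<noteq> ?v j\<close> by auto
  qed
qed

text \<open>The \<open>x\<^sub>i\<^sub>j\<close> are \<open>N\<close>-th roots of these entries, so this is the relation
  \<open>x\<^sup>N + y\<^sup>N = z\<^sup>N\<close> required of the arguments of \<open>\<Omega>\<close>.\<close>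

lemma cocycle_ptolemy:
  assumes z: "cocycle T z" and f: "f \<in> T" and v: "bij_betw v {..3::nat} {..3}"
  defines "x \<equiv> \<lambda>i j. z (edge_path f (v i) (v j)) $ 1 $ 2"
  shows "x 0 3 * x 1 2 + x 0 1 * x 2 3 = x 0 2 * x 1 3"
proof -
  let ?z = "\<lambda>i j. z (edge_path f (v i) (v j))"
  have vle: "v i \<le> 3" if "i \<le> 3" for i
    using bij_betw_apply[OF v, of i] that by simp
  have vne: "v i \<noteq> v j" if "i \<le> 3" "j \<le> 3" "i \<noteq> j" for i j
    using bij_betw_imp_inj_on[OF v] that by (auto dest: inj_onD)
  have tri: "?z i j ** ?z j k = ?z i k" if "i \<le> 3" "j \<le> 3" "k \<le> 3" "i \<noteq> j" "j \<noteq> k" "i \<noteq> k" for i j k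
    using z f vle vne that unfolding cocycle_def by blast
  have B: "?z i j $ 2 $ 1 = 0" "?z i j $ 1 $ 1 * ?z i j $ 2 $ 2 = 1" if "i \<le> 3" "j \<le> 3" "i \<noteq> j" for i j
  proof -
    have "?z i j \<in> B2C"
      using z edge_path_in_oriented_edges[OF f vle vle vne] that unfolding cocycle_def by blast
    then show "?z i j $ 2 $ 1 = 0" "?z i j $ 1 $ 1 * ?z i j $ 2 $ 2 = 1"
      by (auto simp: B2C_def det_2)
  qed
  define t s where "t i j = ?z i j $ 1 $ 1" and "s i j = ?z i j $ 2 $ 2" for i j
  have x: "x i k = t i j * x j k + x i j * s j k" and s: "s i k = s i j * s j k"
    if "i \<le> 3" "j \<le> 3" "k \<le> 3" "i \<noteq> j" "j \<noteq> k" "i \<noteq> k" for i j k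
  proof -
    have "?z i k $ 1 $ 2 = (?z i j ** ?z j k) $ 1 $ 2" "?z i k $ 2 $ 2 = (?z i j ** ?z j k) $ 2 $ 2"
      using tri[OF that] by simp_all
    then show "x i k = t i j * x j k + x i j * s j k" "s i k = s i j * s j k"
      using B(1)[of i j] that by (simp_all add: x_def t_def s_def matrix_matrix_mult_def sum_2)
  qed
  have x02: "x 0 2 = t 0 1 * x 1 2 + x 0 1 * s 1 2" and x13: "x 1 3 = t 1 2 * x 2 3 + x 1 2 * s 2 3"
    and x03: "x 0 3 = t 0 1 * x 1 3 + x 0 1 * (s 1 2 * s 2 3)"
    using x[of 0 1 2] x[of 0 1 3] x[of 1 2 3] s[of 1 2 3] by simp_all
  \<comment> \<open>The defect has the factor \<open>1 - t 1 2 * s 1 2\<close>, which is 0 because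
    the matrix on the edge from 1 to 2 has determinant 1.\<close>
  have "x 0 3 * x 1 2 + x 0 1 * x 2 3 = x 0 2 * x 1 3 + x 0 1 * x 2 3 * (1 - t 1 2 * s 1 2)"
    unfolding x03 x02 x13 by (simp add: algebra_simps)
  moreover have "t 1 2 * s 1 2 = 1"
    using B(2)[of 1 2] by (simp add: t_def s_def)
  ultimately show ?thesis
    by simp
qed

lemma determination_power:
  assumes "determination N b z d" "e \<in> b" "z e $ 1 $ 2 \<noteq> 0"
  shows "d (z e $ 1 $ 2) ^ N = z e $ 1 $ 2"
  using assms unfolding determination_def by blast

text \<open>The constant \<zeta> may depend on \<open>f\<close> but is fixed before the states, so
  that it can be taken out of the sum over states.\<close>

lemma tet_weight_opposite:
  assumes N: "odd N" and opp: "opposite_on W T \<mu> \<mu>'" and b: "branching T b" and z: "full_cocycle T z"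
    and d: "determination N b z d" and f: "f \<in> T"
  obtains \<zeta> where "\<zeta> ^ N = 1"
    and "\<And>\<alpha> \<alpha>'. (\<And>F. F \<in> tri_faces T \<Longrightarrow> \<alpha>' F mod int N = (- \<alpha> F) mod int N) \<Longrightarrow>
      tet_weight N W \<mu>' b (\<lambda>e. cnj_mat (z e)) c \<alpha> (cnj \<circ> d \<circ> cnj) f = \<zeta> * cnj (tet_weight N W \<mu> b z c \<alpha>' d f)"
proof -
  define v where "v = branch_vertex b f"
  have v: "bij_betw v {..3} {..3}" and vb: "\<And>i j. \<lbrakk>i < j; j \<le> 3\<rbrakk> \<Longrightarrow> edge_path f (v i) (v j) \<in> b"
    using branch_vertex_properties[OF b f] by (simp_all add: v_def)
  define y where "y i j = z (edge_path f (v i) (v j)) $ 1 $ 2" for i j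
  define x where "x i j = d (y i j)" for i j
  define c' where "c' i j = c (f, {v i, v j})" for i j
  have N0: "N > 0"
    using N by (simp add: odd_pos)
  have y0: "y i j \<noteq> 0" and xy: "x i j ^ N = y i j" if "i < j" "j \<le> 3" for i j
  proof -
    have "edge_path f (v i) (v j) \<in> oriented_edges T"
      using vb[OF that] b by (auto simp: branching_def)
    then show y0: "y i j \<noteq> 0"
      using z by (simp add: full_cocycle_def y_def)
    then show "x i j ^ N = y i j"
      using determination_power[OF d vb[OF that]] by (simp add: x_def y_def)
  qed
  have nz: "x i j \<noteq> 0" if "i < j" "j \<le> 3" for i j
    using y0[OF that] xy[OF that] N0 by (auto simp: zero_power)
  have "y 0 3 * y 1 2 + y 0 1 * y 2 3 = y 0 2 * y 1 3"
    using cocycle_ptolemy[OF _ f v, of z] z by (simp add: y_def full_cocycle_def)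
  then have pt: "(x 0 3 * x 1 2) ^ N + (x 0 1 * x 2 3) ^ N = (x 0 2 * x 1 3) ^ N"
    by (simp add: power_mult_distrib xy)
  define \<epsilon> where "\<epsilon> = tet_index W \<mu> b f"
  have \<epsilon>: "\<epsilon> = 1 \<or> \<epsilon> = - 1"
    by (simp add: \<epsilon>_def tet_index_def)
  have \<epsilon>': "tet_index W \<mu>' b f = - \<epsilon>"
    using opp f v by (simp add: \<epsilon>_def tet_index_def opposite_on_def v_def)
  obtain \<zeta> where \<zeta>: "\<zeta> ^ N = 1" and eq: "\<And>a a'. (\<And>k. k \<le> 3 \<Longrightarrow> a' k mod int N = (- a k) mod int N) \<Longrightarrow>
      tet_tensor N (- \<epsilon>) (\<lambda>i j. cnj (x i j)) c' a = \<zeta> * cnj (tet_tensor N \<epsilon> x c' a')"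
    using tet_tensor_cnj[OF N nz pt \<epsilon>] by blast
  show thesis
  proof (rule that[OF \<zeta>])
    fix \<alpha> \<alpha>' :: "'a set \<Rightarrow> int"
    assume \<alpha>: "\<And>F. F \<in> tri_faces T \<Longrightarrow> \<alpha>' F mod int N = (- \<alpha> F) mod int N"
    have face: "f ` open_face ({..3} - {v k}) \<in> tri_faces T" if "k \<le> 3" for k
    proof -
      have "v k \<in> {..3}"
        using bij_betw_apply[OF v, of k] that by simp
      then have "card ({..3} - {v k}) = 3"
        by simp
      then show ?thesis
        using f unfolding tri_faces_def by blast
    qed
    have "tet_weight N W \<mu>' b (\<lambda>e. cnj_mat (z e)) c \<alpha> (cnj \<circ> d \<circ> cnj) f
        = tet_tensor N (- \<epsilon>) (\<lambda>i j. cnj (x i j)) c' (\<lambda>k. \<alpha> (f ` open_face ({..3} - {v k})))"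
      by (simp add: tet_weight_def Let_def \<epsilon>' v_def[symmetric] x_def[abs_def] y_def c'_def[abs_def])
    also have "\<dots> = \<zeta> * cnj (tet_tensor N \<epsilon> x c' (\<lambda>k. \<alpha>' (f ` open_face ({..3} - {v k}))))"
      by (rule eq) (rule \<alpha>[OF face])
    also have "tet_tensor N \<epsilon> x c' (\<lambda>k. \<alpha>' (f ` open_face ({..3} - {v k}))) = tet_weight N W \<mu> b z c \<alpha>' d f"
      by (simp add: tet_weight_def Let_def \<epsilon>_def[symmetric] v_def[symmetric] x_def[abs_def] y_def c'_def[abs_def])
    finally show "tet_weight N W \<mu>' b (\<lambda>e. cnj_mat (z e)) c \<alpha> (cnj \<circ> d \<circ> cnj) f = \<zeta> * cnj (tet_weight N W \<mu> b z c \<alpha>' d f)" .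
  qed
qed

section \<open>Summation over states, and the sets of values\<close>

lemma bij_betw_negate_states:
  assumes "N > 0"
  shows "bij_betw (\<lambda>\<alpha>. \<lambda>F\<in>A. (- \<alpha> F) mod int N) (A \<rightarrow>\<^sub>E {0..<int N}) (A \<rightarrow>\<^sub>E {0..<int N})"
proof (rule bij_betw_byWitness[where f' = "\<lambda>\<alpha>. \<lambda>F\<in>A. (- \<alpha> F) mod int N"])
  let ?n = "\<lambda>\<alpha>. \<lambda>F\<in>A. (- \<alpha> F) mod int N"
  have "?n (?n \<alpha>) = \<alpha>" if "\<alpha> \<in> A \<rightarrow>\<^sub>E {0..<int N}" for \<alpha>
  proof
    fix F show "?n (?n \<alpha>) F = \<alpha> F"
    proof (cases "F \<in> A")
      case True
      then have "\<alpha> F \<in> {0..<int N}"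
        using that by auto
      then show ?thesis
        using True by (simp add: mod_minus_eq)
    next
      case False
      then show ?thesis
        using that by (simp add: PiE_def extensional_def)
    qed
  qed
  then show "\<forall>\<alpha>\<in>A \<rightarrow>\<^sub>E {0..<int N}. ?n (?n \<alpha>) = \<alpha>" "\<forall>\<alpha>\<in>A \<rightarrow>\<^sub>E {0..<int N}. ?n (?n \<alpha>) = \<alpha>"
    by blast+
  show "?n ` (A \<rightarrow>\<^sub>E {0..<int N}) \<subseteq> A \<rightarrow>\<^sub>E {0..<int N}" "?n ` (A \<rightarrow>\<^sub>E {0..<int N}) \<subseteq> A \<rightarrow>\<^sub>E {0..<int N}"
    using assms by auto
qed

text \<open>Negation permutes the states, so the conjugated sum can be reindexed; the edge factors
  conjugate by themselves and the power of \<open>N\<close> is real. The constants of the tetrahedra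
  multiply to an \<open>N\<close>-th root of unity, removed by the outer power.\<close>

lemma state_sum_opposite:
  assumes N: "odd N" and opp: "opposite_on W T \<mu> \<mu>'" and b: "branching T b" and z: "full_cocycle T z"
    and d: "determination N b z d"
  shows "state_sum N W \<mu>' T H b (\<lambda>e. cnj_mat (z e)) c (cnj \<circ> d \<circ> cnj) = cnj (state_sum N W \<mu> T H b z c d)"
proof -
  have N0: "N > 0"
    using N by (simp add: odd_pos)
  let ?A = "tri_faces T \<rightarrow>\<^sub>E {0..<int N}"
  let ?w = "\<lambda>\<alpha> f. tet_weight N W \<mu> b z c \<alpha> d f"
  let ?w' = "\<lambda>\<alpha> f. tet_weight N W \<mu>' b (\<lambda>e. cnj_mat (z e)) c \<alpha> (cnj \<circ> d \<circ> cnj) f"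
  let ?e = "\<Prod>e\<in>{e \<in> b. open_edge e \<notin> H}. d (z e $ 1 $ 2) powi (- 2 * int (N div 2))"
  let ?neg = "\<lambda>\<alpha>. \<lambda>F\<in>tri_faces T. (- \<alpha> F) mod int N"
  have "\<exists>\<zeta>. \<zeta> ^ N = 1 \<and> (\<forall>\<alpha> \<alpha>'. (\<forall>F\<in>tri_faces T. \<alpha>' F mod int N = (- \<alpha> F) mod int N) \<longrightarrow>
      ?w' \<alpha> f = \<zeta> * cnj (?w \<alpha>' f))" if "f \<in> T" for f
    using tet_weight_opposite[OF N opp b z d that, where c = c] by metis
  then obtain \<zeta> where \<zeta>: "\<And>f. f \<in> T \<Longrightarrow> \<zeta> f ^ N = 1"
    and w: "\<And>f \<alpha> \<alpha>'. \<lbrakk>f \<in> T; \<forall>F\<in>tri_faces T. \<alpha>' F mod int N = (- \<alpha> F) mod int N\<rbrakk> \<Longrightarrow> ?w' \<alpha> f = \<zeta> f * cnj (?w \<alpha>' f)"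
    by metis
  have ww: "(\<Prod>f\<in>T. ?w' \<alpha> f) = (\<Prod>f\<in>T. \<zeta> f) * cnj (\<Prod>f\<in>T. ?w (?neg \<alpha>) f)" for \<alpha>
  proof -
    have "(\<Prod>f\<in>T. ?w' \<alpha> f) = (\<Prod>f\<in>T. \<zeta> f * cnj (?w (?neg \<alpha>) f))"
      by (intro prod.cong refl w) simp_all
    then show ?thesis
      by (simp add: prod.distrib)
  qed
  have ee: "(\<Prod>e\<in>{e \<in> b. open_edge e \<notin> H}. (cnj \<circ> d \<circ> cnj) (cnj_mat (z e) $ 1 $ 2) powi (- 2 * int (N div 2))) = cnj ?e"
    by (simp add: complex_cnj_power_int)
  have "(\<Sum>\<alpha>\<in>?A. (\<Prod>f\<in>T. ?w' \<alpha> f) * cnj ?e) = (\<Sum>\<alpha>\<in>?A. (\<Prod>f\<in>T. \<zeta> f) * cnj ((\<Prod>f\<in>T. ?w (?neg \<alpha>) f) * ?e))"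
    by (simp only: ww complex_cnj_mult mult.assoc)
  also have "\<dots> = (\<Prod>f\<in>T. \<zeta> f) * (\<Sum>\<alpha>\<in>?A. cnj ((\<Prod>f\<in>T. ?w (?neg \<alpha>) f) * ?e))"
    by (simp only: sum_distrib_left)
  also have "(\<Sum>\<alpha>\<in>?A. cnj ((\<Prod>f\<in>T. ?w (?neg \<alpha>) f) * ?e)) = (\<Sum>\<alpha>\<in>?A. cnj ((\<Prod>f\<in>T. ?w \<alpha> f) * ?e))"
    by (rule sum.reindex_bij_betw[OF bij_betw_negate_states[OF N0]])
  finally have sum: "(\<Sum>\<alpha>\<in>?A. (\<Prod>f\<in>T. ?w' \<alpha> f) * cnj ?e) = (\<Prod>f\<in>T. \<zeta> f) * cnj (\<Sum>\<alpha>\<in>?A. (\<Prod>f\<in>T. ?w \<alpha> f) * ?e)"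
    by (simp only: cnj_sum)
  have "(\<Prod>f\<in>T. \<zeta> f) ^ N = 1"
    unfolding prod_power_distrib by (intro prod.neutral ballI \<zeta>)
  then show ?thesis
    unfolding state_sum_def ee sum
    by (simp only: power_divide power_mult_distrib complex_cnj_power complex_cnj_divide complex_cnj_of_nat mult_1)
qed

lemma state_sum_values_opposite_subset:
  assumes N: "odd N" and opp: "\<And>T. triangulation W T \<Longrightarrow> opposite_on W T \<mu> \<mu>'"
  shows "cnj ` state_sum_values N W \<mu> L \<rho> \<subseteq> state_sum_values N W \<mu>' L (conj_bundle ` \<rho>)"
proof
  fix s assume "s \<in> cnj ` state_sum_values N W \<mu> L \<rho>"
  then obtain T H b z c d where s: "s = cnj (state_sum N W \<mu> T H b z c d)"
    and dec: "decorated_triangulation N W \<mu> L T H b z c" and \<rho>: "flat_class W T z = \<rho>" and d: "determination N b z d"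
    by (auto simp: state_sum_values_def)
  have T: "opposite_on W T \<mu> \<mu>'"
    using dec by (intro opp) (simp add: decorated_triangulation_def distinguished_triangulation_def)
  have "s = state_sum N W \<mu>' T H b (\<lambda>e. cnj_mat (z e)) c (cnj \<circ> d \<circ> cnj)"
    using dec unfolding s by (intro state_sum_opposite[OF N T _ _ d, symmetric]) (simp_all add: decorated_triangulation_def)
  moreover have "flat_class W T (\<lambda>e. cnj_mat (z e)) = conj_bundle ` \<rho>"
    by (simp add: flat_class_cnj \<rho>)
  ultimately show "s \<in> state_sum_values N W \<mu>' L (conj_bundle ` \<rho>)"
    unfolding state_sum_values_def
    using decorated_triangulation_opposite[OF T dec] determination_cnj[OF d] by blast
qed

text \<open>As \<open>opposite_on\<close> is symmetric and \<open>conj_bundle\<close> an involution,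
  the inclusion of value sets also holds backwards and conjugation is a bijection between them. The
  case distinction of \<open>KN\<close> falls alike on both sides, and its default 0 is fixed by
  conjugation.\<close>

lemma KN_opposite:
  assumes N: "odd N" and opp: "\<And>T. triangulation W T \<Longrightarrow> opposite_on W T \<mu> \<mu>'"
  shows "cnj (KN N W \<mu> L \<rho>) = KN N W \<mu>' L (conj_bundle ` \<rho>)"
proof -
  let ?V = "state_sum_values N W \<mu> L \<rho>" and ?V' = "state_sum_values N W \<mu>' L (conj_bundle ` \<rho>)"
  have "cnj ` ?V' \<subseteq> ?V"
    using state_sum_values_opposite_subset[OF N opposite_on_sym[OF opp], of L "conj_bundle ` \<rho>"] by simp
  then have "cnj ` cnj ` ?V' \<subseteq> cnj ` ?V"
    by (rule image_mono)
  then have "?V' = cnj ` ?V"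
    using state_sum_values_opposite_subset[OF N opp, of L \<rho>] by (simp add: image_image)
  moreover have "is_singleton (cnj ` ?V) \<longleftrightarrow> is_singleton ?V"
    by (simp add: is_singleton_altdef card_image inj_on_def)
  moreover have "the_elem (cnj ` ?V) = cnj (the_elem ?V)" if "is_singleton ?V"
    using that by (auto elim!: is_singletonE)
  ultimately show ?thesis
    by (simp add: KN_def)
qed

theorem proposition4p5:
  fixes N :: nat and W :: "'w topology" and \<mu> :: "'w \<Rightarrow> 'w chain set" and L :: "'w set"
  assumes "odd N"
    and "closed_3_manifold W" and "manifold_orientation W \<mu>" and "link_in W L"
  shows "(\<forall>\<rho>\<in>flat_bundle_classes W.
            (\<forall>T H b z c. decorated_triangulation N W \<mu> L T H b z c \<and> flat_class W T z = \<rho> \<longrightarrow>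
               cnj (KN N W \<mu> L \<rho>) =
               KN N W (opposite_orientation W \<mu>) L (flat_class W T (\<lambda>e. cnj_mat (z e)))) \<and>
            (real_class W \<rho> \<longrightarrow>
               cnj (KN N W \<mu> L \<rho>) = KN N W (opposite_orientation W \<mu>) L \<rho>)) \<and>
         cnj (KN_trivial N W \<mu> L) = KN_trivial N W (opposite_orientation W \<mu>) L"
proof -
  have W: "Hausdorff_space W"
    using assms(2) by (simp add: closed_3_manifold_def)
  have "opposite_on W T \<mu> (opposite_orientation W \<mu>)" if "triangulation W T" for T
    unfolding opposite_on_def using orientation_agrees_opposite[OF W that _ assms(3)] by blast
  then have KN: "cnj (KN N W \<mu> L \<rho>) = KN N W (opposite_orientation W \<mu>) L (conj_bundle ` \<rho>)" for \<rho>
    by (rule KN_opposite[OF assms(1)])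
  \<comment> \<open>All three claims are instances: \<open>conj_bundle\<close> maps the class of
    \<open>z\<close> to that of its conjugate, and it fixes real classes and the trivial
    class.\<close>
  show ?thesis
    by (simp add: KN KN_trivial_def flat_class_cnj real_class_conj trivial_class_conj)
qed

end
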